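(* Let $d\ge2$ and assume that $M\sim\mathbb{Q}$ has a regularly varying tail with exponent $\alpha>d$ and that $M>0$ $\mathbb{P}$-a.s. Denote by $R_{\max,\rho}$ the maximal inradius of a cell of the Poisson--Laguerre tessellation with nucleus in $W_\rho$, i.e. the maximum of $r((x,m),\eta)$ over $(x,m)\in\eta\cap(W_\rho\times(0,\infty))$, and by $(X_{\max,\rho},M_{\max,\rho})$ the corresponding nucleus and its mark. Then, as $\rho\to\infty$, $$\Big(\frac1\rho X_{\max,\rho},\,\frac{1}{q_{\alpha,\rho}}M_{\max,\rho},\,\frac{1}{q_{\alpha,\rho}}R_{\max,\rho}\Big)\overset{d}{\longrightarrow}(X,F,F)$$ with independent $X\sim\operatorname{Unif}(W)$ and $F\sim\text{Fréchet}(\alpha)$, i.e. $\mathbb{P}(F\le u)=e^{-u^{-\alpha}}$ for any $u\ge0$ (read as $0$ for $u=0$).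
   Context: Fix $\gamma>0$ and a compact convex set $W\subseteq\mathbb{R}^d$ of volume one; $W_\rho:=\rho W$ for $\rho\ge1$; $\operatorname{Unif}(W)$ is the uniform distribution on $W$. $\lambda_d$ is Lebesgue measure on $\mathbb{R}^d$, $B^d(x,r)$ the closed ball with center $x$ and radius $r$. $\mathbb{Q}$ is a probability measure on $[0,\infty)$ (mark distribution) and $\eta$ is a Poisson process on $\mathbb{R}^d\times[0,\infty)$ with intensity measure $\gamma\lambda_d\otimes\mathbb{Q}$. Counting measures are also treated as sets of points. $M\sim\mathbb{Q}$ has a regularly varying tail with exponent $\alpha>0$ if $\mathbb{Q}((u,\infty))=l(u)u^{-\alpha}$ for all $u>0$, where $l:(0,\infty)\to[0,\infty)$ is slowly varying at $\infty$, i.e. $\lim_{v\to\infty}l(tv)/l(v)=1$ for any $t>0$. For $\rho\ge1$, $q_{\alpha,\rho}:=\gamma^{1/\alpha}q(\rho)$, where $q(\rho)$ is the $(1-\rho^{-d})$-quantile of $\mathbb{Q}$, i.e. $q(\rho)=\inf\{x\ge0:\mathbb{Q}([0,x])\ge1-\rho^{-d}\}$ (only $\rho>1$, where $q(\rho)>0$, is relevant). For a collection $\varphi$ of points of $\mathbb{R}^d\times[0,\infty)$ and $\mathbf{x}=(x,s)\in\varphi$, the Laguerre cell is $L(\mathbf{x},\varphi):=\{z\in\mathbb{R}^d:\|z-x\|^2-s^2\le\|z-y\|^2-t^2\text{ for all }(y,t)\in\varphi\}$, and the inradius is $r(\mathbf{x},\varphi):=\sup\{r\ge0:B^d(x,r)\subseteq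 L(\mathbf{x},\varphi)\}$ if $x\in L(\mathbf{x},\varphi)$ and $r(\mathbf{x},\varphi):=0$ otherwise. Convention: on the event that $\eta\cap(W_\rho\times(0,\infty))$ has no point, or that the maximal inradius is not attained by a unique point, the triple is set equal to $0\in\mathbb{R}^{d+2}$. *)

theory Defs
  imports "HOL-Probability.Probability"
begin

section \<open>Regular variation and quantiles\<close>

definition slowly_varying :: "(real \<Rightarrow> real) \<Rightarrow> bool" where
  "slowly_varying l \<longleftrightarrow> (\<forall>t>0. ((\<lambda>v. l (t * v) / l v) \<longlongrightarrow> 1) at_top)"

definition regularly_varying_tail :: "real measure \<Rightarrow> real \<Rightarrow> bool" where
  "regularly_varying_tail Q \<alpha> \<longleftrightarrow> \<alpha> > 0 \<and>
     (\<exists>l. (\<forall>u>0. l u \<ge> 0) \<and> slowly_varying l \<and>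
          (\<forall>u>0. measure Q {u<..} = l u * u powr (- \<alpha>)))"

definition quantile :: "real measure \<Rightarrow> real \<Rightarrow> real" where
  "quantile Q p = Inf {x. 0 \<le> x \<and> measure Q {0..x} \<ge> p}"

definition q_scale :: "real measure \<Rightarrow> real \<Rightarrow> real \<Rightarrow> nat \<Rightarrow> real \<Rightarrow> real" where
  "q_scale Q \<gamma> \<alpha> d \<rho> = \<gamma> powr (1 / \<alpha>) * quantile Q (1 - 1 / \<rho> ^ d)"


section \<open>Poisson processes\<close>

text \<open>A point process is a random locally finite counting measure: every realization takes
  natural number values on bounded measurable sets.\<close>

definition locally_finite_counting :: "'b::metric_space measure \<Rightarrow> bool" where
  "locally_finite_counting \<mu> \<longleftrightarrow>
     (\<forall>B\<in>sets \<mu>. bounded B \<longrightarrow> (\<exists>k::nat. emeasure \<mu> B = of_nat k))"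

text \<open>The Poisson probabilities are written out because \<^const>\<open>poisson_pmf\<close> is specified for
  positive rates only, whereas sets of intensity \<open>0\<close> must be covered as well. Sets of infinite
  intensity carry infinitely many points almost surely.\<close>

definition poisson_process ::
    "'w measure \<Rightarrow> 'b::metric_space measure \<Rightarrow> ('w \<Rightarrow> 'b measure) \<Rightarrow> bool" where
  "poisson_process P \<Lambda> \<eta> \<longleftrightarrow> prob_space P \<and>
     (\<forall>\<omega>\<in>space P. sets (\<eta> \<omega>) = sets \<Lambda> \<and> locally_finite_counting (\<eta> \<omega>)) \<and>
     (\<forall>B\<in>sets \<Lambda>. (\<lambda>\<omega>. emeasure (\<eta> \<omega>) B) \<in> borel_measurable P) \<and>
     (\<forall>B\<in>sets \<Lambda>. emeasure \<Lambda> B < \<infinity> \<longrightarrow>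
        (\<forall>k::nat. measure P {\<omega>\<in>space P. emeasure (\<eta> \<omega>) B = of_nat k}
                   = measure \<Lambda> B ^ k / fact k * exp (- measure \<Lambda> B))) \<and>
     (\<forall>B\<in>sets \<Lambda>. emeasure \<Lambda> B = \<infinity> \<longrightarrow> (AE \<omega> in P. emeasure (\<eta> \<omega>) B = \<infinity>)) \<and>
     (\<forall>(I::nat set) B. finite I \<and> B ` I \<subseteq> sets \<Lambda> \<and> disjoint_family_on B I \<longrightarrow>
        prob_space.indep_vars P (\<lambda>_. borel) (\<lambda>i \<omega>. emeasure (\<eta> \<omega>) (B i)) I)"

definition points :: "'b measure \<Rightarrow> 'b set" where
  "points \<mu> = {p\<in>space \<mu>. emeasure \<mu> {p} > 0}"


section \<open>Laguerre cells and their inradii\<close>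

definition laguerre_cell ::
    "'a::euclidean_space \<times> real \<Rightarrow> ('a \<times> real) set \<Rightarrow> 'a set" where
  "laguerre_cell p \<phi> =
     {z. \<forall>(y, t)\<in>\<phi>. (norm (z - fst p))\<^sup>2 - (snd p)\<^sup>2 \<le> (norm (z - y))\<^sup>2 - t\<^sup>2}"

text \<open>The inradius is \<open>\<infinity>\<close> when the cell is the whole space, hence the extended value.\<close>

definition inradius :: "'a::euclidean_space \<times> real \<Rightarrow> ('a \<times> real) set \<Rightarrow> ennreal" where
  "inradius p \<phi> =
     (if fst p \<in> laguerre_cell p \<phi>
      then Sup {ennreal r | r. r \<ge> 0 \<and> cball (fst p) r \<subseteq> laguerre_cell p \<phi>} else 0)"

definition nuclei :: "'a::euclidean_space set \<Rightarrow> ('a \<times> real) set \<Rightarrow> ('a \<times> real) set" where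
  "nuclei A \<phi> = \<phi> \<inter> (A \<times> {0<..})"

definition is_max_nucleus ::
    "'a::euclidean_space set \<Rightarrow> ('a \<times> real) set \<Rightarrow> 'a \<times> real \<Rightarrow> bool" where
  "is_max_nucleus A \<phi> p \<longleftrightarrow>
     p \<in> nuclei A \<phi> \<and> (\<forall>p'\<in>nuclei A \<phi>. inradius p' \<phi> \<le> inradius p \<phi>)"

text \<open>Nucleus, mark and inradius of the cell of maximal inradius with nucleus in \<open>A\<close>. The value is
  \<open>0\<close> unless exactly one point attains the maximum; in particular it is \<open>0\<close> if there is no nucleus
  in \<open>A\<close>. An infinite maximal inradius is sent to \<open>0\<close> by \<^const>\<open>enn2real\<close>; for a Poisson process
  this is an event of probability \<open>0\<close>.\<close>

definition max_triple ::
    "'a::euclidean_space set \<Rightarrow> ('a \<times> real) set \<Rightarrow> 'a \<times> real \<times> real" where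
  "max_triple A \<phi> =
     (if \<exists>!p. is_max_nucleus A \<phi> p
      then let p = (THE p. is_max_nucleus A \<phi> p) in (fst p, snd p, enn2real (inradius p \<phi>))
      else 0)"


section \<open>Independence and convergence in distribution\<close>

text \<open>\<^const>\<open>prob_space.indep_var\<close> requires both variables to have the same value type, so
  independence is stated directly for the generated \<open>\<sigma>\<close>-algebras.\<close>

definition independent_variables ::
    "'w measure \<Rightarrow> ('w \<Rightarrow> 'b::topological_space) \<Rightarrow> ('w \<Rightarrow> 'c::topological_space) \<Rightarrow> bool" where
  "independent_variables P X Y \<longleftrightarrow> X \<in> borel_measurable P \<and> Y \<in> borel_measurable P \<and>
     prob_space.indep_set P (sets (vimage_algebra (space P) X borel))
                            (sets (vimage_algebra (space P) Y borel))"

text \<open>The library's \<^const>\<open>weak_conv_m\<close> covers sequences of measures on the real line only.\<close>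

definition converges_in_distribution ::
    "'w measure \<Rightarrow> ('i \<Rightarrow> 'w \<Rightarrow> 'b::metric_space) \<Rightarrow> 'b measure \<Rightarrow> 'i filter \<Rightarrow> bool" where
  "converges_in_distribution P Y \<nu> F \<longleftrightarrow>
     (\<forall>\<^sub>F i in F. Y i \<in> borel_measurable P) \<and>
     (\<forall>f :: 'b \<Rightarrow> real. continuous_on UNIV f \<and> bounded (range f) \<longrightarrow>
        ((\<lambda>i. \<integral>\<omega>. f (Y i \<omega>) \<partial>P) \<longlongrightarrow> (\<integral>y. f y \<partial>\<nu>)) F)"

end

theory Submission
  imports Defs "HOL-Real_Asymp.Real_Asymp"
begin

text \<open>
Let \<open>v\<close> denote the scale \<^const>\<open>q_scale\<close> and \<open>d\<close> the dimension. The scale is normalized so that the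
number of nuclei in \<open>\<rho> W\<close> with mark above \<open>t v\<close> is Poisson with a mean that tends to \<open>t powr (- \<alpha>)\<close>
(\<open>tail_scale\<close>). Hence the largest mark, divided by \<open>v\<close>, is asymptotically Frechet distributed, and its
position is uniform. It remains to see that the largest inradius is attained at the nucleus with the
largest mark \<open>m\<close> and is close to \<open>m\<close>.

A point at distance \<open>l\<close> with mark \<open>t\<close> confines the inradius of a nucleus with mark \<open>m\<close> to
\<open>(l\<^sup>2 + m\<^sup>2 - t\<^sup>2) / (2 l)\<close>. For \<open>t = 0\<close> the minimum over \<open>l\<close> is \<open>m\<close>, attained at \<open>l = m\<close>. Two events make
this picture accurate at scale \<open>v\<close>. First, there are no holes: every lattice cube near \<open>\<rho> W\<close>
whose side is a small multiple of \<open>v\<close> contains a point, so that for each nucleus there is a point at almost any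
prescribed distance of order \<open>v\<close>. Since a cube is empty with probability exponentially small in \<open>v\<close>
and the tail of the marks is at least polynomial, this holds with probability tending to one
(\<open>no_hole_asymp\<close>); it bounds inradii from above. Second, there is no interference: no nucleus with mark
of order \<open>v\<close> is threatened by a second point with a mark of order \<open>v\<close> close by, or with an even larger
mark further away. A union bound over cubes of side \<open>v\<close> estimates the probability of interference by
the expected number of large marks times the \<open>d\<close>-th moment of the mark truncated at a multiple of
\<open>v\<close> (\<open>prob_interference_le\<close>). The moment is finite as \<open>\<alpha> > d\<close>, so the truncated moment vanishes in the
limit. This bounds the winning inradius from below (\<open>max_triple_of_dominant_mark\<close>).

On these events the rescaled triple lies in a small box around the diagonal as soon as exactly one
mark exceeds a level slightly below a short interval and that mark falls into the interval; the
probability of this is explicit (\<open>prob_box_lower\<close>). The resulting lower bounds on boxes almost exhaust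
the total mass one of the limit law when the boxes are fine, which gives weak convergence
(\<open>converges_of_box_bounds\<close>).

The triple has to be a random variable on a probability space that may be incomplete. This rests on
\<open>exists_point_measurable\<close>: the existence of a point of the configuration with a jointly measurable
property is an event.
\<close>

section \<open>Point configurations as measurable kernels\<close>

text \<open>Induction on the mass reduces to a set whose measurable subsets all have mass \<open>0\<close> or full mass.
Each set \<open>U\<close> of a countable base then cuts off a null part, either inside or outside \<open>U\<close>. After
deleting all these null parts the mass is unchanged, and no base set separates two of the
remaining points, so a single point carries the whole mass.\<close>

lemma counting_measure_has_atom:
  fixes \<mu> :: "'b::{second_countable_topology, t1_space} measure"
  assumes open_sets: "\<And>U. open U \<Longrightarrow> U \<inter> space \<mu> \<in> sets \<mu>"
    and "B \<in> sets \<mu>" "emeasure \<mu> B = of_nat k" "k > 0"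
    and "\<And>A. A \<in> sets \<mu> \<Longrightarrow> A \<subseteq> B \<Longrightarrow> \<exists>j::nat. emeasure \<mu> A = of_nat j"
  shows "\<exists>p\<in>B. emeasure \<mu> {p} > 0"
  using assms(2-)
proof (induction k arbitrary: B rule: less_induct)
  case (less k)
  note B [measurable] = less.prems(1)
  show ?case
  proof (cases "\<exists>A\<in>sets \<mu>. A \<subseteq> B \<and> emeasure \<mu> A \<noteq> 0 \<and> emeasure \<mu> A \<noteq> of_nat k")
    case True
    then obtain A where A: "A \<in> sets \<mu>" "A \<subseteq> B" "emeasure \<mu> A \<noteq> 0" "emeasure \<mu> A \<noteq> of_nat k"
      by blast
    obtain j where j: "emeasure \<mu> A = of_nat j" using less.prems(4) A by blast
    have "emeasure \<mu> A \<le> of_nat k"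
      using emeasure_mono[OF A(2) B] less.prems(2) by simp
    then have "j < k" "j > 0" using A(3,4) j by (auto simp: order.order_iff_strict)
    with less.IH[of j A] j A less.prems(4) show ?thesis by (meson order_trans subsetD)
  next
    case False
    then have dich: "emeasure \<mu> A = 0 \<or> emeasure \<mu> A = of_nat k" if "A \<in> sets \<mu>" "A \<subseteq> B" for A
      using that by blast
    obtain \<U> :: "'b set set" where \<U>: "countable \<U>" "topological_basis \<U>"
      using ex_countable_basis by blast
    have BU [measurable]: "B \<inter> U \<in> sets \<mu>" if "U \<in> \<U>" for U
    proof -
      have "B \<inter> U = B \<inter> (U \<inter> space \<mu>)" using sets.sets_into_space[OF B] by blast
      then show ?thesis using open_sets topological_basis_open[OF \<U>(2) that] by auto
    qed
    have BmU [measurable]: "B - U \<in> sets \<mu>" if "U \<in> \<U>" for U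
    proof -
      have "B - U = B - (B \<inter> U)" by blast
      then show ?thesis using BU[OF that] by (metis B sets.Diff)
    qed
    define N where "N = (\<Union>U\<in>{U\<in>\<U>. emeasure \<mu> (B \<inter> U) = 0}. B \<inter> U)
                      \<union> (\<Union>U\<in>{U\<in>\<U>. emeasure \<mu> (B - U) = 0}. B - U)"
    \<comment> \<open>\<open>N\<close> collects, over the countable base, the null part on either side of each base set.\<close>
    have N: "N \<in> null_sets \<mu>"
      unfolding N_def using \<U>(1) BU BmU
      by (intro null_sets.Un null_sets_UN') (auto intro: countable_subset[OF _ \<U>(1)])
    have mass: "emeasure \<mu> (B - N) = of_nat k"
      using emeasure_Diff_null_set[OF N B] less.prems(2) by simp
    then have "B - N \<noteq> {}" using less.prems(3) by (metis emeasure_empty of_nat_0_eq_iff less_irrefl)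
    then obtain p where p: "p \<in> B - N" by blast
    have "p' = p" if p': "p' \<in> B - N" for p'
    proof (rule ccontr)
      assume "p' \<noteq> p"
      then obtain U0 where "open U0" "p \<in> U0" "p' \<notin> U0" using t1_space by metis
      then obtain U where U: "U \<in> \<U>" "p \<in> U" "p' \<notin> U"
        using topological_basisE[OF \<U>(2)] by (metis subsetD)
      have fin: "emeasure \<mu> (B \<inter> U) \<noteq> \<infinity>" using dich[OF BU[OF U(1)]] by auto
      have "B - U = B - (B \<inter> U)" by blast
      then have "emeasure \<mu> (B - U) = emeasure \<mu> B - emeasure \<mu> (B \<inter> U)"
        using emeasure_Diff[OF fin B BU[OF U(1)]] by auto
      moreover have "emeasure \<mu> (B \<inter> U) \<noteq> 0" using p U unfolding N_def by blast
      ultimately have "emeasure \<mu> (B - U) = 0"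
        using dich[OF BU[OF U(1)]] less.prems(2) by auto
      then show False using p' U unfolding N_def by blast
    qed
    then have "B - N = {p}" using p by blast
    then show ?thesis using mass p less.prems(3) by (metis DiffD1 of_nat_0_less_iff)
  qed
qed

text \<open>The configuration may depend on a point of an arbitrary measurable space. This generality is used
for \<open>\<Omega> \<times> S\<close> with \<open>S\<close> the space of marked points: properties of a point relative to the random
configuration live there, and quantifiers over points can then be nested.\<close>

locale point_kernel =
  fixes M :: "'w measure" and \<Lambda> :: "'b::euclidean_space measure" and \<eta> :: "'w \<Rightarrow> 'b measure"
  assumes sets_kernel: "\<And>\<omega>. \<omega> \<in> space M \<Longrightarrow> sets (\<eta> \<omega>) = sets \<Lambda>"
    and counting: "\<And>\<omega>. \<omega> \<in> space M \<Longrightarrow> locally_finite_counting (\<eta> \<omega>)"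
    and measurable_count: "\<And>B. B \<in> sets \<Lambda> \<Longrightarrow> (\<lambda>\<omega>. emeasure (\<eta> \<omega>) B) \<in> borel_measurable M"
    and space_nonempty: "space \<Lambda> \<noteq> {}"
    and borel_trace: "\<And>A. A \<in> sets borel \<Longrightarrow> A \<inter> space \<Lambda> \<in> sets \<Lambda>"
begin

lemma space_kernel: "\<omega> \<in> space M \<Longrightarrow> space (\<eta> \<omega>) = space \<Lambda>"
  by (rule sets_eq_imp_space_eq[OF sets_kernel])

lemma bounded_count:
  assumes "\<omega> \<in> space M" "B \<in> sets \<Lambda>" "bounded B"
  obtains k :: nat where "emeasure (\<eta> \<omega>) B = of_nat k"
  using counting[OF assms(1)] assms(2,3) unfolding locally_finite_counting_def sets_kernel[OF assms(1)]
  by blast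

lemma singleton_sets: "p \<in> space \<Lambda> \<Longrightarrow> {p} \<in> sets \<Lambda>"
  using borel_trace[of "{p}"] by simp

lemma point_count_ge_1:
  assumes "\<omega> \<in> space M" "p \<in> points (\<eta> \<omega>)"
  shows "emeasure (\<eta> \<omega>) {p} \<ge> 1"
proof -
  have p: "p \<in> space \<Lambda>" "emeasure (\<eta> \<omega>) {p} > 0"
    using assms space_kernel by (auto simp: points_def)
  obtain k :: nat where k: "emeasure (\<eta> \<omega>) {p} = of_nat k"
    using bounded_count[OF assms(1) singleton_sets[OF p(1)]] by auto
  then have "k \<ge> 1" using p(2) by (cases k) auto
  then show ?thesis unfolding k by (metis of_nat_1 of_nat_mono)
qed

text \<open>Counts are natural numbers on bounded sets only, so the atom is sought in the intersection of \<open>B\<close>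
with a ball that receives positive mass.\<close>

lemma exists_point_iff:
  assumes \<omega>: "\<omega> \<in> space M" and B: "B \<in> sets \<Lambda>"
  shows "(\<exists>p\<in>points (\<eta> \<omega>). p \<in> B) \<longleftrightarrow> emeasure (\<eta> \<omega>) B > 0"
proof
  assume "\<exists>p\<in>points (\<eta> \<omega>). p \<in> B"
  then obtain p where p: "p \<in> points (\<eta> \<omega>)" "p \<in> B" by blast
  have "emeasure (\<eta> \<omega>) {p} \<le> emeasure (\<eta> \<omega>) B"
    using p B by (intro emeasure_mono) (auto simp: sets_kernel[OF \<omega>])
  then show "emeasure (\<eta> \<omega>) B > 0" using p by (auto simp: points_def)
next
  assume pos: "emeasure (\<eta> \<omega>) B > 0"
  have Bn: "B \<inter> ball 0 (real n) \<in> sets \<Lambda>" for n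
  proof -
    have "B \<inter> ball 0 (real n) = B \<inter> (ball 0 (real n) \<inter> space \<Lambda>)"
      using sets.sets_into_space[OF B] by blast
    then show ?thesis using borel_trace[of "ball 0 (real n)"] B by simp
  qed
  have "(\<Union>n. B \<inter> ball 0 (real n)) = B"
    by (auto simp: reals_Archimedean2)
  moreover have "(\<Union>n. B \<inter> ball 0 (real n)) \<in> null_sets (\<eta> \<omega>)"
    if "\<And>n. emeasure (\<eta> \<omega>) (B \<inter> ball 0 (real n)) = 0"
    using that Bn by (intro null_sets_UN) (auto simp: sets_kernel[OF \<omega>])
  ultimately obtain n where n: "emeasure (\<eta> \<omega>) (B \<inter> ball 0 (real n)) \<noteq> 0"
    using pos by (metis null_setsD1 less_irrefl)
  have bdd: "bounded (B \<inter> ball 0 (real n))" by (simp add: bounded_Int)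
  obtain k :: nat where k: "emeasure (\<eta> \<omega>) (B \<inter> ball 0 (real n)) = of_nat k"
    using bounded_count[OF \<omega> Bn bdd] by blast
  have "\<exists>p\<in>B \<inter> ball 0 (real n). emeasure (\<eta> \<omega>) {p} > 0"
  proof (rule counting_measure_has_atom[OF _ _ k])
    show "U \<inter> space (\<eta> \<omega>) \<in> sets (\<eta> \<omega>)" if "open U" for U
      using that borel_trace[of U] by (simp add: sets_kernel[OF \<omega>] space_kernel[OF \<omega>])
    show "B \<inter> ball 0 (real n) \<in> sets (\<eta> \<omega>)" using Bn by (simp add: sets_kernel[OF \<omega>])
    show "k > 0" using n k by (cases k) auto
    show "\<exists>j::nat. emeasure (\<eta> \<omega>) A = of_nat j" if "A \<in> sets (\<eta> \<omega>)" "A \<subseteq> B \<inter> ball 0 (real n)" for A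
      using bounded_count[OF \<omega>, of A] that bounded_subset[OF bdd that(2)]
      by (metis sets_kernel[OF \<omega>])
  qed
  then show "\<exists>p\<in>points (\<eta> \<omega>). p \<in> B"
    using sets.sets_into_space[OF B] by (auto simp: points_def space_kernel[OF \<omega>])
qed

lemma two_points_count:
  assumes \<omega>: "\<omega> \<in> space M" and B: "B \<in> sets \<Lambda>"
    and p: "p \<in> points (\<eta> \<omega>)" and q: "q \<in> points (\<eta> \<omega>)" and neq: "p \<noteq> q"
    and pB: "p \<in> B" and qB: "q \<in> B"
  shows "2 \<le> emeasure (\<eta> \<omega>) B"
proof -
  have sing: "{p} \<in> sets (\<eta> \<omega>)" "{q} \<in> sets (\<eta> \<omega>)"
    using p q singleton_sets by (auto simp: points_def sets_kernel[OF \<omega>] space_kernel[OF \<omega>])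
  have "1 + 1 \<le> emeasure (\<eta> \<omega>) {p} + emeasure (\<eta> \<omega>) {q}"
    using point_count_ge_1[OF \<omega> p] point_count_ge_1[OF \<omega> q] by (rule add_mono)
  also have "\<dots> = emeasure (\<eta> \<omega>) ({p} \<union> {q})"
    using sing neq by (intro plus_emeasure) auto
  also have "\<dots> \<le> emeasure (\<eta> \<omega>) B"
    using pB qB B by (intro emeasure_mono) (auto simp: sets_kernel[OF \<omega>])
  finally show ?thesis by simp
qed

text \<open>The basic tool for measurability. The event says that the section of \<open>R\<close> at \<open>\<omega>\<close> has positive mass.
Restricted to a ball and divided by one plus the number of points in it, the random configuration
becomes a subprobability kernel, and for such kernels the mass of a section is a measurable
function of the parameter.\<close>

lemma exists_point_measurable:
  assumes R: "Measurable.pred (M \<Otimes>\<^sub>M \<Lambda>) (\<lambda>(\<omega>, p). R \<omega> p)"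
  shows "Measurable.pred M (\<lambda>\<omega>. \<exists>p\<in>points (\<eta> \<omega>). R \<omega> p)"
proof -
  define C where "C n = ball 0 (real n) \<inter> space \<Lambda>" for n
  have C [measurable]: "C n \<in> sets \<Lambda>" for n unfolding C_def by (rule borel_trace) simp
  define c where "c n \<omega> = emeasure (\<eta> \<omega>) (C n)" for n \<omega>
  have c [measurable]: "c n \<in> borel_measurable M" for n
    unfolding c_def by (rule measurable_count[OF C])
  have cfin: "c n \<omega> < \<infinity>" if w: "\<omega> \<in> space M" for n \<omega>
  proof -
    have "bounded (C n)" unfolding C_def by (simp add: bounded_Int)
    then obtain k :: nat where "c n \<omega> = of_nat k" unfolding c_def using bounded_count[OF w C] by blast
    then show ?thesis by (simp add: of_nat_less_top)
  qed
  define L where "L n \<omega> = scale_measure (1 / (1 + c n \<omega>)) (density (\<eta> \<omega>) (indicator (C n)))" for n \<omega>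
  have eL: "emeasure (L n \<omega>) B = (1 / (1 + c n \<omega>)) * emeasure (\<eta> \<omega>) (C n \<inter> B)"
    if "\<omega> \<in> space M" "B \<in> sets \<Lambda>" for n \<omega> B
    unfolding L_def using that C[of n]
    by (subst emeasure_scale_measure, subst emeasure_restricted) (auto simp: sets_kernel[OF that(1)])
  have sL: "sets (L n \<omega>) = sets \<Lambda>" if "\<omega> \<in> space M" for n \<omega>
    unfolding L_def by (simp add: sets_kernel[OF that])
  have Lm [measurable]: "L n \<in> measurable M (subprob_algebra \<Lambda>)" for n
  proof (rule measurable_subprob_algebra)
    fix \<omega> assume \<omega>: "\<omega> \<in> space M"
    have "space (L n \<omega>) = space \<Lambda>" by (rule sets_eq_imp_space_eq[OF sL[OF \<omega>]])
    moreover have "emeasure (L n \<omega>) (space \<Lambda>) \<le> 1"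
    proof -
      have "C n \<inter> space \<Lambda> = C n" unfolding C_def by blast
      then have "emeasure (L n \<omega>) (space \<Lambda>) = c n \<omega> / (1 + c n \<omega>)"
        using eL[OF \<omega>, of "space \<Lambda>" n] by (simp add: c_def ennreal_times_divide mult.commute)
      also have "\<dots> \<le> (1 + c n \<omega>) / (1 + c n \<omega>)" by (intro divide_right_mono_ennreal) simp
      also have "\<dots> = 1" using cfin[OF \<omega>, of n] by (intro ennreal_divide_self) (auto simp: less_top)
      finally show ?thesis .
    qed
    ultimately show "subprob_space (L n \<omega>)"
      by (intro subprob_spaceI) (simp_all add: space_nonempty)
  next
    show "sets (L n \<omega>) = sets \<Lambda>" if "\<omega> \<in> space M" for \<omega> by (rule sL[OF that])
  next
    fix B assume B [measurable]: "B \<in> sets \<Lambda>"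
    have [measurable]: "(\<lambda>\<omega>. emeasure (\<eta> \<omega>) (C n \<inter> B)) \<in> borel_measurable M"
      by (rule measurable_count) simp
    have "(\<lambda>\<omega>. (1 / (1 + c n \<omega>)) * emeasure (\<eta> \<omega>) (C n \<inter> B)) \<in> borel_measurable M" by measurable
    then show "(\<lambda>\<omega>. emeasure (L n \<omega>) B) \<in> borel_measurable M"
      using measurable_cong[of M "\<lambda>\<omega>. emeasure (L n \<omega>) B"] eL[OF _ B] by simp
  qed
  have sect: "{p \<in> space \<Lambda>. R \<omega> p} \<in> sets \<Lambda>" if "\<omega> \<in> space M" for \<omega>
    using R that by measurable
  have "(\<exists>p\<in>points (\<eta> \<omega>). R \<omega> p) \<longleftrightarrow> (\<exists>n. emeasure (L n \<omega>) {p \<in> space \<Lambda>. R \<omega> p} > 0)"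
    if \<omega>: "\<omega> \<in> space M" for \<omega>
  proof -
    have "emeasure (L n \<omega>) {p \<in> space \<Lambda>. R \<omega> p} > 0
            \<longleftrightarrow> emeasure (\<eta> \<omega>) (C n \<inter> {p \<in> space \<Lambda>. R \<omega> p}) > 0" for n
      using cfin[OF \<omega>, of n]
      by (subst eL[OF \<omega> sect[OF \<omega>]]) (auto simp: ennreal_zero_less_mult_iff zero_less_iff_neq_zero)
    also have "\<dots> n \<longleftrightarrow> (\<exists>p\<in>points (\<eta> \<omega>). p \<in> C n \<inter> {p \<in> space \<Lambda>. R \<omega> p})" for n
      using sect[OF \<omega>] by (intro exists_point_iff[OF \<omega>, symmetric]) simp
    finally have *: "emeasure (L n \<omega>) {p \<in> space \<Lambda>. R \<omega> p} > 0
      \<longleftrightarrow> (\<exists>p\<in>points (\<eta> \<omega>). p \<in> C n \<inter> {p \<in> space \<Lambda>. R \<omega> p})" for n .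
    have "p \<in> space \<Lambda>" if "p \<in> points (\<eta> \<omega>)" for p
      using that by (simp add: points_def space_kernel[OF \<omega>])
    then show ?thesis unfolding * C_def using reals_Archimedean2 by fastforce
  qed
  moreover have "Measurable.pred M (\<lambda>\<omega>. \<exists>n. emeasure (L n \<omega>) {p \<in> space \<Lambda>. R \<omega> p} > 0)"
  proof -
    have "(SIGMA \<omega>:space M. {p \<in> space \<Lambda>. R \<omega> p}) = {x \<in> space (M \<Otimes>\<^sub>M \<Lambda>). case x of (\<omega>, p) \<Rightarrow> R \<omega> p}"
      by (auto simp: space_pair_measure)
    then have "(SIGMA \<omega>:space M. {p \<in> space \<Lambda>. R \<omega> p}) \<in> sets (M \<Otimes>\<^sub>M \<Lambda>)"
      using R by (simp add: pred_def)
    from emeasure_measurable_subprob_algebra2[OF this Lm]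
    have [measurable]: "(\<lambda>\<omega>. emeasure (L n \<omega>) {p \<in> space \<Lambda>. R \<omega> p}) \<in> borel_measurable M" for n .
    show ?thesis by measurable
  qed
  ultimately show ?thesis by (subst measurable_cong) auto
qed

lemma product_kernel: "point_kernel (M \<Otimes>\<^sub>M N) \<Lambda> (\<lambda>x. \<eta> (fst x))"
proof
  fix x assume x: "x \<in> space (M \<Otimes>\<^sub>M N)"
  then have "fst x \<in> space M" by (auto simp: space_pair_measure)
  then show "sets (\<eta> (fst x)) = sets \<Lambda>" "locally_finite_counting (\<eta> (fst x))"
    using sets_kernel counting by auto
next
  show "(\<lambda>x. emeasure (\<eta> (fst x)) B) \<in> borel_measurable (M \<Otimes>\<^sub>M N)" if "B \<in> sets \<Lambda>" for B
    using measurable_compose[OF measurable_fst measurable_count[OF that]] .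
qed (rule space_nonempty borel_trace, assumption?)+

end


section \<open>Inradii and the largest cell\<close>

text \<open>The power distance to \<open>p\<close> is at most the one to \<open>q\<close> on a half space. For distinct nuclei
at distance \<open>l\<close> with marks \<open>m\<close> and \<open>t\<close>, its boundary has signed distance \<open>(l\<^sup>2 + m\<^sup>2 - t\<^sup>2) / (2 l)\<close>
from the nucleus of \<open>p\<close>. The multiplied-out form also covers coinciding nuclei, where the half space
is everything or nothing.\<close>

definition within_bisector :: "real \<Rightarrow> 'a::euclidean_space \<times> real \<Rightarrow> 'a \<times> real \<Rightarrow> bool" where
  "within_bisector r p q \<longleftrightarrow>
     2 * r * norm (fst q - fst p) \<le> (norm (fst q - fst p))\<^sup>2 + (snd p)\<^sup>2 - (snd q)\<^sup>2"

text \<open>In coordinates centred at the nucleus of \<open>p\<close> the power inequality is linear in \<open>z\<close>. By Cauchy-Schwarz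
its worst case on the ball is the boundary point in the direction of the other nucleus.\<close>

lemma within_bisector_iff:
  assumes "r \<ge> 0"
  shows "within_bisector r p q \<longleftrightarrow>
    (\<forall>z\<in>cball (fst p) r. (norm (z - fst p))\<^sup>2 - (snd p)\<^sup>2 \<le> (norm (z - fst q))\<^sup>2 - (snd q)\<^sup>2)"
proof -
  obtain x m y t where pq: "p = (x, m)" "q = (y, t)" by fastforce
  define w where "w = y - x"
  have power: "(norm (z - x))\<^sup>2 - m\<^sup>2 \<le> (norm (z - y))\<^sup>2 - t\<^sup>2
                 \<longleftrightarrow> 2 * ((z - x) \<bullet> w) \<le> (norm w)\<^sup>2 + m\<^sup>2 - t\<^sup>2" for z
    unfolding w_def power2_norm_eq_inner by (simp add: algebra_simps inner_commute)
  show ?thesis unfolding within_bisector_def pq fst_conv snd_conv power w_def[symmetric]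
  proof safe
    fix z assume z: "z \<in> cball x r" and le: "2 * r * norm w \<le> (norm w)\<^sup>2 + m\<^sup>2 - t\<^sup>2"
    have "(z - x) \<bullet> w \<le> norm (z - x) * norm w" by (rule norm_cauchy_schwarz)
    also have "\<dots> \<le> r * norm w" using z by (intro mult_right_mono) (auto simp: dist_norm norm_minus_commute)
    finally show "2 * ((z - x) \<bullet> w) \<le> (norm w)\<^sup>2 + m\<^sup>2 - t\<^sup>2" using le by simp
  next
    assume all: "\<forall>z\<in>cball x r. 2 * ((z - x) \<bullet> w) \<le> (norm w)\<^sup>2 + m\<^sup>2 - t\<^sup>2"
    define z where "z = x + r *\<^sub>R sgn w"
    have "z \<in> cball x r" using assms by (auto simp: z_def dist_norm norm_sgn)
    moreover have "(z - x) \<bullet> w = r * norm w"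
      by (cases "w = 0") (auto simp: z_def sgn_div_norm power2_norm_eq_inner[symmetric] power2_eq_square)
    ultimately show "2 * r * norm w \<le> (norm w)\<^sup>2 + m\<^sup>2 - t\<^sup>2" using all by fastforce
  qed
qed

lemma within_bisector_mono:
  "within_bisector r p q \<Longrightarrow> r' \<le> r \<Longrightarrow> within_bisector r' p q"
  unfolding within_bisector_def
  by (erule order_trans[rotated]) (intro mult_right_mono, auto)

lemma cball_subset_cell_iff:
  assumes "r \<ge> 0"
  shows "cball (fst p) r \<subseteq> laguerre_cell p \<phi> \<longleftrightarrow> (\<forall>q\<in>\<phi>. within_bisector r p q)"
  unfolding within_bisector_iff[OF assms] laguerre_cell_def by (auto simp: subset_eq split: prod.splits)

text \<open>If the nucleus lies outside its own cell, then already the radius \<open>0\<close> is inadmissible, so the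
supremum is over the empty set and agrees with the separate clause in the definition.\<close>

lemma inradius_eq:
  "inradius p \<phi> = (SUP r\<in>{r. 0 \<le> r \<and> (\<forall>q\<in>\<phi>. within_bisector r p q)}. ennreal r)"
proof -
  have cell: "fst p \<in> laguerre_cell p \<phi> \<longleftrightarrow> (\<forall>q\<in>\<phi>. within_bisector 0 p q)"
    using cball_subset_cell_iff[of 0 p \<phi>] by simp
  have radii: "{ennreal r |r. 0 \<le> r \<and> cball (fst p) r \<subseteq> laguerre_cell p \<phi>}
      = ennreal ` {r. 0 \<le> r \<and> (\<forall>q\<in>\<phi>. within_bisector r p q)}"
    using cball_subset_cell_iff[of _ p \<phi>] by auto
  show ?thesis
  proof (cases "\<forall>q\<in>\<phi>. within_bisector 0 p q")
    case True
    then show ?thesis unfolding inradius_def radii using cell by simp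
  next
    case False
    then have empty: "{r. 0 \<le> r \<and> (\<forall>q\<in>\<phi>. within_bisector r p q)} = {}"
      using within_bisector_mono by blast
    show ?thesis unfolding inradius_def empty using False cell by (auto simp: bot_ennreal)
  qed
qed

text \<open>A countable supremum, so that measurability of the inradius reduces to that of the conditions for
a fixed radius.\<close>

lemma inradius_eq_rational:
  "inradius p \<phi> = (SUP r\<in>\<rat> \<inter> {0..}. if \<forall>q\<in>\<phi>. within_bisector r p q then ennreal r else 0)"
    (is "_ = ?R")
proof (rule antisym)
  show "inradius p \<phi> \<le> ?R"
    unfolding inradius_eq
  proof (rule SUP_least)
    fix r assume "r \<in> {r. 0 \<le> r \<and> (\<forall>q\<in>\<phi>. within_bisector r p q)}"
    then have r: "0 \<le> r" "\<forall>q\<in>\<phi>. within_bisector r p q" by auto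
    show "ennreal r \<le> ?R"
    proof (rule dense_le)
      fix y assume y: "y < ennreal r"
      then obtain s where s: "y = ennreal s" "0 \<le> s" "s < r"
        using r(1) by (cases y) (auto simp: ennreal_less_iff)
      obtain t where t: "t \<in> \<rat>" "s < t" "t < r" using Rats_dense_in_real[OF s(3)] by blast
      have "y \<le> ennreal t" using s t by (simp add: ennreal_leI)
      also have "\<dots> = (if \<forall>q\<in>\<phi>. within_bisector t p q then ennreal t else 0)"
        using r t within_bisector_mono by (smt (verit))
      also have "\<dots> \<le> ?R" using t s by (intro SUP_upper) auto
      finally show "y \<le> ?R" .
    qed
  qed
  show "?R \<le> inradius p \<phi>"
    unfolding inradius_eq by (intro SUP_least) (auto intro!: SUP_upper)
qed

lemma inradius_ge:
  assumes "\<And>q. q \<in> \<phi> \<Longrightarrow> within_bisector r p q" "0 \<le> r"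
  shows "ennreal r \<le> inradius p \<phi>"
  unfolding inradius_eq using assms by (intro SUP_upper) auto

lemma inradius_le:
  assumes "q \<in> \<phi>" "fst q \<noteq> fst p"
    "(norm (fst q - fst p))\<^sup>2 + (snd p)\<^sup>2 \<le> 2 * R * norm (fst q - fst p)"
  shows "inradius p \<phi> \<le> ennreal R"
  unfolding inradius_eq
proof (intro SUP_least ennreal_leI)
  fix r assume "r \<in> {r. 0 \<le> r \<and> (\<forall>q\<in>\<phi>. within_bisector r p q)}"
  then have "within_bisector r p q" using assms(1) by auto
  then have "2 * r * norm (fst q - fst p) \<le> 2 * R * norm (fst q - fst p)"
    using assms(3) unfolding within_bisector_def by (smt (verit) zero_le_power2)
  then show "r \<le> R" using assms(2) by simp
qed

locale laguerre_kernel = point_kernel M \<Lambda> \<eta>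
  for M :: "'w measure" and \<Lambda> :: "('a::euclidean_space \<times> real) measure" and \<eta>
begin

lemma id_borel: "(\<lambda>p. p) \<in> measurable \<Lambda> borel"
  by (rule measurableI) (use borel_trace in auto)

lemma fst_borel [measurable]: "fst \<in> measurable \<Lambda> borel"
  using measurable_compose[OF id_borel borel_measurable_continuous_onI[of fst]]
  by (simp add: continuous_on_fst)

lemma snd_borel [measurable]: "snd \<in> measurable \<Lambda> borel"
  using measurable_compose[OF id_borel borel_measurable_continuous_onI[of snd]]
  by (simp add: continuous_on_snd)

lemma inradius_measurable [measurable]:
  "(\<lambda>(\<omega>, p). inradius p (points (\<eta> \<omega>))) \<in> borel_measurable (M \<Otimes>\<^sub>M \<Lambda>)"
proof -
  interpret prod: point_kernel "M \<Otimes>\<^sub>M \<Lambda>" \<Lambda> "\<lambda>x. \<eta> (fst x)" by (rule product_kernel)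
  have [measurable]: "Measurable.pred (M \<Otimes>\<^sub>M \<Lambda>) (\<lambda>x. \<exists>q\<in>points (\<eta> (fst x)). \<not> within_bisector r (snd x) q)" for r
    by (rule prod.exists_point_measurable) (unfold within_bisector_def, measurable)
  have eq: "(\<lambda>(\<omega>, p). inradius p (points (\<eta> \<omega>))) =
     (\<lambda>x. SUP r\<in>\<rat> \<inter> {0..}. if \<not> (\<exists>q\<in>points (\<eta> (fst x)). \<not> within_bisector r (snd x) q) then ennreal r else 0)"
    by (auto simp: inradius_eq_rational fun_eq_iff)
  have "countable (\<rat> \<inter> {0::real..})" using countable_rat by (rule countable_subset[rotated]) auto
  then show ?thesis unfolding eq by measurable
qed

text \<open>That a maximal nucleus exists, that there are not two of them, and that some maximal nucleus has
its triple in a given Borel set are all existence statements about points of the configuration;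
together they determine the event that the triple lies in the set.\<close>

lemma max_triple_measurable:
  assumes A: "A \<in> sets borel"
  shows "(\<lambda>\<omega>. max_triple A (points (\<eta> \<omega>))) \<in> borel_measurable M"
proof -
  interpret prod: point_kernel "M \<Otimes>\<^sub>M \<Lambda>" \<Lambda> "\<lambda>x. \<eta> (fst x)" by (rule product_kernel)
  note [measurable] = A
  define inr where "inr \<omega> p = inradius p (points (\<eta> \<omega>))" for \<omega> p
  have [measurable]: "(\<lambda>x. inr (fst x) (snd x)) \<in> borel_measurable (M \<Otimes>\<^sub>M \<Lambda>)"
    using inradius_measurable by (simp add: inr_def case_prod_beta')
  have [measurable]: "(\<lambda>x. inr (fst (fst x)) (snd x)) \<in> borel_measurable ((M \<Otimes>\<^sub>M \<Lambda>) \<Otimes>\<^sub>M \<Lambda>)"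
    using measurable_compose[of "\<lambda>x. (fst (fst x), snd x)" "(M \<Otimes>\<^sub>M \<Lambda>) \<Otimes>\<^sub>M \<Lambda>" "M \<Otimes>\<^sub>M \<Lambda>" "\<lambda>x. inr (fst x) (snd x)" borel]
    by simp
  have [measurable]: "(\<lambda>x. inr (fst (fst x)) (snd (fst x))) \<in> borel_measurable ((M \<Otimes>\<^sub>M \<Lambda>) \<Otimes>\<^sub>M \<Lambda>)"
    using measurable_compose[of fst "(M \<Otimes>\<^sub>M \<Lambda>) \<Otimes>\<^sub>M \<Lambda>" "M \<Otimes>\<^sub>M \<Lambda>" "\<lambda>x. inr (fst x) (snd x)" borel]
    by simp
  define nuc where "nuc p \<longleftrightarrow> fst p \<in> A \<and> 0 < snd p" for p :: "'a \<times> real"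
  define mx where "mx \<omega> p \<longleftrightarrow> nuc p \<and> \<not> (\<exists>q\<in>points (\<eta> \<omega>). nuc q \<and> inr \<omega> p < inr \<omega> q)" for \<omega> p
  have is_max: "is_max_nucleus A (points (\<eta> \<omega>)) p \<longleftrightarrow> p \<in> points (\<eta> \<omega>) \<and> mx \<omega> p" for \<omega> p
    unfolding is_max_nucleus_def nuclei_def mx_def nuc_def inr_def by (auto simp: not_less mem_Times_iff)
  have [measurable]: "Measurable.pred \<Lambda> nuc" unfolding nuc_def by measurable
  have mx_meas [measurable]: "Measurable.pred (M \<Otimes>\<^sub>M \<Lambda>) (\<lambda>x. mx (fst x) (snd x))"
  proof -
    have [measurable]: "Measurable.pred (M \<Otimes>\<^sub>M \<Lambda>)
        (\<lambda>x. \<exists>q\<in>points (\<eta> (fst x)). nuc q \<and> inr (fst x) (snd x) < inr (fst x) q)"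
      by (rule prod.exists_point_measurable) (simp add: case_prod_beta')
    show ?thesis unfolding mx_def by measurable
  qed
  have [measurable]: "Measurable.pred ((M \<Otimes>\<^sub>M \<Lambda>) \<Otimes>\<^sub>M \<Lambda>) (\<lambda>x. mx (fst (fst x)) (snd x))"
    using measurable_compose[of "\<lambda>x. (fst (fst x), snd x)" "(M \<Otimes>\<^sub>M \<Lambda>) \<Otimes>\<^sub>M \<Lambda>" "M \<Otimes>\<^sub>M \<Lambda>", OF _ mx_meas]
    by simp
  define some where "some S \<omega> \<longleftrightarrow>
      (\<exists>p\<in>points (\<eta> \<omega>). mx \<omega> p \<and> (fst p, snd p, enn2real (inr \<omega> p)) \<in> S)" for S \<omega>
  define two where "two \<omega> \<longleftrightarrow> (\<exists>p\<in>points (\<eta> \<omega>). mx \<omega> p \<and> (\<exists>q\<in>points (\<eta> \<omega>). q \<noteq> p \<and> mx \<omega> q))" for \<omega>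
  have some_meas [measurable]: "Measurable.pred M (some S)" if [measurable]: "S \<in> sets borel" for S
    unfolding some_def
  proof (rule exists_point_measurable)
    have "(\<lambda>x. (fst (snd x), snd (snd x), enn2real (inr (fst x) (snd x)))) \<in> borel_measurable (M \<Otimes>\<^sub>M \<Lambda>)"
      by measurable
    note [measurable] = this
    show "Measurable.pred (M \<Otimes>\<^sub>M \<Lambda>) (\<lambda>(\<omega>, p). mx \<omega> p \<and> (fst p, snd p, enn2real (inr \<omega> p)) \<in> S)"
      unfolding case_prod_beta' by measurable
  qed
  have two_meas [measurable]: "Measurable.pred M two"
    unfolding two_def
  proof (rule exists_point_measurable)
    have [measurable]: "Measurable.pred (M \<Otimes>\<^sub>M \<Lambda>) (\<lambda>x. \<exists>q\<in>points (\<eta> (fst x)). q \<noteq> snd x \<and> mx (fst x) q)"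
      by (rule prod.exists_point_measurable) (simp add: case_prod_beta' prod_eq_iff)
    show "Measurable.pred (M \<Otimes>\<^sub>M \<Lambda>) (\<lambda>(\<omega>, p). mx \<omega> p \<and> (\<exists>q\<in>points (\<eta> \<omega>). q \<noteq> p \<and> mx \<omega> q))"
      unfolding case_prod_beta' by measurable
  qed
  have iff: "max_triple A (points (\<eta> \<omega>)) \<in> S \<longleftrightarrow>
      (if some UNIV \<omega> \<and> \<not> two \<omega> then some S \<omega> else 0 \<in> S)" for S \<omega>
  proof (cases "some UNIV \<omega> \<and> \<not> two \<omega>")
    case True
    then obtain p where p: "p \<in> points (\<eta> \<omega>)" "mx \<omega> p" "\<And>q. q \<in> points (\<eta> \<omega>) \<Longrightarrow> mx \<omega> q \<Longrightarrow> q = p"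
      unfolding some_def two_def by blast
    then have ex: "\<exists>!p. is_max_nucleus A (points (\<eta> \<omega>)) p" and the: "(THE p. is_max_nucleus A (points (\<eta> \<omega>)) p) = p"
      unfolding is_max by blast+
    have "max_triple A (points (\<eta> \<omega>)) = (fst p, snd p, enn2real (inr \<omega> p))"
      unfolding max_triple_def Let_def the using ex by (simp add: inr_def)
    moreover have "some S \<omega> \<longleftrightarrow> (fst p, snd p, enn2real (inr \<omega> p)) \<in> S"
      unfolding some_def using p by blast
    ultimately show ?thesis using True by simp
  next
    case False
    then have "\<not> (\<exists>!p. is_max_nucleus A (points (\<eta> \<omega>)) p)"
      unfolding is_max some_def two_def by blast
    then show ?thesis using False unfolding max_triple_def by auto
  qed
  show ?thesis
  proof (rule measurableI)
    fix S :: "('a \<times> real \<times> real) set" assume [measurable]: "S \<in> sets borel"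
    have "(\<lambda>\<omega>. max_triple A (points (\<eta> \<omega>))) -` S \<inter> space M
        = {\<omega> \<in> space M. if some UNIV \<omega> \<and> \<not> two \<omega> then some S \<omega> else 0 \<in> S}"
      using iff by blast
    also have "\<dots> \<in> sets M" by measurable
    finally show "(\<lambda>\<omega>. max_triple A (points (\<eta> \<omega>))) -` S \<inter> space M \<in> sets M" .
  qed simp
qed

end

section \<open>Lattice cubes\<close>

text \<open>Half-open cubes of a lattice of mesh \<open>h\<close>, so that every point lies in one of them and every cube
contains its \<open>corner\<close>. The finite set \<open>indices k\<close> is large enough for the cubes to cover the ball of
radius \<open>k h\<close> about the origin.\<close>

definition cube :: "real \<Rightarrow> ('a::euclidean_space \<Rightarrow> int) \<Rightarrow> 'a set" where
  "cube h z = {x. \<forall>b\<in>Basis. h * z b \<le> x \<bullet> b \<and> x \<bullet> b < h * (z b + 1)}"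

definition corner :: "real \<Rightarrow> ('a::euclidean_space \<Rightarrow> int) \<Rightarrow> 'a" where
  "corner h z = (\<Sum>b\<in>Basis. (h * z b) *\<^sub>R b)"

definition indices :: "real \<Rightarrow> ('a::euclidean_space \<Rightarrow> int) set" where
  "indices k = Basis \<rightarrow>\<^sub>E {- \<lceil>k\<rceil>..\<lceil>k\<rceil>}"

lemma finite_indices: "finite (indices k)"
  unfolding indices_def by (intro finite_PiE) auto

lemma card_indices:
  assumes "k \<ge> 1"
  shows "real (card (indices k :: ('a::euclidean_space \<Rightarrow> int) set)) \<le> (5 * k) ^ DIM('a)"
proof -
  have "real (card {- \<lceil>k\<rceil>..\<lceil>k\<rceil>}) \<le> 5 * k" using assms by (simp, linarith)
  then have "real (card {- \<lceil>k\<rceil>..\<lceil>k\<rceil>}) ^ DIM('a) \<le> (5 * k) ^ DIM('a)" by (rule power_mono) simp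
  moreover have "real (card (indices k :: ('a \<Rightarrow> int) set)) = real (card {- \<lceil>k\<rceil>..\<lceil>k\<rceil>}) ^ DIM('a)"
    by (simp add: indices_def card_PiE del: card_atLeastAtMost_int)
  ultimately show ?thesis by simp
qed

lemma corner_inner: "b \<in> Basis \<Longrightarrow> corner h z \<bullet> b = h * z b"
  unfolding corner_def by (simp add: inner_sum_left inner_Basis if_distrib sum.If_cases cong: if_cong)

lemma corner_in_cube: "h > 0 \<Longrightarrow> corner h z \<in> cube h z"
  by (simp add: cube_def corner_inner algebra_simps)

lemma cube_diameter:
  fixes x y :: "'a::euclidean_space" and h :: real
  assumes "x \<in> cube h z" "y \<in> cube h z"
  shows "norm (x - y) \<le> DIM('a) * h"
proof -
  have "norm (x - y) \<le> (\<Sum>b\<in>Basis. \<bar>(x - y) \<bullet> b\<bar>)" by (rule norm_le_l1)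
  also have "\<dots> \<le> (\<Sum>b\<in>(Basis :: 'a set). h)"
    using assms by (intro sum_mono) (force simp: cube_def inner_diff_left algebra_simps abs_le_iff)
  finally show ?thesis by simp
qed

lemma cube_sets [measurable]: "cube h z \<in> sets borel"
proof -
  have "cube h z = {x \<in> space borel. \<forall>b\<in>Basis. h * z b \<le> x \<bullet> b \<and> x \<bullet> b < h * (z b + 1)}"
    by (simp add: cube_def)
  also have "\<dots> \<in> sets borel" by measurable
  finally show ?thesis .
qed

lemma emeasure_cube:
  assumes "h > 0"
  shows "emeasure lborel (cube h z :: 'a::euclidean_space set) = ennreal (h ^ DIM('a))"
proof -
  define c :: 'a where "c = corner h z"
  define c' :: 'a where "c' = c + h *\<^sub>R One"
  have cb: "c \<bullet> b = h * z b" "c' \<bullet> b = h * z b + h" if "b \<in> Basis" for b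
    using that by (auto simp: c_def c'_def corner_inner inner_add_left)
  have sub: "box c c' \<subseteq> cube h z" "cube h z \<subseteq> cbox c c'"
    using cb by (force simp: cube_def mem_box algebra_simps)+
  have diff: "(c' - c) \<bullet> b = h" if "b \<in> Basis" for b using that cb by (simp add: inner_diff_left)
  have "emeasure lborel (box c c') = ennreal (h ^ DIM('a))"
    using assms cb diff by (subst emeasure_lborel_box) auto
  moreover have "emeasure lborel (cbox c c') = ennreal (h ^ DIM('a))"
    using assms cb diff by (subst emeasure_lborel_cbox) auto
  ultimately show ?thesis
    using emeasure_mono[OF sub(1), of lborel] emeasure_mono[OF sub(2), of lborel] by simp
qed

lemma in_some_cube:
  fixes x :: "'a::euclidean_space"
  assumes "h > 0" "norm x \<le> k * h"
  obtains z where "z \<in> indices k" "x \<in> cube h z"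
proof
  define z where "z = (\<lambda>b\<in>Basis. \<lfloor>x \<bullet> b / h\<rfloor>)"
  show "x \<in> cube h z"
  proof -
    have "h * \<lfloor>x \<bullet> b / h\<rfloor> \<le> x \<bullet> b \<and> x \<bullet> b < h * (\<lfloor>x \<bullet> b / h\<rfloor> + 1)" for b
    proof -
      define i where "i = real_of_int \<lfloor>x \<bullet> b / h\<rfloor>"
      have "i \<le> x \<bullet> b / h" "x \<bullet> b / h < i + 1" unfolding i_def by linarith+
      then have "h * i \<le> x \<bullet> b" "x \<bullet> b < h * (i + 1)" using assms(1)
        by (simp_all only: pos_le_divide_eq pos_divide_less_eq mult.commute)
      then show ?thesis by (simp add: i_def)
    qed
    then show ?thesis by (simp add: cube_def z_def)
  qed
  show "z \<in> indices k"
  proof -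
    have "\<lfloor>x \<bullet> b / h\<rfloor> \<in> {- \<lceil>k\<rceil>..\<lceil>k\<rceil>}" if "b \<in> Basis" for b
    proof -
      have "\<bar>x \<bullet> b\<bar> \<le> k * h" using Basis_le_norm[OF that, of x] assms(2) by linarith
      then have "\<bar>x \<bullet> b / h\<bar> \<le> k" using assms(1) by (simp add: abs_le_iff field_simps)
      then have "- k \<le> x \<bullet> b / h" "x \<bullet> b / h \<le> k" by linarith+
      then show ?thesis unfolding atLeastAtMost_iff by linarith
    qed
    then show ?thesis by (auto simp: indices_def z_def)
  qed
qed

section \<open>Geometry of the largest cell\<close>

text \<open>A point at distance \<open>l\<close> confines the inradius to \<open>(l\<^sup>2 + m\<^sup>2) / (2 l)\<close>, whatever its mark. For \<open>m \<le> c\<close> this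
is at most \<open>c + (l - c)\<^sup>2 / (2 l)\<close>, which is close to \<open>c\<close> when \<open>l\<close> is.\<close>

lemma inradius_le_of_filled:
  fixes x y e :: "'a::euclidean_space"
  assumes "(y, t) \<in> \<phi>" "norm e = 1" "norm (y - (x + c *\<^sub>R e)) \<le> \<kappa> * c"
    and "0 \<le> m" "m \<le> c" "0 < c" "0 < \<kappa>" "\<kappa> \<le> 1 / 2"
  shows "inradius (x, m) \<phi> \<le> ennreal ((1 + \<kappa>) * c)"
proof -
  define l where "l = norm (y - x)"
  have "\<bar>norm (y - x) - norm (c *\<^sub>R e)\<bar> \<le> norm ((y - x) - c *\<^sub>R e)" by (rule norm_triangle_ineq3)
  also have "\<dots> \<le> \<kappa> * c" using assms(3) by (simp add: algebra_simps)
  finally have l: "\<bar>l - c\<bar> \<le> \<kappa> * c" using assms by (simp add: l_def)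
  have "\<kappa> * c \<le> (1 / 2) * c" using assms by (intro mult_right_mono) auto
  then have lc: "c / 2 \<le> l" using l by linarith
  have "(l - c)\<^sup>2 \<le> (\<kappa> * c)\<^sup>2" using l assms by (simp add: abs_le_square_iff[symmetric])
  also have "\<dots> = \<kappa> * c * (\<kappa> * c)" by (simp add: power2_eq_square)
  also have "\<dots> \<le> \<kappa> * c * (c / 2)" using assms by (intro mult_left_mono) auto
  also have "\<dots> \<le> \<kappa> * c * (2 * l)" using assms lc by (intro mult_left_mono) auto
  finally have "(l - c)\<^sup>2 \<le> 2 * \<kappa> * c * l" by simp
  moreover have "m\<^sup>2 \<le> c\<^sup>2" using assms by (simp add: power_mono)
  ultimately have "l\<^sup>2 + m\<^sup>2 \<le> 2 * ((1 + \<kappa>) * c) * l" by (simp add: power2_eq_square algebra_simps)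
  moreover have "y \<noteq> x" using lc assms by (auto simp: l_def)
  ultimately show ?thesis using inradius_le[OF assms(1), of "(x, m)" "(1 + \<kappa>) * c"] by (simp add: l_def)
qed

text \<open>Points with mark at most \<open>e\<close> leave the ball of radius \<open>a / s\<close> inside the cell because
\<open>l\<^sup>2 - 2 (a / s) l + a\<^sup>2 \<ge> a\<^sup>2 - (a / s)\<^sup>2 \<ge> e\<^sup>2\<close> for every distance \<open>l\<close>. A point with a larger mark \<open>t\<close> does
so as well once its distance is at least \<open>t + a\<close>.\<close>

lemma inradius_ge_of_no_interference:
  fixes x :: "'a::euclidean_space"
  assumes a: "0 < a" "a < m" and s: "s > 1" and e: "e\<^sup>2 \<le> a\<^sup>2 - (a / s)\<^sup>2"
    and marks: "\<And>y t. (y, t) \<in> \<phi> \<Longrightarrow> 0 \<le> t"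
    and far: "\<And>y t. (y, t) \<in> \<phi> \<Longrightarrow> (y, t) \<noteq> (x, m) \<Longrightarrow> t \<le> e \<or> t \<le> norm (y - x) - a"
  shows "ennreal (a / s) \<le> inradius (x, m) \<phi>"
proof (rule inradius_ge)
  fix q assume "q \<in> \<phi>"
  then obtain y t where q: "q = (y, t)" "(y, t) \<in> \<phi>" by (cases q) auto
  define l where "l = norm (y - x)"
  have rs: "a / s \<le> a" "0 \<le> a / s" using a s by (auto simp: field_simps)
  have am: "a\<^sup>2 \<le> m\<^sup>2" using a by (intro power_mono) auto
  have l0: "0 \<le> l" by (simp add: l_def)
  have "2 * (a / s) * l \<le> l\<^sup>2 + m\<^sup>2 - t\<^sup>2"
  proof (cases "(y, t) = (x, m)")
    case True then show ?thesis by (simp add: l_def)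
  next
    case False
    from far[OF q(2) False] show ?thesis
    proof
      assume "t \<le> e"
      then have "t\<^sup>2 \<le> a\<^sup>2 - (a / s)\<^sup>2" using marks[OF q(2)] e power_mono[of t e 2] by linarith
      moreover have "0 \<le> (l - a / s)\<^sup>2" by simp
      moreover have "(l - a / s)\<^sup>2 = l\<^sup>2 - 2 * (a / s) * l + (a / s)\<^sup>2" by (simp add: power2_diff)
      ultimately show ?thesis using am by linarith
    next
      assume "t \<le> norm (y - x) - a"
      then have "t\<^sup>2 \<le> (l - a)\<^sup>2" using marks[OF q(2)] by (intro power_mono) (auto simp: l_def)
      moreover have "(l - a)\<^sup>2 = l\<^sup>2 - 2 * a * l + a\<^sup>2" by (simp add: power2_diff)
      moreover have "2 * (a / s) * l \<le> 2 * a * l" using rs l0 by (intro mult_right_mono) auto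
      ultimately show ?thesis using am by linarith
    qed
  qed
  then show "within_bisector (a / s) (x, m) q" by (simp add: within_bisector_def q l_def)
qed (use a s in auto)

text \<open>The deterministic core. All nuclei in \<open>A\<close> except one have mark at most \<open>c = a / s\<^sup>3\<close>, so their inradii
are at most \<open>s c = a / s\<^sup>2\<close>. The exceptional nucleus has inradius at least \<open>a / s\<close>, hence it wins, and at
most \<open>s (s a)\<close> because its mark is at most \<open>s a\<close>. The hypothesis \<open>filled\<close> provides the points that bound
inradii from above, \<open>far\<close> excludes large marks near the exceptional nucleus.\<close>

lemma max_triple_of_dominant_mark:
  fixes x e :: "'a::euclidean_space"
  assumes p: "(x, m) \<in> \<phi>" "x \<in> A" and a: "0 < a" "a < m" "m \<le> s * a" and s: "s > 1"
    and marks: "\<And>y t. (y, t) \<in> \<phi> \<Longrightarrow> 0 \<le> t"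
    and others: "\<And>y t. (y, t) \<in> \<phi> \<Longrightarrow> y \<in> A \<Longrightarrow> (y, t) \<noteq> (x, m) \<Longrightarrow> t \<le> a / s ^ 3"
    and far: "\<And>y t. (y, t) \<in> \<phi> \<Longrightarrow> (y, t) \<noteq> (x, m) \<Longrightarrow>
                 t \<le> a * sqrt (1 - 1 / s\<^sup>2) \<or> t \<le> norm (y - x) - a"
    and e: "norm e = 1" and \<kappa>: "0 < \<kappa>" "\<kappa> \<le> 1 / 2" "1 + \<kappa> \<le> s"
    and filled: "\<And>c y. c = a / s ^ 3 \<or> c = s * a \<Longrightarrow> y \<in> A \<Longrightarrow>
                 \<exists>y' t. (y', t) \<in> \<phi> \<and> norm (y' - (y + c *\<^sub>R e)) \<le> \<kappa> * (a / s ^ 3)"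
  obtains R where "max_triple A \<phi> = (x, m, R)" "a / s \<le> R" "R \<le> s\<^sup>2 * a"
proof -
  have s3: "1 \<le> s ^ 3" using s by simp
  have upper: "inradius (y, t) \<phi> \<le> ennreal (s * c)"
    if c: "c = a / s ^ 3 \<or> c = s * a" and y: "(y, t) \<in> \<phi>" "y \<in> A" "t \<le> c" for c y t
  proof -
    have "a * 1 \<le> a * s ^ 3" using a s3 by (intro mult_left_mono) auto
    then have "a / s ^ 3 \<le> a" using s by (simp add: divide_le_eq)
    moreover have "a \<le> s * a" using a s by simp
    ultimately have ac: "0 < c" "a / s ^ 3 \<le> c" using c a s by auto
    obtain y' t' where y': "(y', t') \<in> \<phi>" "norm (y' - (y + c *\<^sub>R e)) \<le> \<kappa> * (a / s ^ 3)"
      using filled[OF c y(2)] by blast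
    have "\<kappa> * (a / s ^ 3) \<le> \<kappa> * c" using ac \<kappa> by (intro mult_left_mono) auto
    then have "inradius (y, t) \<phi> \<le> ennreal ((1 + \<kappa>) * c)"
      using y' y ac \<kappa> e marks[OF y(1)] by (intro inradius_le_of_filled[of y' t' \<phi> e y c \<kappa> t]) auto
    also have "\<dots> \<le> ennreal (s * c)" using \<kappa> ac by (intro ennreal_leI mult_right_mono) auto
    finally show ?thesis .
  qed
  have "a\<^sup>2 - (a / s)\<^sup>2 = a\<^sup>2 * (1 - 1 / s\<^sup>2)" by (simp add: power_divide algebra_simps)
  moreover have "1 / s\<^sup>2 \<le> 1" using s by (simp add: one_le_power)
  ultimately have "(a * sqrt (1 - 1 / s\<^sup>2))\<^sup>2 \<le> a\<^sup>2 - (a / s)\<^sup>2"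
    by (simp add: power_mult_distrib)
  then have lower: "ennreal (a / s) \<le> inradius (x, m) \<phi>"
    using far marks a s by (intro inradius_ge_of_no_interference[where e="a * sqrt (1 - 1 / s\<^sup>2)"]) auto
  have upper_p: "inradius (x, m) \<phi> \<le> ennreal (s\<^sup>2 * a)"
    using upper[of "s * a" x m] p a by (simp add: power2_eq_square mult.assoc)
  have "s * (a / s ^ 3) < a / s"
  proof -
    have "s * (a / s ^ 3) = (a / s) / s" using s by (simp add: power3_eq_cube)
    also have "\<dots> < a / s" using a s by (simp add: divide_less_eq)
    finally show ?thesis .
  qed
  then have small: "inradius (y, t) \<phi> < inradius (x, m) \<phi>"
    if "(y, t) \<in> \<phi>" "y \<in> A" "(y, t) \<noteq> (x, m)" for y t
  proof -
    have "inradius (y, t) \<phi> \<le> ennreal (s * (a / s ^ 3))" using upper[of "a / s ^ 3" y t] others that by blast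
    also have "\<dots> < ennreal (a / s)"
      using \<open>s * (a / s ^ 3) < a / s\<close> a s by (intro ennreal_lessI) auto
    finally show ?thesis using lower by (rule less_le_trans)
  qed
  have mx: "is_max_nucleus A \<phi> q \<longleftrightarrow> q = (x, m)" for q
  proof
    assume "is_max_nucleus A \<phi> q"
    then have q: "q \<in> \<phi>" "fst q \<in> A" "inradius (x, m) \<phi> \<le> inradius q \<phi>"
      using p a by (auto simp: is_max_nucleus_def nuclei_def)
    show "q = (x, m)"
    proof (rule ccontr)
      assume "q \<noteq> (x, m)"
      then have "inradius q \<phi> < inradius (x, m) \<phi>" using small[of "fst q" "snd q"] q by simp
      then show False using q(3) by simp
    qed
  next
    assume "q = (x, m)"
    then show "is_max_nucleus A \<phi> q"
      using p a small by (auto simp: is_max_nucleus_def nuclei_def) (metis less_imp_le order_refl prod.inject)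
  qed
  define R where "R = enn2real (inradius (x, m) \<phi>)"
  have fin: "inradius (x, m) \<phi> < top" using upper_p by (rule le_less_trans) simp
  then have R: "inradius (x, m) \<phi> = ennreal R" by (simp add: R_def)
  have "max_triple A \<phi> = (x, m, R)" unfolding max_triple_def mx by (simp add: R_def)
  moreover have "a / s \<le> R"
    using lower a s unfolding R by (subst (asm) ennreal_le_iff) (auto simp: R_def)
  moreover have "R \<le> s\<^sup>2 * a"
    using upper_p a s unfolding R by (subst (asm) ennreal_le_iff) auto
  ultimately show ?thesis by (rule that)
qed

section \<open>Regularly varying tails\<close>

locale heavy_tail = prob_space Q for Q :: "real measure" +
  fixes \<alpha> :: real
  assumes sets_Q: "sets Q = sets (restrict_space borel {0..})"
    and rv: "regularly_varying_tail Q \<alpha>"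
begin

definition tail :: "real \<Rightarrow> real" where
  "tail u = measure Q {u<..}"

lemma space_Q: "space Q = {0..}"
  using sets_eq_imp_space_eq[OF sets_Q] by (simp add: space_restrict_space)

lemma sets_Q_iff: "A \<in> sets Q \<longleftrightarrow> A \<in> sets borel \<and> A \<subseteq> {0..}"
  unfolding sets_Q by (subst sets_restrict_space_iff) auto

lemma ray_sets [measurable]: "0 \<le> u \<Longrightarrow> {u<..} \<in> sets Q"
  by (auto simp: sets_Q_iff)

lemma alpha_pos: "\<alpha> > 0"
  using rv by (simp add: regularly_varying_tail_def)

lemma tail_nonneg: "0 \<le> tail u"
  by (simp add: tail_def)

lemma tail_mono: "0 \<le> u \<Longrightarrow> u \<le> u' \<Longrightarrow> tail u' \<le> tail u"
  unfolding tail_def by (intro finite_measure_mono) auto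

lemma tail_pos: "tail u > 0" if "0 \<le> u"
proof -
  obtain l where sv: "slowly_varying l" and l: "\<And>u. u > 0 \<Longrightarrow> tail u = l u * u powr (- \<alpha>)"
    using rv unfolding regularly_varying_tail_def tail_def by blast
  have "((\<lambda>v. l (1 * v) / l v) \<longlongrightarrow> 1) at_top"
    using sv unfolding slowly_varying_def by (metis zero_less_one)
  then have "eventually (\<lambda>v. l (1 * v) / l v > 0) at_top" by (rule order_tendstoD) simp
  then have "eventually (\<lambda>v. l v \<noteq> 0 \<and> v > u) at_top"
    using eventually_gt_at_top[of u] by eventually_elim auto
  then obtain v where v: "l v \<noteq> 0" "v > u" using eventually_happens by fastforce
  then have "tail v \<noteq> 0" using that l[of v] by auto
  then show ?thesis using tail_mono[OF that, of v] v tail_nonneg[of v] by linarith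
qed

text \<open>Regular variation in the form in which it is used: the slowly varying factor is eliminated.\<close>

lemma tail_ratio:
  assumes t: "t > 0" "s > 0"
  shows "((\<lambda>v. tail (t * v) / tail (s * v)) \<longlongrightarrow> (t / s) powr (- \<alpha>)) at_top"
proof -
  obtain l where sv: "slowly_varying l" and l: "\<And>u. u > 0 \<Longrightarrow> tail u = l u * u powr (- \<alpha>)"
    using rv unfolding regularly_varying_tail_def tail_def by blast
  have one: "((\<lambda>v. tail (r * v) / tail v) \<longlongrightarrow> r powr (- \<alpha>)) at_top" if r: "r > 0" for r
  proof -
    have "((\<lambda>v. l (r * v) / l v * r powr (- \<alpha>)) \<longlongrightarrow> 1 * r powr (- \<alpha>)) at_top"
      using sv r unfolding slowly_varying_def by (intro tendsto_mult tendsto_const) blast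
    moreover have "eventually (\<lambda>v. l (r * v) / l v * r powr (- \<alpha>) = tail (r * v) / tail v) at_top"
      using eventually_gt_at_top[of 0]
    proof eventually_elim
      case (elim v)
      then show ?case using r l[of v] l[of "r * v"] by (simp add: powr_mult)
    qed
    ultimately show ?thesis by (simp add: filterlim_cong)
  qed
  have "filterlim (\<lambda>v. s * v) at_top at_top"
    using t(2) by (intro filterlim_tendsto_pos_mult_at_top[OF tendsto_const]) (auto simp: filterlim_ident)
  from filterlim_compose[OF one[of "t / s"] this] show ?thesis using t by simp
qed

text \<open>Along a dyadic sequence the ratio of consecutive tails tends to \<open>2 powr (- \<alpha>)\<close>, so the tail is
eventually squeezed between geometric sequences. These one-sided Potter bounds suffice for the
two consequences of regular variation that are needed, a finite moment and a polynomial lower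
bound.\<close>

lemma tail_dyadic_le:
  assumes "\<beta> > 2 powr (- \<alpha>)"
  obtains u0 where "u0 \<ge> 1" "\<And>k::nat. tail (2 ^ k * u0) \<le> \<beta> ^ k * tail u0"
proof -
  have "((\<lambda>v. tail (2 * v) / tail (1 * v)) \<longlongrightarrow> (2 / 1) powr (- \<alpha>)) at_top" by (rule tail_ratio) auto
  then have "eventually (\<lambda>v. tail (2 * v) / tail v < \<beta>) at_top"
    using assms by (auto dest: order_tendstoD)
  then obtain u1 where u1: "\<And>v. v \<ge> u1 \<Longrightarrow> tail (2 * v) / tail v < \<beta>"
    by (auto simp: eventually_at_top_linorder)
  define u0 where "u0 = max 1 u1"
  have \<beta>: "\<beta> > 0" using assms by (rule le_less_trans[rotated]) simp
  have "tail (2 ^ k * u0) \<le> \<beta> ^ k * tail u0" for k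
  proof (induction k)
    case (Suc k)
    have u0_ge: "u0 \<ge> 1" by (simp add: u0_def)
    moreover have "1 * u0 \<le> 2 ^ k * u0" using u0_ge by (intro mult_right_mono) auto
    ultimately have big: "u0 \<le> 2 ^ k * u0" "u0 \<ge> 1" by auto
    moreover have "u1 \<le> u0" by (simp add: u0_def)
    ultimately have "u1 \<le> 2 ^ k * u0" by linarith
    then have "tail (2 * (2 ^ k * u0)) \<le> \<beta> * tail (2 ^ k * u0)"
      using u1[of "2 ^ k * u0"] tail_pos[of "2 ^ k * u0"] big by (simp add: divide_less_eq)
    also have "\<dots> \<le> \<beta> * (\<beta> ^ k * tail u0)" using Suc \<beta> by (intro mult_left_mono) auto
    finally show ?case by (simp add: mult_ac)
  qed simp
  then show ?thesis using that[of u0] by (simp add: u0_def)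
qed

lemma tail_dyadic_ge:
  assumes "0 < \<beta>" "\<beta> < 2 powr (- \<alpha>)"
  obtains u0 where "u0 \<ge> 1" "\<And>k::nat. \<beta> ^ k * tail u0 \<le> tail (2 ^ k * u0)"
proof -
  have "((\<lambda>v. tail (2 * v) / tail (1 * v)) \<longlongrightarrow> (2 / 1) powr (- \<alpha>)) at_top" by (rule tail_ratio) auto
  then have "eventually (\<lambda>v. tail (2 * v) / tail v > \<beta>) at_top"
    using assms by (auto dest: order_tendstoD)
  then obtain u1 where u1: "\<And>v. v \<ge> u1 \<Longrightarrow> tail (2 * v) / tail v > \<beta>"
    by (auto simp: eventually_at_top_linorder)
  define u0 where "u0 = max 1 u1"
  have "\<beta> ^ k * tail u0 \<le> tail (2 ^ k * u0)" for k
  proof (induction k)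
    case (Suc k)
    have u0_ge: "u0 \<ge> 1" by (simp add: u0_def)
    moreover have "1 * u0 \<le> 2 ^ k * u0" using u0_ge by (intro mult_right_mono) auto
    ultimately have big: "u0 \<le> 2 ^ k * u0" "u0 \<ge> 1" by auto
    moreover have "u1 \<le> u0" by (simp add: u0_def)
    ultimately have "u1 \<le> 2 ^ k * u0" by linarith
    then have "\<beta> * tail (2 ^ k * u0) \<le> tail (2 * (2 ^ k * u0))"
      using u1[of "2 ^ k * u0"] tail_pos[of "2 ^ k * u0"] big by (simp add: less_divide_eq)
    moreover have "\<beta> * (\<beta> ^ k * tail u0) \<le> \<beta> * tail (2 ^ k * u0)"
      using Suc assms(1) by (intro mult_left_mono) auto
    ultimately show ?case by (simp add: mult_ac)
  qed simp
  then show ?thesis using that[of u0] by (simp add: u0_def)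
qed

text \<open>Cut the half-line at \<open>2\<^sup>k u\<^sub>0\<close>. The \<open>k\<close>-th piece contributes at most
\<open>(2\<^sup>k\<^sup>+\<^sup>1 u\<^sub>0)\<^sup>d\<close> times the tail at \<open>2\<^sup>k u\<^sub>0\<close>, and these bounds decay geometrically because \<open>\<beta> < 2 powr (- d)\<close>.\<close>

lemma moment_finite:
  assumes d: "\<alpha> > real d"
  shows "(\<integral>\<^sup>+ t. ennreal (t ^ d) \<partial>Q) < \<infinity>"
proof -
  define \<beta> where "\<beta> = 2 powr (- ((\<alpha> + d) / 2))"
  have \<beta>: "\<beta> > 2 powr (- \<alpha>)" "\<beta> < 2 powr (- real d)" "\<beta> > 0"
    using d by (auto simp: \<beta>_def)
  obtain u0 where u0: "u0 \<ge> 1" "\<And>k::nat. tail (2 ^ k * u0) \<le> \<beta> ^ k * tail u0"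
    using tail_dyadic_le[OF \<beta>(1)] by blast
  define a where "a k = (2 ^ Suc k * u0) ^ d" for k :: nat
  have pw: "ennreal (t ^ d) \<le> ennreal (u0 ^ d) + (\<Sum>k. ennreal (a k) * indicator {2 ^ k * u0<..} t)"
    if t: "t \<in> space Q" for t
  proof (cases "t \<le> u0")
    case True
    then have "ennreal (t ^ d) \<le> ennreal (u0 ^ d)"
      using t by (intro ennreal_leI power_mono) (auto simp: space_Q)
    then show ?thesis by (rule order_trans) simp
  next
    case False
    obtain n :: nat where "t / u0 < 2 ^ n" using real_arch_pow[of 2 "t / u0"] by auto
    then have ex: "\<exists>n::nat. t \<le> 2 ^ n * u0" using u0(1) by (intro exI[of _ n]) (simp add: divide_less_eq)
    define n where "n = (LEAST n::nat. t \<le> 2 ^ n * u0)"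
    have n: "t \<le> 2 ^ n * u0" unfolding n_def using ex by (rule LeastI_ex)
    have "n \<noteq> 0" using n False by (intro notI) simp
    then obtain k where k: "n = Suc k" using not0_implies_Suc by blast
    have "\<not> t \<le> 2 ^ k * u0" using not_less_Least[of k "\<lambda>n. t \<le> 2 ^ n * u0"] k unfolding n_def by simp
    then have "ennreal (t ^ d) \<le> ennreal (a k) * indicator {2 ^ k * u0<..} t"
      using n k t unfolding a_def by (auto intro!: ennreal_leI power_mono simp: space_Q)
    also have "\<dots> \<le> (\<Sum>k. ennreal (a k) * indicator {2 ^ k * u0<..} t)"
      using sum_le_suminf[OF summableI, of "{k}" "\<lambda>k. ennreal (a k) * indicator {2 ^ k * u0<..} t"]
      by (simp del: sum_mult_indicator)
    also have "\<dots> \<le> ennreal (u0 ^ d) + \<dots>" by simp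
    finally show ?thesis .
  qed
  have [measurable]: "{2 ^ k * u0<..} \<in> sets Q" for k :: nat using u0(1) by (intro ray_sets) simp
  have "(\<integral>\<^sup>+ t. ennreal (t ^ d) \<partial>Q)
      \<le> (\<integral>\<^sup>+ t. ennreal (u0 ^ d) + (\<Sum>k. ennreal (a k) * indicator {2 ^ k * u0<..} t) \<partial>Q)"
    by (intro nn_integral_mono pw)
  also have "\<dots> = ennreal (u0 ^ d) + (\<Sum>k. ennreal (a k) * ennreal (tail (2 ^ k * u0)))"
    by (simp add: nn_integral_add nn_integral_suminf nn_integral_cmult prob_space
        tail_def emeasure_eq_measure)
  also have "\<dots> \<le> ennreal (u0 ^ d) + (\<Sum>k. ennreal ((2 * u0) ^ d * tail u0 * (2 ^ d * \<beta>) ^ k))"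
  proof (intro add_left_mono suminf_le)
    fix k :: nat
    have "a k * tail (2 ^ k * u0) \<le> a k * (\<beta> ^ k * tail u0)"
      using u0 by (intro mult_left_mono) (auto simp: a_def)
    also have "\<dots> = (2 * u0) ^ d * tail u0 * (2 ^ d * \<beta>) ^ k"
      by (simp add: a_def power_mult_distrib power_mult[symmetric] mult.commute[of d])
    finally have "a k * tail (2 ^ k * u0) \<le> (2 * u0) ^ d * tail u0 * (2 ^ d * \<beta>) ^ k" .
    then show "ennreal (a k) * ennreal (tail (2 ^ k * u0))
        \<le> ennreal ((2 * u0) ^ d * tail u0 * (2 ^ d * \<beta>) ^ k)"
      using u0(1) by (subst ennreal_mult[symmetric]) (auto simp: a_def tail_nonneg intro!: ennreal_leI)
  qed auto
  also have "\<dots> < \<infinity>"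
  proof -
    have "2 ^ d * \<beta> < 2 ^ d * 2 powr (- real d)" using \<beta>(2) by simp
    also have "\<dots> = 1" by (simp add: powr_minus powr_realpow)
    finally have "summable (\<lambda>k. (2 * u0) ^ d * tail u0 * (2 ^ d * \<beta>) ^ k)"
      using \<beta>(3) by (intro summable_mult summable_geometric) simp
    then have "(\<Sum>k. ennreal ((2 * u0) ^ d * tail u0 * (2 ^ d * \<beta>) ^ k)) < \<infinity>"
      using \<beta>(3) u0(1) tail_nonneg by (subst suminf_ennreal2) (auto intro!: mult_nonneg_nonneg)
    then show ?thesis by (simp add: less_top)
  qed
  finally show ?thesis .
qed

text \<open>The tail is bounded below by a negative power, hence exponentials are negligible against it.\<close>

lemma exp_over_tail:
  assumes c: "c > 0"
  shows "((\<lambda>u. exp (- c * u) / tail u) \<longlongrightarrow> 0) at_top"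
proof -
  obtain b :: nat where b: "\<alpha> < b" using reals_Archimedean2 by blast
  have "inverse (2 ^ b) < 2 powr (- \<alpha>)"
    using b by (simp add: powr_realpow[symmetric] powr_minus[symmetric])
  then obtain u0 where u0: "u0 \<ge> 1" "\<And>k::nat. inverse (2 ^ b) ^ k * tail u0 \<le> tail (2 ^ k * u0)"
    using tail_dyadic_ge[of "inverse (2 ^ b)"] by (metis inverse_positive_iff_positive zero_less_numeral zero_less_power)
  have lower: "tail u0 / (2 * u) ^ b \<le> tail u" if u: "u \<ge> u0" for u
  proof -
    obtain n :: nat where "u / u0 < 2 ^ n" using real_arch_pow[of 2 "u / u0"] by auto
    then have ex: "\<exists>n::nat. u \<le> 2 ^ n * u0" using u0(1) by (intro exI[of _ n]) (simp add: divide_less_eq)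
    define n where "n = (LEAST n::nat. u \<le> 2 ^ n * u0)"
    have n: "u \<le> 2 ^ n * u0" unfolding n_def using ex by (rule LeastI_ex)
    have le: "2 ^ n \<le> 2 * u"
    proof (cases n)
      case 0 then show ?thesis using u u0 by simp
    next
      case (Suc k)
      then have "\<not> u \<le> 2 ^ k * u0" using not_less_Least[of k "\<lambda>n. u \<le> 2 ^ n * u0"] unfolding n_def by simp
      moreover have "2 ^ k * 1 \<le> 2 ^ k * u0" using u0(1) by (intro mult_left_mono) auto
      ultimately have "2 ^ k \<le> u" by linarith
      then show ?thesis using Suc by simp
    qed
    have "tail u0 / (2 * u) ^ b \<le> tail u0 / (2 ^ n) ^ b"
      using le u u0(1) tail_nonneg by (intro divide_left_mono power_mono) auto
    also have "\<dots> = inverse (2 ^ b) ^ n * tail u0"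
      by (simp add: power_inverse power_mult[symmetric] mult.commute field_simps)
    also have "\<dots> \<le> tail (2 ^ n * u0)" by (rule u0)
    also have "\<dots> \<le> tail u" using n u u0 by (intro tail_mono) auto
    finally show ?thesis .
  qed
  have lim: "((\<lambda>u. exp (- c * u) * (2 * u) ^ b / tail u0) \<longlongrightarrow> 0) at_top"
  proof -
    have "((\<lambda>u. exp (- c * u) * (2 * u) ^ b) \<longlongrightarrow> 0) at_top" using c by real_asymp
    then show ?thesis using tendsto_divide[OF _ tendsto_const, of _ 0 at_top "tail u0"] tail_pos[of u0] u0(1)
      by fastforce
  qed
  show ?thesis
  proof (rule tendsto_sandwich[OF _ _ tendsto_const lim])
    show "eventually (\<lambda>u. 0 \<le> exp (- c * u) / tail u) at_top" by (simp add: tail_nonneg)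
    show "eventually (\<lambda>u. exp (- c * u) / tail u \<le> exp (- c * u) * (2 * u) ^ b / tail u0) at_top"
      using eventually_ge_at_top[of u0]
    proof eventually_elim
      case (elim u)
      have "0 < tail u0 / (2 * u) ^ b" using elim u0(1) tail_pos[of u0] by simp
      then have "exp (- c * u) / tail u \<le> exp (- c * u) / (tail u0 / (2 * u) ^ b)"
        using lower[OF elim] by (intro divide_left_mono mult_pos_pos exp_ge_zero) linarith+
      then show ?case by simp
    qed
  qed
qed

lemma measure_initial: "0 \<le> x \<Longrightarrow> measure Q {0..x} = 1 - tail x"
proof -
  assume "0 \<le> x"
  then have "{0..x} = space Q - {x<..}" by (auto simp: space_Q)
  then show ?thesis using \<open>0 \<le> x\<close> prob_compl[OF ray_sets] by (simp add: tail_def)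
qed

lemma tail_small:
  assumes "e > 0"
  obtains x where "x \<ge> 0" "tail x < e"
proof -
  have "(\<lambda>n. measure Q {real n<..}) \<longlonglongrightarrow> measure Q (\<Inter>n. {real n<..})"
    by (intro finite_Lim_measure_decseq) (auto simp: decseq_def)
  moreover have "(\<Inter>n. {real n<..}) = {}"
    by (auto simp: set_eq_iff not_less real_arch_simple)
  ultimately have "(\<lambda>n. tail (real n)) \<longlonglongrightarrow> 0" by (simp add: tail_def)
  then have "eventually (\<lambda>n. tail (real n) < e) sequentially" using assms by (rule order_tendstoD)
  then obtain n where "tail (real n) < e" using eventually_happens'[of sequentially] by auto
  then show ?thesis using that[of "real n"] by simp
qed

text \<open>The mark distribution may have atoms, so the tail at the quantile itself can differ from \<open>e\<close>; only
the comparison on either side survives.\<close>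

lemma quantile_props:
  assumes p: "0 < e" "e < 1"
  shows "0 \<le> quantile Q (1 - e)"
    and "\<And>x. x > quantile Q (1 - e) \<Longrightarrow> tail x \<le> e"
    and "\<And>x. 0 \<le> x \<Longrightarrow> x < quantile Q (1 - e) \<Longrightarrow> tail x > e"
proof -
  define S where "S = {x. 0 \<le> x \<and> measure Q {0..x} \<ge> 1 - e}"
  have q: "quantile Q (1 - e) = Inf S" by (simp add: quantile_def S_def)
  have S: "x \<in> S \<longleftrightarrow> 0 \<le> x \<and> tail x \<le> e" for x unfolding S_def using measure_initial by auto
  obtain x where "x \<ge> 0" "tail x < e" using tail_small[OF p(1)] .
  then have ne: "S \<noteq> {}" using S[of x] by auto
  have bdd: "bdd_below S" by (rule bdd_belowI[of _ 0]) (simp add: S)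
  show "0 \<le> quantile Q (1 - e)" unfolding q by (rule cInf_greatest[OF ne]) (simp add: S)
  show "tail x \<le> e" if x: "x > quantile Q (1 - e)" for x
  proof -
    obtain y where "y \<in> S" "y < x" using cInf_lessD[OF ne x[unfolded q]] by blast
    then show ?thesis using S[of y] tail_mono[of y x] by simp
  qed
  show "tail x > e" if "0 \<le> x" "x < quantile Q (1 - e)" for x
  proof (rule ccontr)
    assume "\<not> tail x > e"
    then have "x \<in> S" using that S by simp
    then show False using cInf_lower[OF _ bdd] that(2) unfolding q by force
  qed
qed

lemma quantile_at_top:
  assumes "d > 0"
  shows "filterlim (\<lambda>\<rho>. quantile Q (1 - 1 / \<rho> ^ d)) at_top at_top"
  unfolding filterlim_at_top
proof
  fix Z :: real
  define x where "x = max Z 0"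
  have "((\<lambda>\<rho>::real. 1 / \<rho> ^ d) \<longlongrightarrow> 0) at_top" using assms by real_asymp
  then have "eventually (\<lambda>\<rho>::real. 1 / \<rho> ^ d < tail x) at_top"
    using tail_pos[of x] by (auto simp: x_def dest: order_tendstoD)
  then show "eventually (\<lambda>\<rho>. Z \<le> quantile Q (1 - 1 / \<rho> ^ d)) at_top"
    using eventually_gt_at_top[of 1]
  proof eventually_elim
    case (elim \<rho>)
    have "1 < \<rho> ^ d" using elim assms by (simp add: one_less_power)
    then have "0 < 1 / \<rho> ^ d" "1 / \<rho> ^ d < 1" by auto
    from quantile_props(2)[OF this, of x] show ?case using elim by (force simp: x_def)
  qed
qed

text \<open>For \<open>s\<close> slightly above and slightly below \<open>1\<close>, the number \<open>\<rho>\<^sup>d\<close> lies between the reciprocals of the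
tails at \<open>s q\<close>. Comparing the tail at \<open>t q\<close> with these gives the limits \<open>(t / s) powr (- \<alpha>)\<close>, and \<open>s\<close> is
arbitrarily close to \<open>1\<close>.\<close>

lemma tail_quantile:
  assumes "d > 0" "t > 0"
  shows "((\<lambda>\<rho>. \<rho> ^ d * tail (t * quantile Q (1 - 1 / \<rho> ^ d))) \<longlongrightarrow> t powr (- \<alpha>)) at_top"
proof -
  define q where "q \<rho> = quantile Q (1 - 1 / \<rho> ^ d)" for \<rho>
  have qtop: "filterlim q at_top at_top" unfolding q_def by (rule quantile_at_top[OF assms(1)])
  have ratio: "((\<lambda>\<rho>. tail (t * q \<rho>) / tail (s * q \<rho>)) \<longlongrightarrow> (t / s) powr (- \<alpha>)) at_top" if "s > 0" for s
    using filterlim_compose[OF tail_ratio[OF assms(2) that] qtop] .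
  have cont: "((\<lambda>s. (t / s) powr (- \<alpha>)) \<longlongrightarrow> t powr (- \<alpha>)) (at_right 1)"
             "((\<lambda>s. (t / s) powr (- \<alpha>)) \<longlongrightarrow> t powr (- \<alpha>)) (at_left 1)"
    using assms(2) by (auto intro!: tendsto_eq_intros)
  have ev: "eventually (\<lambda>\<rho>. \<rho> > 1 \<and> q \<rho> > 0) at_top"
    using eventually_gt_at_top[of 1] filterlim_at_top_dense[THEN iffD1, OF qtop, rule_format, of 0]
    by eventually_elim simp
  have e01: "0 < 1 / \<rho> ^ d" "1 / \<rho> ^ d < 1" if "\<rho> > 1" for \<rho> :: real
    using one_less_power[OF that assms(1)] by auto
  show ?thesis unfolding q_def[symmetric]
  proof (rule order_tendstoI)
    fix a assume "a < t powr (- \<alpha>)"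
    then have "eventually (\<lambda>s. (t / s) powr (- \<alpha>) > a) (at_left 1)" using cont(2) by (auto dest: order_tendstoD)
    moreover have "eventually (\<lambda>s::real. s \<in> {0<..<1}) (at_left 1)" by (rule eventually_at_leftI[of 0]) auto
    ultimately have "eventually (\<lambda>s::real. (t / s) powr (- \<alpha>) > a \<and> s \<in> {0<..<1}) (at_left 1)" by (rule eventually_conj)
    then obtain s where s: "(t / s) powr (- \<alpha>) > a" "0 < s" "s < 1"
      using eventually_happens'[of "at_left (1::real)"] by fastforce
    have "eventually (\<lambda>\<rho>. tail (t * q \<rho>) / tail (s * q \<rho>) > a) at_top" using ratio[OF s(2)] s(1) by (rule order_tendstoD)
    then show "eventually (\<lambda>\<rho>. a < \<rho> ^ d * tail (t * q \<rho>)) at_top" using ev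
    proof eventually_elim
      case (elim \<rho>)
      have less: "1 / \<rho> ^ d < tail (s * q \<rho>)"
        using quantile_props(3)[OF e01, of \<rho> "s * q \<rho>"] elim s by (simp add: q_def)
      then have "1 < \<rho> ^ d * tail (s * q \<rho>)"
        using elim by (simp add: divide_less_eq mult.commute)
      then have "1 / tail (s * q \<rho>) \<le> \<rho> ^ d"
        using tail_pos[of "s * q \<rho>"] elim s by (simp add: divide_le_eq)
      then have "tail (t * q \<rho>) * (1 / tail (s * q \<rho>)) \<le> tail (t * q \<rho>) * \<rho> ^ d"
        by (intro mult_left_mono tail_nonneg)
      then show ?case using elim by (simp add: mult.commute)
    qed
  next
    fix a assume "a > t powr (- \<alpha>)"
    then have "eventually (\<lambda>s. (t / s) powr (- \<alpha>) < a) (at_right 1)" using cont(1) by (auto dest: order_tendstoD)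
    moreover have "eventually (\<lambda>s::real. s \<in> {1<..<2}) (at_right 1)" by (rule eventually_at_rightI[of _ 2]) auto
    ultimately have "eventually (\<lambda>s::real. (t / s) powr (- \<alpha>) < a \<and> s \<in> {1<..<2}) (at_right 1)" by (rule eventually_conj)
    then obtain s where s: "(t / s) powr (- \<alpha>) < a" "1 < s"
      using eventually_happens'[of "at_right (1::real)"] by fastforce
    have "eventually (\<lambda>\<rho>. tail (t * q \<rho>) / tail (s * q \<rho>) < a) at_top" using ratio[of s] s by (auto dest: order_tendstoD)
    then show "eventually (\<lambda>\<rho>. \<rho> ^ d * tail (t * q \<rho>) < a) at_top" using ev
    proof eventually_elim
      case (elim \<rho>)
      have le: "tail (s * q \<rho>) \<le> 1 / \<rho> ^ d"
        using quantile_props(2)[OF e01, of \<rho> "s * q \<rho>"] elim s by (simp add: q_def)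
      have pos: "tail (s * q \<rho>) > 0" using elim s by (intro tail_pos) simp
      have "tail (s * q \<rho>) * \<rho> ^ d \<le> 1" using le elim by (simp add: le_divide_eq)
      then have "\<rho> ^ d \<le> 1 / tail (s * q \<rho>)" using pos by (simp add: le_divide_eq mult.commute)
      then have "tail (t * q \<rho>) * \<rho> ^ d \<le> tail (t * q \<rho>) * (1 / tail (s * q \<rho>))"
        by (intro mult_left_mono tail_nonneg)
      then show ?case using elim by (simp add: mult.commute)
    qed
  qed
qed

end

locale heavy_tail_scaling = heavy_tail Q \<alpha> for Q :: "real measure" and \<alpha> +
  fixes \<gamma> :: real and d :: nat
  assumes gamma_pos: "\<gamma> > 0" and d_pos: "d > 0" and alpha_gt: "\<alpha> > real d"
begin

abbreviation v :: "real \<Rightarrow> real" where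
  "v \<rho> \<equiv> q_scale Q \<gamma> \<alpha> d \<rho>"

lemma scale_at_top: "filterlim v at_top at_top"
  unfolding q_scale_def using gamma_pos
  by (intro filterlim_tendsto_pos_mult_at_top[OF tendsto_const _ quantile_at_top[OF d_pos]]) simp

text \<open>The normalization behind \<^const>\<open>q_scale\<close>: the left-hand side is the expected number of
points with mark above \<open>t v\<close> over a set of volume \<open>\<rho>\<^sup>d\<close>.\<close>

lemma tail_scale:
  assumes t: "t > 0"
  shows "((\<lambda>\<rho>. \<gamma> * \<rho> ^ d * tail (t * v \<rho>)) \<longlongrightarrow> t powr (- \<alpha>)) at_top"
proof -
  define g where "g = \<gamma> powr (1 / \<alpha>)"
  have g: "g > 0" "g powr (- \<alpha>) = 1 / \<gamma>"
    using gamma_pos alpha_pos by (auto simp: g_def powr_powr powr_minus field_simps)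
  have "((\<lambda>\<rho>. \<gamma> * (\<rho> ^ d * tail ((t * g) * quantile Q (1 - 1 / \<rho> ^ d)))) \<longlongrightarrow> \<gamma> * (t * g) powr (- \<alpha>)) at_top"
    using g t by (intro tendsto_mult tendsto_const tail_quantile d_pos) auto
  moreover have "\<gamma> * (t * g) powr (- \<alpha>) = t powr (- \<alpha>)"
    using g t gamma_pos by (simp add: powr_mult)
  ultimately show ?thesis by (simp add: q_scale_def g_def mult_ac)
qed

lemma moment_tail_tendsto:
  assumes "t > 0"
  shows "((\<lambda>\<rho>. enn2real (\<integral>\<^sup>+ s. ennreal (s ^ d) * indicator {t * v \<rho><..} s \<partial>Q)) \<longlongrightarrow> 0) at_top"
proof -
  have [measurable]: "(\<lambda>s. s) \<in> borel_measurable Q"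
    by (rule measurableI) (auto simp: sets_Q_iff space_Q)
  define I where "I n = (\<integral>\<^sup>+ s. ennreal (s ^ d) * indicator {real n<..} s \<partial>Q)" for n
  have lim: "I \<longlonglongrightarrow> (\<integral>\<^sup>+ s. 0 \<partial>Q)"
    unfolding I_def
  proof (rule nn_integral_dominated_convergence[where w="\<lambda>s. ennreal (s ^ d)"])
    show "AE s in Q. (\<lambda>n. ennreal (s ^ d) * indicator {real n<..} s) \<longlonglongrightarrow> 0"
    proof (rule AE_I2)
      fix s :: real
      obtain N :: nat where N: "s < N" using reals_Archimedean2 by blast
      have "eventually (\<lambda>n. ennreal (s ^ d) * indicator {real n<..} s = 0) sequentially"
        using eventually_ge_at_top[of N] by eventually_elim (use N in \<open>auto simp: indicator_def\<close>)
      then show "(\<lambda>n. ennreal (s ^ d) * indicator {real n<..} s) \<longlonglongrightarrow> 0" by (rule tendsto_eventually)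
    qed
  qed (use moment_finite[OF alpha_gt] in \<open>auto simp: indicator_def\<close>)
  show ?thesis
  proof (rule order_tendstoI)
    fix e :: real assume e: "e > 0"
    have "eventually (\<lambda>n. I n < ennreal e) sequentially" using lim e by (intro order_tendstoD) auto
    then obtain n where n: "I n < ennreal e" using eventually_happens'[of sequentially] by auto
    have "filterlim (\<lambda>\<rho>. t * v \<rho>) at_top at_top"
      by (rule filterlim_tendsto_pos_mult_at_top[OF tendsto_const assms scale_at_top])
    then have "eventually (\<lambda>\<rho>. t * v \<rho> \<ge> n) at_top" by (simp add: filterlim_at_top)
    then show "eventually (\<lambda>\<rho>. enn2real (\<integral>\<^sup>+ s. ennreal (s ^ d) * indicator {t * v \<rho><..} s \<partial>Q) < e) at_top"
    proof eventually_elim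
      case (elim \<rho>)
      have "(\<integral>\<^sup>+ s. ennreal (s ^ d) * indicator {t * v \<rho><..} s \<partial>Q) \<le> I n"
        unfolding I_def using elim by (intro nn_integral_mono) (auto simp: indicator_def)
      then have "(\<integral>\<^sup>+ s. ennreal (s ^ d) * indicator {t * v \<rho><..} s \<partial>Q) < ennreal e" using n by simp
      then show ?case using e by (metis enn2real_ennreal enn2real_less_iff less_imp_le less_trans
            ennreal_less_top enn2real_nonneg ennreal_enn2real ennreal_less_iff)
    qed
  next
    fix a :: real assume "a < 0"
    then show "eventually (\<lambda>\<rho>. a < enn2real (\<integral>\<^sup>+ s. ennreal (s ^ d) * indicator {t * v \<rho><..} s \<partial>Q)) at_top"
      by (intro always_eventually allI) (rule less_le_trans[OF _ enn2real_nonneg])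
  qed
qed

text \<open>Since \<open>v\<^sup>d\<close> times the tail at \<open>v\<close> is at most the truncated \<open>d\<close>-th moment, it tends to \<open>0\<close>, whereas
\<open>\<gamma> \<rho>\<^sup>d\<close> times the same tail tends to \<open>1\<close>.\<close>

lemma scale_le_index: "eventually (\<lambda>\<rho>. v \<rho> \<le> \<rho>) at_top"
proof -
  have pos: "eventually (\<lambda>\<rho>. v \<rho> > 0 \<and> \<rho> > 0) at_top"
    using filterlim_at_top_dense[THEN iffD1, OF scale_at_top, rule_format, of 0] eventually_gt_at_top[of 0]
    by eventually_elim simp
  have "((\<lambda>\<rho>. \<gamma> * \<rho> ^ d * tail (1 * v \<rho>)) \<longlongrightarrow> 1 powr (- \<alpha>)) at_top" by (rule tail_scale) simp
  then have "eventually (\<lambda>\<rho>. \<gamma> * \<rho> ^ d * tail (1 * v \<rho>) > 1 / 2) at_top"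
    by (rule order_tendstoD) simp
  moreover have "eventually (\<lambda>\<rho>. enn2real (\<integral>\<^sup>+ s. ennreal (s ^ d) * indicator {1 * v \<rho><..} s \<partial>Q) < 1 / (2 * \<gamma>)) at_top"
    using gamma_pos by (intro order_tendstoD[OF moment_tail_tendsto]) auto
  ultimately show ?thesis using pos
  proof eventually_elim
    case (elim \<rho>)
    have ray [measurable]: "{v \<rho><..} \<in> sets Q" using elim by (intro ray_sets) simp
    have "ennreal (v \<rho> ^ d * tail (v \<rho>)) = (\<integral>\<^sup>+ s. ennreal (v \<rho> ^ d) * indicator {v \<rho><..} s \<partial>Q)"
      using elim by (simp add: nn_integral_cmult tail_def emeasure_eq_measure ennreal_mult)
    also have le: "\<dots> \<le> (\<integral>\<^sup>+ s. ennreal (s ^ d) * indicator {v \<rho><..} s \<partial>Q)"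
      using elim by (intro nn_integral_mono) (auto simp: indicator_def intro!: ennreal_leI power_mono)
    finally have le: "ennreal (v \<rho> ^ d * tail (v \<rho>)) \<le> (\<integral>\<^sup>+ s. ennreal (s ^ d) * indicator {v \<rho><..} s \<partial>Q)" .
    have "(\<integral>\<^sup>+ s. ennreal (s ^ d) * indicator {v \<rho><..} s \<partial>Q) \<le> (\<integral>\<^sup>+ s. ennreal (s ^ d) \<partial>Q)"
      by (intro nn_integral_mono) (auto simp: indicator_def)
    also have "\<dots> < \<infinity>" by (rule moment_finite[OF alpha_gt])
    finally have "v \<rho> ^ d * tail (v \<rho>) \<le> enn2real (\<integral>\<^sup>+ s. ennreal (s ^ d) * indicator {v \<rho><..} s \<partial>Q)"
      using enn2real_mono[OF le] elim tail_nonneg[of "v \<rho>"] by (simp add: less_top)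
    also have "\<dots> < 1 / (2 * \<gamma>)" using elim by simp
    also have "\<dots> < \<rho> ^ d * tail (v \<rho>)" using elim gamma_pos by (simp add: field_simps)
    finally have "v \<rho> ^ d < \<rho> ^ d" using tail_pos[of "v \<rho>"] elim by simp
    then show ?case using elim by (meson less_imp_le power_less_imp_less_base)
  qed
qed

text \<open>By the normalization \<open>\<rho>\<^sup>d\<close> is comparable with the reciprocal of the tail at \<open>v\<close>.\<close>

lemma index_power_exp_scale:
  assumes c: "c > 0"
  shows "((\<lambda>\<rho>. \<rho> ^ d * exp (- c * v \<rho>)) \<longlongrightarrow> 0) at_top"
proof -
  have "((\<lambda>\<rho>. exp (- c * v \<rho>) / tail (v \<rho>)) \<longlongrightarrow> 0) at_top"
    by (rule filterlim_compose[OF exp_over_tail[OF c] scale_at_top])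
  then have lim: "((\<lambda>\<rho>. (\<gamma> * \<rho> ^ d * tail (1 * v \<rho>)) * (exp (- c * v \<rho>) / tail (v \<rho>)) / \<gamma>) \<longlongrightarrow> 1 powr (- \<alpha>) * 0 / \<gamma>) at_top"
    using gamma_pos by (intro tendsto_intros tail_scale) auto
  have "eventually (\<lambda>\<rho>. v \<rho> > 0) at_top"
    using filterlim_at_top_dense[THEN iffD1, OF scale_at_top] by blast
  then have "eventually (\<lambda>\<rho>. (\<gamma> * \<rho> ^ d * tail (1 * v \<rho>)) * (exp (- c * v \<rho>) / tail (v \<rho>)) / \<gamma>
       = \<rho> ^ d * exp (- c * v \<rho>)) at_top"
  proof eventually_elim
    case (elim \<rho>)
    then show ?case using gamma_pos tail_pos[of "v \<rho>"] by simp
  qed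
  from filterlim_cong[OF refl refl this] lim show ?thesis by simp
qed

end

section \<open>Estimates for Poisson counts\<close>

lemma (in prob_space) indep_vars_pair:
  assumes "indep_vars (\<lambda>_. N) X {0, 1::nat}" "S \<in> sets N" "T \<in> sets N"
  shows "prob {\<omega> \<in> space M. X 0 \<omega> \<in> S \<and> X 1 \<omega> \<in> T}
       = prob {\<omega> \<in> space M. X 0 \<omega> \<in> S} * prob {\<omega> \<in> space M. X 1 \<omega> \<in> T}"
proof -
  have "prob (\<Inter>j\<in>{0, 1}. X j -` (if j = 0 then S else T) \<inter> space M)
      = (\<Prod>j\<in>{0, 1}. prob (X j -` (if j = 0 then S else T) \<inter> space M))"
    using assms by (intro indep_varsD) auto
  moreover have "(\<Inter>j\<in>{0, 1}. X j -` (if j = 0 then S else T) \<inter> space M)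
      = {\<omega> \<in> space M. X 0 \<omega> \<in> S \<and> X 1 \<omega> \<in> T}" by auto
  moreover have "X j -` A \<inter> space M = {\<omega> \<in> space M. X j \<omega> \<in> A}" for j A by auto
  ultimately show ?thesis by simp
qed

locale poisson_laguerre = heavy_tail_scaling Q \<alpha> \<gamma> "DIM('a::euclidean_space)"
  for Q \<alpha> \<gamma> +
  fixes W :: "'a::euclidean_space set" and P :: "'w measure"
    and \<eta> :: "'w \<Rightarrow> ('a::euclidean_space \<times> real) measure"
  assumes compact_W: "compact W" and volume_W: "emeasure lborel W = 1"
    and poisson: "poisson_process P (scale_measure (ennreal \<gamma>) (lborel \<Otimes>\<^sub>M Q)) \<eta>"
begin

definition \<Lambda> :: "('a \<times> real) measure" where
  "\<Lambda> = scale_measure (ennreal \<gamma>) (lborel \<Otimes>\<^sub>M Q)"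

lemma poisson_\<Lambda>: "poisson_process P \<Lambda> \<eta>"
  using poisson by (simp add: \<Lambda>_def)

lemma sets_\<Lambda> [measurable_cong]: "sets \<Lambda> = sets (lborel \<Otimes>\<^sub>M Q)"
  by (simp add: \<Lambda>_def)

lemma space_\<Lambda>: "space \<Lambda> = UNIV \<times> {0..}"
  by (simp add: \<Lambda>_def space_scale_measure space_pair_measure space_Q)

lemma borel_trace_\<Lambda>:
  assumes "A \<in> sets borel"
  shows "A \<inter> space \<Lambda> \<in> sets \<Lambda>"
proof -
  have "(\<lambda>s. s) \<in> borel_measurable Q"
    by (rule measurableI) (auto simp: sets_Q_iff space_Q)
  from measurable_compose[OF measurable_snd this]
  have [measurable]: "snd \<in> borel_measurable (lborel \<Otimes>\<^sub>M Q)" .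
  have [measurable]: "fst \<in> borel_measurable (lborel \<Otimes>\<^sub>M Q)"
    using measurable_compose[OF measurable_fst[of lborel Q], of "\<lambda>x. x" borel] by simp
  have "(\<lambda>p. (fst p, snd p)) \<in> borel_measurable (lborel \<Otimes>\<^sub>M Q)" by measurable
  from measurable_sets[OF this assms] show ?thesis
    by (simp add: vimage_def \<Lambda>_def space_scale_measure Collect_conj_eq)
qed

sublocale P: prob_space P
  using poisson by (simp add: poisson_process_def)

sublocale laguerre_kernel P \<Lambda> \<eta>
proof
  show "space \<Lambda> \<noteq> {}" by (simp add: space_\<Lambda>)
qed (use poisson_\<Lambda> borel_trace_\<Lambda> in \<open>auto simp: poisson_process_def\<close>)

abbreviation cnt :: "('a \<times> real) set \<Rightarrow> 'w \<Rightarrow> ennreal" where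
  "cnt B \<omega> \<equiv> emeasure (\<eta> \<omega>) B"

lemma cnt_measurable [measurable]: "B \<in> sets \<Lambda> \<Longrightarrow> cnt B \<in> borel_measurable P"
  by (rule measurable_count)

lemma times_sets [measurable]: "A \<in> sets borel \<Longrightarrow> B \<in> sets Q \<Longrightarrow> A \<times> B \<in> sets \<Lambda>"
  by (simp add: sets_\<Lambda>)

lemma intensity_times:
  "A \<in> sets borel \<Longrightarrow> B \<in> sets Q \<Longrightarrow>
   emeasure \<Lambda> (A \<times> B) = ennreal \<gamma> * (emeasure lborel A * emeasure Q B)"
  by (simp add: \<Lambda>_def emeasure_pair_measure_Times)

lemma prob_cnt:
  assumes "B \<in> sets \<Lambda>" "emeasure \<Lambda> B < \<infinity>"
  shows "P.prob {\<omega>\<in>space P. cnt B \<omega> = of_nat k} = measure \<Lambda> B ^ k / fact k * exp (- measure \<Lambda> B)"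
  using poisson_\<Lambda> assms by (auto simp: poisson_process_def)

lemma prob_cnt_0:
  assumes "B \<in> sets \<Lambda>" "emeasure \<Lambda> B < \<infinity>"
  shows "P.prob {\<omega>\<in>space P. cnt B \<omega> = 0} = exp (- measure \<Lambda> B)"
  using prob_cnt[OF assms, of 0] by simp

lemma prob_cnt_1:
  assumes "B \<in> sets \<Lambda>" "emeasure \<Lambda> B < \<infinity>"
  shows "P.prob {\<omega>\<in>space P. cnt B \<omega> = 1} = measure \<Lambda> B * exp (- measure \<Lambda> B)"
  using prob_cnt[OF assms, of 1] by simp

lemma prob_cnt_pos:
  assumes [measurable]: "B \<in> sets \<Lambda>" and fin: "emeasure \<Lambda> B < \<infinity>"
  shows "P.prob {\<omega>\<in>space P. cnt B \<omega> \<noteq> 0} \<le> measure \<Lambda> B"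
proof -
  have "P.prob {\<omega>\<in>space P. \<not> cnt B \<omega> = 0} = 1 - P.prob {\<omega>\<in>space P. cnt B \<omega> = 0}"
    by (rule P.prob_neg) measurable
  also have "\<dots> \<le> measure \<Lambda> B"
    using exp_ge_add_one_self[of "- measure \<Lambda> B"] unfolding prob_cnt_0[OF assms] by linarith
  finally show ?thesis .
qed

lemma prob_cnt_ge_2:
  assumes [measurable]: "B \<in> sets \<Lambda>" and fin: "emeasure \<Lambda> B < \<infinity>"
  shows "P.prob {\<omega>\<in>space P. cnt B \<omega> \<noteq> 0 \<and> cnt B \<omega> \<noteq> 1} \<le> (measure \<Lambda> B)\<^sup>2"
proof -
  define l where "l = measure \<Lambda> B"
  have "P.prob {\<omega>\<in>space P. cnt B \<omega> \<noteq> 0 \<and> cnt B \<omega> \<noteq> 1}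
      = P.prob {\<omega>\<in>space P. \<not> (cnt B \<omega> = 0 \<or> cnt B \<omega> = 1)}" by simp
  also have "\<dots> = 1 - P.prob {\<omega>\<in>space P. cnt B \<omega> = 0 \<or> cnt B \<omega> = 1}"
    by (rule P.prob_neg) measurable
  also have "{\<omega>\<in>space P. cnt B \<omega> = 0 \<or> cnt B \<omega> = 1}
      = {\<omega>\<in>space P. cnt B \<omega> = 0} \<union> {\<omega>\<in>space P. cnt B \<omega> = 1}" by auto
  also have "P.prob \<dots> = P.prob {\<omega>\<in>space P. cnt B \<omega> = 0} + P.prob {\<omega>\<in>space P. cnt B \<omega> = 1}"
    by (intro P.finite_measure_Union) auto
  also have "1 - \<dots> = 1 - (1 + l) * exp (- l)"
    unfolding prob_cnt_0[OF assms] prob_cnt_1[OF assms] l_def by (simp add: algebra_simps)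
  also have "\<dots> \<le> 1 - (1 + l) * (1 - l)"
    using exp_ge_add_one_self[of "- l"] by (intro diff_left_mono mult_left_mono) (auto simp: l_def)
  also have "\<dots> = l\<^sup>2" by (simp add: power2_eq_square algebra_simps)
  finally show ?thesis by (simp add: l_def)
qed

lemma prob_cnt_disjoint:
  assumes "A \<in> sets \<Lambda>" "B \<in> sets \<Lambda>" "A \<inter> B = {}" "S \<in> sets borel" "T \<in> sets borel"
  shows "P.prob {\<omega>\<in>space P. cnt A \<omega> \<in> S \<and> cnt B \<omega> \<in> T}
       = P.prob {\<omega>\<in>space P. cnt A \<omega> \<in> S} * P.prob {\<omega>\<in>space P. cnt B \<omega> \<in> T}"
proof -
  define C where "C i = (if i = (0::nat) then A else B)" for i
  have "P.indep_vars (\<lambda>_. borel) (\<lambda>i \<omega>. cnt (C i) \<omega>) {0, 1}"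
    using poisson_\<Lambda> assms unfolding poisson_process_def
    by (elim conjE allE[of _ "{0, 1}"] allE[of _ C] mp) (auto simp: C_def disjoint_family_on_def)
  from P.indep_vars_pair[OF this assms(4,5)] show ?thesis by (simp add: C_def)
qed

text \<open>A substitute for the second factorial moment: the event forces either two points in \<open>C\<close>, or one in \<open>C\<close>
and one in the disjoint set \<open>N - C\<close>, and the latter two counts are independent.\<close>

lemma prob_pair_le:
  assumes C [measurable]: "C \<in> sets \<Lambda>" and N [measurable]: "N \<in> sets \<Lambda>" and sub: "C \<subseteq> N"
    and fin: "emeasure \<Lambda> N < \<infinity>"
  shows "P.prob {\<omega>\<in>space P. cnt C \<omega> \<noteq> 0 \<and> cnt N \<omega> \<noteq> 1} \<le> 2 * (measure \<Lambda> C * measure \<Lambda> N)"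
proof -
  have finC: "emeasure \<Lambda> C < \<infinity>" and finD: "emeasure \<Lambda> (N - C) < \<infinity>"
    using emeasure_mono[OF sub N] emeasure_mono[OF Diff_subset N] fin by (auto intro: le_less_trans)
  have fm: "N \<in> fmeasurable \<Lambda>" using fin by (intro fmeasurableI) auto
  have le: "measure \<Lambda> C \<le> measure \<Lambda> N" "measure \<Lambda> (N - C) \<le> measure \<Lambda> N"
    using sub by (auto intro!: measure_mono_fmeasurable fm)
  have split: "cnt N \<omega> = cnt C \<omega> + cnt (N - C) \<omega>" if "\<omega> \<in> space P" for \<omega>
  proof -
    have "cnt (C \<union> (N - C)) \<omega> = cnt C \<omega> + cnt (N - C) \<omega>"
      by (rule plus_emeasure[symmetric]) (auto simp: sets_kernel[OF that])
    moreover have "C \<union> (N - C) = N" using sub by blast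
    ultimately show ?thesis by simp
  qed
  have "P.prob {\<omega>\<in>space P. cnt C \<omega> \<noteq> 0 \<and> cnt N \<omega> \<noteq> 1}
      \<le> P.prob ({\<omega>\<in>space P. cnt C \<omega> \<noteq> 0 \<and> cnt C \<omega> \<noteq> 1}
          \<union> {\<omega>\<in>space P. cnt C \<omega> \<in> - {0} \<and> cnt (N - C) \<omega> \<in> - {0}})"
  proof (rule P.finite_measure_mono)
    show "{\<omega>\<in>space P. cnt C \<omega> \<noteq> 0 \<and> cnt N \<omega> \<noteq> 1}
      \<subseteq> {\<omega>\<in>space P. cnt C \<omega> \<noteq> 0 \<and> cnt C \<omega> \<noteq> 1}
          \<union> {\<omega>\<in>space P. cnt C \<omega> \<in> - {0} \<and> cnt (N - C) \<omega> \<in> - {0}}"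
      using split by auto
  qed measurable
  also have "\<dots> \<le> P.prob {\<omega>\<in>space P. cnt C \<omega> \<noteq> 0 \<and> cnt C \<omega> \<noteq> 1}
      + P.prob {\<omega>\<in>space P. cnt C \<omega> \<in> - {0} \<and> cnt (N - C) \<omega> \<in> - {0}}"
    by (rule measure_Un_le) measurable
  also have "P.prob {\<omega>\<in>space P. cnt C \<omega> \<in> - {0} \<and> cnt (N - C) \<omega> \<in> - {0}}
      = P.prob {\<omega>\<in>space P. cnt C \<omega> \<in> - {0}} * P.prob {\<omega>\<in>space P. cnt (N - C) \<omega> \<in> - {0}}"
    by (rule prob_cnt_disjoint) auto
  also have "\<dots> \<le> measure \<Lambda> C * measure \<Lambda> N"
    using prob_cnt_pos[OF C finC] prob_cnt_pos[OF _ finD] le(2)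
    by (intro mult_mono) (auto intro: order_trans)
  also have "P.prob {\<omega>\<in>space P. cnt C \<omega> \<noteq> 0 \<and> cnt C \<omega> \<noteq> 1} \<le> measure \<Lambda> C * measure \<Lambda> N"
  proof -
    have "(measure \<Lambda> C)\<^sup>2 \<le> measure \<Lambda> C * measure \<Lambda> N"
      unfolding power2_eq_square using le by (intro mult_left_mono) auto
    then show ?thesis using prob_cnt_ge_2[OF C finC] by linarith
  qed
  finally show ?thesis by simp
qed

lemma prob_one_in_none_in:
  assumes A [measurable]: "A \<in> sets \<Lambda>" and B [measurable]: "B \<in> sets \<Lambda>"
    and disj: "A \<inter> B = {}" and fin: "emeasure \<Lambda> (A \<union> B) < \<infinity>"
  shows "P.prob {\<omega>\<in>space P. cnt A \<omega> = 1 \<and> cnt B \<omega> = 0} = measure \<Lambda> A * exp (- measure \<Lambda> (A \<union> B))"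
proof -
  have finA: "emeasure \<Lambda> A < \<infinity>" and finB: "emeasure \<Lambda> B < \<infinity>"
    using emeasure_mono[OF Un_upper1, of A B \<Lambda>] emeasure_mono[OF Un_upper2, of A B \<Lambda>] A B fin by (auto intro: le_less_trans)
  have "measure \<Lambda> (A \<union> B) = measure \<Lambda> A + measure \<Lambda> B"
    using finA finB disj by (intro measure_Union) auto
  moreover have "P.prob {\<omega>\<in>space P. cnt A \<omega> \<in> {1} \<and> cnt B \<omega> \<in> {0}}
      = P.prob {\<omega>\<in>space P. cnt A \<omega> \<in> {1}} * P.prob {\<omega>\<in>space P. cnt B \<omega> \<in> {0}}"
    by (rule prob_cnt_disjoint) (auto simp: disj)
  ultimately show ?thesis
    using prob_cnt_1[OF A finA] prob_cnt_0[OF B finB] by (simp add: exp_add[symmetric] algebra_simps)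
qed

section \<open>Absence of holes and of interference\<close>

definition no_hole :: "real \<Rightarrow> real \<Rightarrow> 'w \<Rightarrow> bool" where
  "no_hole h k \<omega> \<longleftrightarrow> (\<forall>z\<in>indices k. cnt (cube h z \<times> {0..}) \<omega> \<noteq> 0)"

lemma nonneg_sets [measurable]: "{0..} \<in> sets Q"
  using sets.top[of Q] by (simp add: space_Q)

lemma no_hole_measurable [measurable]: "Measurable.pred P (no_hole h k)"
proof -
  have "cube h z \<times> {0..} \<in> sets \<Lambda>" for z by (rule times_sets) measurable
  note [measurable] = this finite_indices[THEN countable_finite]
  show ?thesis unfolding no_hole_def by measurable
qed

lemma no_hole_point:
  fixes h k :: real
  assumes "no_hole h k \<omega>" "\<omega> \<in> space P" "h > 0" "norm (x :: 'a) \<le> k * h"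
  shows "\<exists>y t. (y, t) \<in> points (\<eta> \<omega>) \<and> norm (y - x) \<le> DIM('a) * h"
proof -
  obtain z where z: "z \<in> indices k" "x \<in> cube h z" using in_some_cube[OF assms(3,4)] .
  have "cnt (cube h z \<times> {0..}) \<omega> > 0" using assms(1) z(1) by (simp add: no_hole_def zero_less_iff_neq_zero)
  then obtain p where p: "p \<in> points (\<eta> \<omega>)" "p \<in> cube h z \<times> {0..}"
    using exists_point_iff[OF assms(2) times_sets[OF cube_sets nonneg_sets]] by blast
  then show ?thesis using cube_diameter[OF _ z(2), of "fst p"]
    by (intro exI[of _ "fst p"] exI[of _ "snd p"]) auto
qed

text \<open>Union bound over at most \<open>(5 k)\<^sup>d\<close> cubes, each empty with probability \<open>exp (- \<gamma> h\<^sup>d)\<close>.\<close>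

lemma prob_hole_le:
  fixes h k :: real
  assumes h: "h > 0" and k: "k \<ge> 1"
  shows "P.prob {\<omega>\<in>space P. \<not> no_hole h k \<omega>} \<le> (5 * k) ^ DIM('a) * exp (- \<gamma> * h ^ DIM('a))"
proof -
  have C [measurable]: "cube h z \<times> {0..} \<in> sets \<Lambda>" for z :: "'a \<Rightarrow> int" by (rule times_sets) measurable
  have em: "emeasure \<Lambda> (cube h z \<times> {0..}) = ennreal (\<gamma> * h ^ DIM('a))" for z :: "'a \<Rightarrow> int"
    using h gamma_pos emeasure_space_1
    by (subst intensity_times) (auto simp: emeasure_cube space_Q ennreal_mult)
  then have me: "measure \<Lambda> (cube h z \<times> {0..}) = \<gamma> * h ^ DIM('a)" for z :: "'a \<Rightarrow> int"
    using gamma_pos h by (simp add: measure_def)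
  have "{\<omega>\<in>space P. \<not> no_hole h k \<omega>} = (\<Union>z\<in>indices k. {\<omega>\<in>space P. cnt (cube h z \<times> {0..}) \<omega> = 0})"
    by (auto simp: no_hole_def)
  also have "P.prob \<dots> \<le> (\<Sum>z\<in>indices k. P.prob {\<omega>\<in>space P. cnt (cube h z \<times> {0..}) \<omega> = 0})"
    by (intro P.finite_measure_subadditive_finite finite_indices) auto
  also have "\<dots> = card (indices k :: ('a \<Rightarrow> int) set) * exp (- \<gamma> * h ^ DIM('a))"
    by (simp add: prob_cnt_0[OF C] em me)
  also have "\<dots> \<le> (5 * k) ^ DIM('a) * exp (- \<gamma> * h ^ DIM('a))"
    using card_indices[OF k] by (intro mult_right_mono) auto
  finally show ?thesis .
qed

text \<open>Up to the slack \<open>D\<close>, the points that can cut into the cell of a nucleus near \<open>c\<close> before its own mark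
does: their mark exceeds a threshold \<open>u\<close> and roughly also the distance to \<open>c\<close>.\<close>

definition reach :: "'a \<Rightarrow> real \<Rightarrow> real \<Rightarrow> ('a \<times> real) set" where
  "reach c u D = {(y, t). u < t \<and> norm (y - c) < t + D}"

text \<open>For \<open>D\<close> at least the diameter of the cubes, the region \<open>reach\<close> of a cube contains all points over that
cube with mark above \<open>u\<close>. Count \<open>1\<close> thus means that such a point is alone in the whole region.\<close>

definition no_interference :: "real \<Rightarrow> real \<Rightarrow> real \<Rightarrow> real \<Rightarrow> 'w \<Rightarrow> bool" where
  "no_interference h k u D \<omega> \<longleftrightarrow>
     (\<forall>z\<in>indices k. cnt (cube h z \<times> {u<..}) \<omega> = 0 \<or> cnt (reach (corner h z) u D) \<omega> = 1)"

lemma reach_sets [measurable]: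
  assumes "u \<ge> 0"
  shows "reach c u D \<in> sets \<Lambda>"
proof -
  have "reach c u D = {p \<in> space \<Lambda>. u < snd p \<and> norm (fst p - c) < snd p + D}"
    using assms by (auto simp: reach_def space_\<Lambda>)
  also have "\<dots> \<in> sets \<Lambda>" by measurable
  finally show ?thesis .
qed

lemma no_interference_measurable [measurable]:
  assumes "u \<ge> 0"
  shows "Measurable.pred P (no_interference h k u D)"
proof -
  note [measurable] = finite_indices[THEN countable_finite] reach_sets[OF assms] times_sets[OF cube_sets ray_sets[OF assms]]
  show ?thesis unfolding no_interference_def by measurable
qed

text \<open>At mark level \<open>t\<close> the region is a ball of radius \<open>t + D \<le> (1 + D / u) t\<close>; integrate its volume over
the marks.\<close>

lemma intensity_reach_le:
  assumes u: "u > 0" and D: "D \<ge> 0"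
  shows "emeasure \<Lambda> (reach c u D)
    \<le> ennreal (\<gamma> * unit_ball_vol DIM('a) * (1 + D / u) ^ DIM('a))
        * (\<integral>\<^sup>+ t. ennreal (t ^ DIM('a)) * indicator {u<..} t \<partial>Q)"
proof -
  define K where "K = unit_ball_vol DIM('a) * (1 + D / u) ^ DIM('a)"
  have K: "K \<ge> 0" using u D by (simp add: K_def)
  interpret pair_sigma_finite "lborel :: 'a measure" Q
    by (intro pair_sigma_finite.intro lborel.sigma_finite_measure_axioms sigma_finite_measure_axioms)
  have [measurable]: "(\<lambda>s. s) \<in> borel_measurable Q"
    by (rule measurableI) (auto simp: sets_Q_iff space_Q)
  have [measurable]: "{u<..} \<in> sets Q" using u by (intro ray_sets) simp
  have R: "reach c u D \<in> sets (lborel \<Otimes>\<^sub>M Q)" using reach_sets[of u c D] u by (simp add: sets_\<Lambda>)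
  have "emeasure (lborel \<Otimes>\<^sub>M Q) (reach c u D) = (\<integral>\<^sup>+ t. emeasure lborel ((\<lambda>x. (x, t)) -` reach c u D) \<partial>Q)"
    by (rule emeasure_pair_measure_alt2[OF R])
  also have "\<dots> \<le> (\<integral>\<^sup>+ t. ennreal K * (ennreal (t ^ DIM('a)) * indicator {u<..} t) \<partial>Q)"
  proof (rule nn_integral_mono)
    fix t
    show "emeasure lborel ((\<lambda>x. (x, t)) -` reach c u D) \<le> ennreal K * (ennreal (t ^ DIM('a)) * indicator {u<..} t)"
    proof (cases "u < t")
      case True
      have "(\<lambda>x. (x, t)) -` reach c u D \<subseteq> cball c (t + D)"
        by (auto simp: reach_def dist_norm norm_minus_commute)
      then have "emeasure lborel ((\<lambda>x. (x, t)) -` reach c u D) \<le> emeasure lborel (cball c (t + D))"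
        by (rule emeasure_mono) simp
      also have "\<dots> = ennreal (unit_ball_vol DIM('a) * (t + D) ^ DIM('a))"
        using True u D by (subst emeasure_cball) auto
      also have "\<dots> \<le> ennreal (K * t ^ DIM('a))"
      proof (rule ennreal_leI)
        have "D * 1 \<le> D * (t / u)" using True u D by (intro mult_left_mono) auto
        then have "t + D \<le> (1 + D / u) * t" by (simp add: algebra_simps)
        then have "(t + D) ^ DIM('a) \<le> ((1 + D / u) * t) ^ DIM('a)"
          using True u D by (intro power_mono) auto
        then show "unit_ball_vol DIM('a) * (t + D) ^ DIM('a) \<le> K * t ^ DIM('a)"
          unfolding K_def power_mult_distrib mult.assoc by (intro mult_left_mono) auto
      qed
      finally show ?thesis using True K u by (simp add: ennreal_mult)
    qed (auto simp: reach_def)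
  qed
  also have "\<dots> = ennreal K * (\<integral>\<^sup>+ t. ennreal (t ^ DIM('a)) * indicator {u<..} t \<partial>Q)"
    by (rule nn_integral_cmult) measurable
  finally have "ennreal \<gamma> * emeasure (lborel \<Otimes>\<^sub>M Q) (reach c u D)
      \<le> ennreal \<gamma> * (ennreal K * (\<integral>\<^sup>+ t. ennreal (t ^ DIM('a)) * indicator {u<..} t \<partial>Q))"
    by (rule mult_left_mono) simp
  then show ?thesis
    using K gamma_pos by (simp add: K_def \<Lambda>_def ennreal_mult mult.assoc)
qed

text \<open>Union bound over the cubes with \<open>prob_pair_le\<close>. The number of cubes times the volume of one is of the
order of the volume of the ball of radius \<open>k h\<close>, so one factor is the expected number of large marks
there and the other is a truncated moment.\<close>

lemma prob_interference_le:
  fixes h k :: real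
  assumes h: "h > 0" and k: "k \<ge> 1" and u: "u > 0" and D: "D \<ge> DIM('a) * h"
  shows "P.prob {\<omega>\<in>space P. \<not> no_interference h k u D \<omega>}
    \<le> 2 * (5 * k * h) ^ DIM('a) * (\<gamma> * tail u) * (\<gamma> * unit_ball_vol DIM('a) * (1 + D / u) ^ DIM('a)
        * enn2real (\<integral>\<^sup>+ t. ennreal (t ^ DIM('a)) * indicator {u<..} t \<partial>Q))"
proof -
  define I where "I = (\<integral>\<^sup>+ t. ennreal (t ^ DIM('a)) * indicator {u<..} t \<partial>Q)"
  define K where "K = \<gamma> * unit_ball_vol DIM('a) * (1 + D / u) ^ DIM('a)"
  have u0: "u \<ge> 0" using u by simp
  have "0 \<le> real DIM('a) * h" using h by simp
  then have D0: "D \<ge> 0" using D by linarith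
  have K: "K \<ge> 0" using u D0 gamma_pos by (simp add: K_def)
  have "I \<le> (\<integral>\<^sup>+ t. ennreal (t ^ DIM('a)) \<partial>Q)"
    unfolding I_def by (intro nn_integral_mono) (auto simp: indicator_def)
  then have I: "I < \<infinity>" using moment_finite[OF alpha_gt] by (rule le_less_trans)
  define C where "C z = cube h z \<times> {u<..}" for z :: "'a \<Rightarrow> int"
  define N where "N z = reach (corner h z) u D" for z :: "'a \<Rightarrow> int"
  have C [measurable]: "C z \<in> sets \<Lambda>" and N [measurable]: "N z \<in> sets \<Lambda>" for z
    unfolding C_def N_def using u0 by (auto intro!: times_sets reach_sets cube_sets ray_sets)
  have sub: "C z \<subseteq> N z" for z
  proof
    fix p assume p: "p \<in> C z"
    then have "norm (fst p - corner h z) \<le> DIM('a) * h"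
      by (intro cube_diameter[OF _ corner_in_cube[OF h]]) (auto simp: C_def)
    then show "p \<in> N z" using p D u by (auto simp: C_def N_def reach_def)
  qed
  have eC: "emeasure \<Lambda> (C z) = ennreal (h ^ DIM('a) * (\<gamma> * tail u))" for z
    unfolding C_def using h gamma_pos u0
    by (subst intensity_times) (auto simp: emeasure_cube tail_def emeasure_eq_measure ennreal_mult mult_ac)
  then have mC: "measure \<Lambda> (C z) = h ^ DIM('a) * (\<gamma> * tail u)" for z
    using h gamma_pos tail_nonneg[of u] by (simp add: measure_def)
  have eN: "emeasure \<Lambda> (N z) \<le> ennreal K * I" for z
    unfolding N_def K_def I_def by (rule intensity_reach_le[OF u D0])
  have fin: "ennreal K * I < \<infinity>" using I by (simp add: ennreal_mult_less_top)
  have finN: "emeasure \<Lambda> (N z) < \<infinity>" for z using eN fin by (rule le_less_trans)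
  have mN: "measure \<Lambda> (N z) \<le> K * enn2real I" for z
    using enn2real_mono[OF eN] fin K by (simp add: measure_def enn2real_mult)
  have "{\<omega>\<in>space P. \<not> no_interference h k u D \<omega>} = (\<Union>z\<in>indices k. {\<omega>\<in>space P. cnt (C z) \<omega> \<noteq> 0 \<and> cnt (N z) \<omega> \<noteq> 1})"
    by (auto simp: no_interference_def C_def N_def)
  also have "P.prob \<dots> \<le> (\<Sum>z\<in>indices k. P.prob {\<omega>\<in>space P. cnt (C z) \<omega> \<noteq> 0 \<and> cnt (N z) \<omega> \<noteq> 1})"
    by (intro P.finite_measure_subadditive_finite finite_indices) auto
  also have "\<dots> \<le> (\<Sum>z\<in>(indices k :: ('a \<Rightarrow> int) set). 2 * ((h ^ DIM('a) * (\<gamma> * tail u)) * (K * enn2real I)))"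
  proof (rule sum_mono)
    fix z :: "'a \<Rightarrow> int"
    have "P.prob {\<omega>\<in>space P. cnt (C z) \<omega> \<noteq> 0 \<and> cnt (N z) \<omega> \<noteq> 1} \<le> 2 * (measure \<Lambda> (C z) * measure \<Lambda> (N z))"
      by (rule prob_pair_le[OF C N sub finN])
    also have "\<dots> \<le> 2 * ((h ^ DIM('a) * (\<gamma> * tail u)) * (K * enn2real I))"
      unfolding mC using mN h gamma_pos tail_nonneg[of u] by (intro mult_left_mono) auto
    finally show "P.prob {\<omega>\<in>space P. cnt (C z) \<omega> \<noteq> 0 \<and> cnt (N z) \<omega> \<noteq> 1}
      \<le> 2 * ((h ^ DIM('a) * (\<gamma> * tail u)) * (K * enn2real I))" .
  qed
  also have "\<dots> = real (card (indices k :: ('a \<Rightarrow> int) set)) * (2 * ((h ^ DIM('a) * (\<gamma> * tail u)) * (K * enn2real I)))"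
    by simp
  also have "\<dots> \<le> (5 * k) ^ DIM('a) * (2 * ((h ^ DIM('a) * (\<gamma> * tail u)) * (K * enn2real I)))"
    using card_indices[OF k, where 'a='a] h gamma_pos tail_nonneg[of u] K by (intro mult_right_mono) auto
  also have "\<dots> = 2 * (5 * k * h) ^ DIM('a) * (\<gamma> * tail u) * (K * enn2real I)"
    by (simp add: power_mult_distrib mult_ac)
  finally show ?thesis unfolding K_def I_def .
qed

lemma no_interference_far:
  fixes h k :: real
  assumes ni: "no_interference h k u D \<omega>" and \<omega>: "\<omega> \<in> space P" and h: "h > 0"
    and u: "u > 0" and D: "D \<ge> DIM('a) * h"
    and p: "(x, m) \<in> points (\<eta> \<omega>)" "norm x \<le> k * h" "u < m"
    and q: "(y, t) \<in> points (\<eta> \<omega>)" "(y, t) \<noteq> (x, m)"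
  shows "t \<le> u \<or> t \<le> norm (y - x) - (D - DIM('a) * h)"
proof (rule ccontr)
  assume neg: "\<not> ?thesis"
  have u0: "u \<ge> 0" using u by simp
  obtain z where z: "z \<in> indices k" "x \<in> cube h z" using in_some_cube[OF h p(2)] .
  define c where "c = corner h z"
  have xc: "norm (x - c) \<le> DIM('a) * h" unfolding c_def by (rule cube_diameter[OF z(2) corner_in_cube[OF h]])
  have yc: "norm (y - c) \<le> norm (y - x) + norm (x - c)" using norm_triangle_ineq[of "y - x" "x - c"] by simp
  have xN: "(x, m) \<in> reach c u D" using xc D p u by (auto simp: reach_def)
  have yN: "(y, t) \<in> reach c u D" using xc yc neg by (auto simp: reach_def)
  have "cnt (cube h z \<times> {u<..}) \<omega> > 0"
    using exists_point_iff[OF \<omega> times_sets[OF cube_sets ray_sets[OF u0]], of h z] p z by force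
  then have one: "cnt (reach c u D) \<omega> = 1" using ni z(1) by (auto simp: no_interference_def c_def)
  have "2 \<le> cnt (reach c u D) \<omega>"
    by (rule two_points_count[OF \<omega> reach_sets[OF u0] p(1) q(1) _ xN yN]) (use q(2) in auto)
  then show False using one by simp
qed

end

section \<open>Weak convergence from lower bounds on boxes\<close>

text \<open>The second coordinate ranges over a short interval and the third over a slightly larger one that
contains it, with ratios controlled by \<open>s > 1\<close>. The third margin leaves room for the inradius to
differ from the mark.\<close>

definition box_near_diagonal :: "'a set \<Rightarrow> real \<Rightarrow> real \<Rightarrow> ('a::euclidean_space \<times> real \<times> real) set" where
  "box_near_diagonal V a s = V \<times> {a<..s * a} \<times> {a / s..s\<^sup>2 * a}"

lemma box_near_diagonal_sets [measurable]:
  "V \<in> sets borel \<Longrightarrow> box_near_diagonal V a s \<in> sets borel"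
  unfolding box_near_diagonal_def by (intro borel_Times) auto

lemma norm_triple_le: "norm (x, y, z) \<le> norm x + norm y + norm z"
  using norm_Pair_le[of x "(y, z)"] norm_Pair_le[of y z] by linarith

lemma borel_partition_of_compact:
  fixes W :: "'a::euclidean_space set"
  assumes "compact W" "\<delta> > 0"
  shows "\<exists>(V :: nat \<Rightarrow> 'a set) (N :: nat). (\<forall>j. V j \<in> sets borel \<and> V j \<subseteq> W) \<and> disjoint_family V
    \<and> W \<subseteq> (\<Union>j<N. V j) \<and> (\<forall>j. \<forall>x\<in>V j. \<forall>y\<in>V j. norm (x - y) < \<delta>)"
proof -
  obtain K where K: "finite K" "W \<subseteq> (\<Union>x\<in>K. ball x (\<delta> / 2))"
    using compact_eq_totally_bounded[of W] assms by (metis half_gt_zero)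
  obtain xs where xs: "set xs = K" using finite_list[OF K(1)] by blast
  define B where "B j = (if j < length xs then W \<inter> ball (xs ! j) (\<delta> / 2) else {})" for j
  have B: "B j \<in> sets borel" for j
    using borel_compact[OF assms(1)] by (auto simp: B_def)
  show ?thesis
  proof (intro exI[of _ "disjointed B"] exI[of _ "length xs"] conjI allI ballI)
    show "disjointed B j \<in> sets borel" for j
      using sets.range_disjointed_sets[of B borel] B by blast
    show "disjointed B j \<subseteq> W" for j
      using disjointed_subset[of B j] by (auto simp: B_def split: if_splits)
    show "disjoint_family (disjointed B)" by (rule disjoint_family_disjointed)
    show "W \<subseteq> (\<Union>j<length xs. disjointed B j)"
    proof
      fix x assume x: "x \<in> W"
      then obtain y where "y \<in> set xs" "x \<in> ball y (\<delta> / 2)" using K(2) xs by blast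
      then have "x \<in> (\<Union>j<length xs. B j)" using x by (auto simp: B_def in_set_conv_nth)
      then have "x \<in> (\<Union>j. disjointed B j)" unfolding UN_disjointed_eq by blast
      then obtain j where j: "x \<in> disjointed B j" by blast
      then have "x \<in> B j" using disjointed_subset[of B j] by blast
      then have "j < length xs" by (simp add: B_def split: if_splits)
      then show "x \<in> (\<Union>j<length xs. disjointed B j)" using j by blast
    qed
    show "norm (x - y) < \<delta>" if "x \<in> disjointed B j" "y \<in> disjointed B j" for j x y
    proof -
      have "x \<in> B j" "y \<in> B j" using that disjointed_subset[of B j] by auto
      then have "dist (xs ! j) x < \<delta> / 2" "dist (xs ! j) y < \<delta> / 2" by (auto simp: B_def split: if_splits)
      then have "dist x y < \<delta>" by (rule dist_triangle_half_r)
      then show ?thesis by (simp add: dist_norm)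
    qed
  qed
qed

text \<open>Only one of the two points has to lie in the compact set; the other one stays in a compact
neighbourhood.\<close>

lemma uniform_continuity_near_compact:
  fixes f :: "'b::euclidean_space \<Rightarrow> real"
  assumes "continuous_on UNIV f" "compact T" "\<epsilon> > 0"
  obtains \<delta> where "\<delta> > 0" "\<And>p y. p \<in> T \<Longrightarrow> norm (y - p) < \<delta> \<Longrightarrow> \<bar>f y - f p\<bar> < \<epsilon>"
proof -
  obtain r where r: "\<And>p. p \<in> T \<Longrightarrow> norm p \<le> r"
    using compact_imp_bounded[OF assms(2)] unfolding bounded_pos by blast
  have "uniformly_continuous_on (cball 0 (r + 1)) f"
    by (intro compact_uniformly_continuous continuous_on_subset[OF assms(1)]) auto
  then obtain d where d: "d > 0"
    "\<And>x x'. x \<in> cball 0 (r + 1) \<Longrightarrow> x' \<in> cball 0 (r + 1) \<Longrightarrow> dist x' x < d \<Longrightarrow> dist (f x') (f x) < \<epsilon>"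
    unfolding uniformly_continuous_on_def using assms(3) by (elim allE[of _ \<epsilon>]) blast
  show ?thesis
  proof (rule that[of "min d 1"])
    fix p y assume p: "p \<in> T" "norm (y - p) < min d 1"
    have "norm p \<le> r" using p r by blast
    moreover have "norm y \<le> norm p + norm (y - p)" using norm_triangle_ineq[of p "y - p"] by simp
    ultimately have "norm y \<le> r + 1" "norm p \<le> r + 1" using p by auto
    then have "dist (f y) (f p) < \<epsilon>" using d(2)[of p y] p by (auto simp: dist_norm)
    then show "\<bar>f y - f p\<bar> < \<epsilon>" by (simp add: dist_norm)
  qed (use d in auto)
qed

lemma sum_indicator_disjoint:
  fixes c :: "'i \<Rightarrow> real"
  assumes "finite I" "disjoint_family_on B I" "i \<in> I" "y \<in> B i"
  shows "(\<Sum>k\<in>I. c k * indicator (B k) y) = c i"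
proof -
  have "(\<Sum>k\<in>I - {i}. c k * indicator (B k) y) = 0"
    using assms by (intro sum.neutral) (auto simp: disjoint_family_on_def indicator_def)
  then show ?thesis using assms by (simp add: sum.remove[of I i] del: sum_mult_indicator)
qed

lemma geometric_strip_exists:
  fixes a s u :: real
  assumes "s > 1" "a > 0" "a < u" "u \<le> a * s ^ n"
  obtains i where "i < n" "a * s ^ i < u" "u \<le> s * (a * s ^ i)"
proof -
  define m where "m = (LEAST m. u \<le> a * s ^ m)"
  have m: "u \<le> a * s ^ m" unfolding m_def using assms(4) by (rule LeastI)
  have "m \<le> n" unfolding m_def using assms(4) by (rule Least_le)
  have "m \<noteq> 0" using m assms(3) by (intro notI) simp
  then obtain i where i: "m = Suc i" using not0_implies_Suc by blast
  have "a * s ^ i < u" using not_less_Least[of i "\<lambda>m. u \<le> a * s ^ m"] i unfolding m_def by simp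
  then show ?thesis using that[of i] m i \<open>m \<le> n\<close> by (simp add: mult_ac)
qed

lemma geometric_strips_disjoint:
  fixes a s :: real
  assumes "s > 1" "a > 0" "i \<noteq> k"
  shows "{a * s ^ i<..s * (a * s ^ i)} \<inter> {a * s ^ k<..s * (a * s ^ k)} = {}"
proof -
  have *: "{a * s ^ i<..s * (a * s ^ i)} \<inter> {a * s ^ k<..s * (a * s ^ k)} = {}" if "i < k" for i k
  proof -
    have "s ^ Suc i \<le> s ^ k" using that assms by (intro power_increasing) auto
    then have "a * s ^ Suc i \<le> a * s ^ k" using assms by simp
    then have "s * (a * s ^ i) \<le> a * s ^ k" by (simp add: mult_ac)
    then show ?thesis by auto
  qed
  show ?thesis using *[of i k] *[of k i] assms(3) by (cases "i < k") auto
qed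

locale uniform_frechet = prob_space P' for P' :: "'v measure" +
  fixes X :: "'v \<Rightarrow> 'a::euclidean_space" and F :: "'v \<Rightarrow> real" and W :: "'a set" and \<alpha> :: real
  assumes compact: "compact W" and volume: "emeasure lborel W = 1" and \<alpha>: "\<alpha> > 0"
    and X [measurable]: "X \<in> borel_measurable P'" and F [measurable]: "F \<in> borel_measurable P'"
    and distr_X: "distr P' borel X = uniform_measure lborel W"
    and distr_F: "\<And>u. u \<ge> 0 \<Longrightarrow>
           measure P' {\<omega>\<in>space P'. F \<omega> \<le> u} = (if u = 0 then 0 else exp (- (u powr (- \<alpha>))))"
    and indep: "independent_variables P' X F"
begin

lemma prob_X:
  assumes "V \<in> sets borel" "V \<subseteq> W"
  shows "prob {\<omega>\<in>space P'. X \<omega> \<in> V} = measure lborel V"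
proof -
  have W: "W \<in> sets borel" using compact by (simp add: borel_compact)
  have "prob {\<omega>\<in>space P'. X \<omega> \<in> V} = measure (distr P' borel X) V"
    using assms by (subst measure_distr) (auto simp: vimage_def Int_def conj_commute)
  also have "\<dots> = measure lborel V"
    unfolding distr_X measure_def using assms W volume by (subst emeasure_uniform_measure) (auto simp: Int_absorb1 divide_ennreal_def)
  finally show ?thesis .
qed

lemma prob_F:
  assumes "0 < a" "a \<le> b"
  shows "prob {\<omega>\<in>space P'. a < F \<omega> \<and> F \<omega> \<le> b} = exp (- (b powr (- \<alpha>))) - exp (- (a powr (- \<alpha>)))"
proof -
  have "{\<omega>\<in>space P'. a < F \<omega> \<and> F \<omega> \<le> b} = {\<omega>\<in>space P'. F \<omega> \<le> b} - {\<omega>\<in>space P'. F \<omega> \<le> a}" by auto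
  also have "prob \<dots> = prob {\<omega>\<in>space P'. F \<omega> \<le> b} - prob {\<omega>\<in>space P'. F \<omega> \<le> a}"
    using assms by (intro finite_measure_Diff) auto
  finally show ?thesis using assms distr_F[of a] distr_F[of b] by simp
qed

lemma prob_cell:
  assumes V: "V \<in> sets borel" "V \<subseteq> W" and a: "0 < a" "a \<le> b"
  shows "prob {\<omega>\<in>space P'. X \<omega> \<in> V \<and> a < F \<omega> \<and> F \<omega> \<le> b}
    = measure lborel V * (exp (- (b powr (- \<alpha>))) - exp (- (a powr (- \<alpha>))))"
proof -
  have "X -` V \<inter> space P' \<in> sets (vimage_algebra (space P') X borel)"
    "F -` {a<..b} \<inter> space P' \<in> sets (vimage_algebra (space P') F borel)"
    using V by (auto intro!: in_vimage_algebra)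
  then have "prob ((X -` V \<inter> space P') \<inter> (F -` {a<..b} \<inter> space P'))
      = prob (X -` V \<inter> space P') * prob (F -` {a<..b} \<inter> space P')"
    using indep unfolding independent_variables_def by (intro indep_setD) auto
  moreover have "(X -` V \<inter> space P') \<inter> (F -` {a<..b} \<inter> space P') = {\<omega>\<in>space P'. X \<omega> \<in> V \<and> a < F \<omega> \<and> F \<omega> \<le> b}"
    "X -` V \<inter> space P' = {\<omega>\<in>space P'. X \<omega> \<in> V}" "F -` {a<..b} \<inter> space P' = {\<omega>\<in>space P'. a < F \<omega> \<and> F \<omega> \<le> b}"
    by auto
  ultimately show ?thesis using prob_X[OF V] prob_F[OF a] by simp
qed

text \<open>With \<open>h\<^sub>1 - h\<^sub>2\<close> the intensity of the strip of marks between \<open>a\<close> and \<open>s a\<close>, the factor \<open>h\<^sub>1 - h\<^sub>2\<close> dominates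
\<open>1 - exp (- (h\<^sub>1 - h\<^sub>2))\<close>. The remaining loss is \<open>exp (- (h\<^sub>0 - h\<^sub>2))\<close>, which is uniformly close to \<open>1\<close> for a
fine geometric subdivision. The right-hand side of the claim is the limiting probability that
exactly one mark exceeds \<open>a / s\<^sup>3\<close> and that it falls into the strip and its nucleus into \<open>V\<close>.\<close>

lemma box_limit_ge:
  assumes V: "V \<in> sets borel" "V \<subseteq> W" and a: "a > 0" and s: "s > 1"
    and e: "(a / s ^ 3) powr (- \<alpha>) - (s * a) powr (- \<alpha>) \<le> \<epsilon>"
  shows "exp (- \<epsilon>) * prob {\<omega>\<in>space P'. X \<omega> \<in> V \<and> a < F \<omega> \<and> F \<omega> \<le> s * a}
    \<le> measure lborel V * (a powr (- \<alpha>) - (s * a) powr (- \<alpha>)) * exp (- ((a / s ^ 3) powr (- \<alpha>)))"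
proof -
  define h0 h1 h2 where "h0 = (a / s ^ 3) powr (- \<alpha>)" and "h1 = a powr (- \<alpha>)" and "h2 = (s * a) powr (- \<alpha>)"
  have asa: "a < s * a" using a s by simp
  have "1 - exp (- (h1 - h2)) \<le> h1 - h2" using exp_ge_add_one_self[of "- (h1 - h2)"] by linarith
  then have "exp (- h2) * (1 - exp (- (h1 - h2))) \<le> exp (- h2) * (h1 - h2)" by (intro mult_left_mono) auto
  then have d: "exp (- h2) - exp (- h1) \<le> exp (- h2) * (h1 - h2)" by (simp add: algebra_simps exp_add[symmetric])
  have h12: "0 \<le> h1 - h2" using asa a \<alpha> by (simp add: h1_def h2_def powr_mono2')
  have "exp (- \<epsilon>) * (exp (- h2) - exp (- h1)) \<le> exp (- \<epsilon>) * (exp (- h2) * (h1 - h2))"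
    using d by (intro mult_left_mono) auto
  also have "\<dots> = exp (- \<epsilon> - h2) * (h1 - h2)" by (simp add: exp_diff exp_minus field_simps)
  also have "\<dots> \<le> exp (- h0) * (h1 - h2)"
    using h12 e by (intro mult_right_mono) (auto simp: h0_def h2_def)
  finally have "measure lborel V * (exp (- \<epsilon>) * (exp (- h2) - exp (- h1))) \<le> measure lborel V * (exp (- h0) * (h1 - h2))"
    by (intro mult_left_mono) auto
  then show ?thesis
    using asa a by (subst prob_cell[OF V]) (auto simp: h0_def h1_def h2_def mult_ac)
qed

lemma prob_range_lower:
  assumes "\<epsilon> > 0"
  obtains L where "L > 0" "prob {\<omega>\<in>space P'. exp (- L) < F \<omega> \<and> F \<omega> \<le> exp L} \<ge> 1 - \<epsilon>"
proof -
  have eq: "exp x powr (- \<alpha>) = exp (- \<alpha> * x)" for x by (simp add: powr_def mult.commute)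
  have l1: "((\<lambda>L. exp (- exp (- \<alpha> * L))) \<longlongrightarrow> exp (- 0)) at_top"
    using \<alpha> by (intro tendsto_exp tendsto_minus filterlim_compose[OF exp_at_bot]
        filterlim_tendsto_neg_mult_at_bot[OF tendsto_const _ filterlim_ident]) simp
  have l2: "((\<lambda>L. exp (- exp (\<alpha> * L))) \<longlongrightarrow> 0) at_top"
    using \<alpha> by (intro filterlim_compose[OF exp_at_bot] filterlim_compose[OF filterlim_uminus_at_bot_at_top]
        filterlim_compose[OF exp_at_top] filterlim_tendsto_pos_mult_at_top[OF tendsto_const _ filterlim_ident])
  have "((\<lambda>L. exp (- exp (- \<alpha> * L)) - exp (- exp (\<alpha> * L))) \<longlongrightarrow> exp (- 0) - 0) at_top"
    by (intro tendsto_diff l1 l2)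
  then have "eventually (\<lambda>L. exp (- exp (- \<alpha> * L)) - exp (- exp (\<alpha> * L)) > 1 - \<epsilon>) at_top"
    by (rule order_tendstoD(1)) (use assms in simp)
  then have "eventually (\<lambda>L. exp (- exp (- \<alpha> * L)) - exp (- exp (\<alpha> * L)) > 1 - \<epsilon> \<and> L > 0) at_top"
    using eventually_gt_at_top[of 0] by eventually_elim auto
  then obtain L where L: "exp (- exp (- \<alpha> * L)) - exp (- exp (\<alpha> * L)) > 1 - \<epsilon>" "L > 0"
    using eventually_happens by fastforce
  moreover have "prob {\<omega>\<in>space P'. exp (- L) < F \<omega> \<and> F \<omega> \<le> exp L} = exp (- exp (- \<alpha> * L)) - exp (- exp (\<alpha> * L))"
    using L(2) by (subst prob_F) (auto simp: eq)
  ultimately show ?thesis using that[of L] by simp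
qed

text \<open>Subdivide the interval from \<open>exp (- L)\<close> to \<open>exp L\<close> geometrically into \<open>n\<close> strips; all requirements hold
in the limit \<open>s \<rightarrow> 1\<close>.\<close>

lemma fine_ratio_exists:
  assumes "L > 0" "\<epsilon> > 0" "\<delta> > 0"
  obtains s n where "s > 1" "exp (- L) * s ^ n = exp L" "(s\<^sup>2 - 1 / s) * exp L < \<delta>"
    "\<And>a. exp (- L) \<le> a \<Longrightarrow> (a / s ^ 3) powr (- \<alpha>) - (s * a) powr (- \<alpha>) \<le> \<epsilon>"
proof -
  define s where "s n = exp (2 * L / real n)" for n
  have "(\<lambda>n. 2 * L / real n) \<longlonglongrightarrow> 0" by (rule lim_const_over_n)
  then have s1: "s \<longlonglongrightarrow> exp 0" unfolding s_def by (intro tendsto_exp)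
  have "(\<lambda>n. ((s n)\<^sup>2 - 1 / s n) * exp L) \<longlonglongrightarrow> ((exp 0)\<^sup>2 - 1 / exp 0) * exp L"
    by (intro tendsto_intros s1) auto
  then have e1: "eventually (\<lambda>n. ((s n)\<^sup>2 - 1 / s n) * exp L < \<delta>) sequentially"
    by (rule order_tendstoD(2)) (use assms(3) in simp)
  have "(\<lambda>n. exp (- L) powr (- \<alpha>) * ((1 / s n ^ 3) powr (- \<alpha>) - s n powr (- \<alpha>)))
      \<longlonglongrightarrow> exp (- L) powr (- \<alpha>) * ((1 / exp 0 ^ 3) powr (- \<alpha>) - exp 0 powr (- \<alpha>))"
    by (intro tendsto_intros s1) auto
  then have e2: "eventually (\<lambda>n. exp (- L) powr (- \<alpha>) * ((1 / s n ^ 3) powr (- \<alpha>) - s n powr (- \<alpha>)) < \<epsilon>) sequentially"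
    by (rule order_tendstoD(2)) (use assms(2) in simp)
  have "eventually (\<lambda>n. ((s n)\<^sup>2 - 1 / s n) * exp L < \<delta> \<and>
      exp (- L) powr (- \<alpha>) * ((1 / s n ^ 3) powr (- \<alpha>) - s n powr (- \<alpha>)) < \<epsilon> \<and> 0 < n) sequentially"
    using e1 e2 eventually_gt_at_top[of 0] by eventually_elim auto
  then obtain n where n: "((s n)\<^sup>2 - 1 / s n) * exp L < \<delta>"
    "exp (- L) powr (- \<alpha>) * ((1 / s n ^ 3) powr (- \<alpha>) - s n powr (- \<alpha>)) < \<epsilon>" "0 < n"
    using eventually_happens'[of sequentially] by auto
  have s: "s n > 1" using assms(1) n(3) by (simp add: s_def)
  show ?thesis
  proof (rule that[of "s n" n])
    show "exp (- L) * s n ^ n = exp L"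
      using n(3) by (simp add: s_def exp_of_nat_mult[symmetric] exp_add[symmetric])
    show "(a / s n ^ 3) powr (- \<alpha>) - (s n * a) powr (- \<alpha>) \<le> \<epsilon>" if a: "exp (- L) \<le> a" for a
    proof -
      have a0: "a > 0" using a by (rule less_le_trans[OF exp_gt_zero])
      have "1 / s n ^ 3 \<le> s n"
      proof -
        have "1 \<le> s n ^ 3" using s by (intro one_le_power) simp
        then have "1 / s n ^ 3 \<le> 1" using s by (simp add: divide_le_eq)
        then show ?thesis using s by linarith
      qed
      then have pos: "0 \<le> (1 / s n ^ 3) powr (- \<alpha>) - s n powr (- \<alpha>)" using s \<alpha> by (simp add: powr_mono2')
      have "(a / s n ^ 3) powr (- \<alpha>) - (s n * a) powr (- \<alpha>)
          = a powr (- \<alpha>) * ((1 / s n ^ 3) powr (- \<alpha>) - s n powr (- \<alpha>))"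
        using a0 s powr_mult[of a "1 / s n ^ 3" "- \<alpha>"] powr_mult[of "s n" a "- \<alpha>"] by (simp add: algebra_simps)
      also have "\<dots> \<le> exp (- L) powr (- \<alpha>) * ((1 / s n ^ 3) powr (- \<alpha>) - s n powr (- \<alpha>))"
        using a \<alpha> pos by (intro mult_right_mono powr_mono2') auto
      finally show ?thesis using n(2) by linarith
    qed
  qed (use n s in auto)
qed

text \<open>Up to probability \<open>\<epsilon>\<close> the limit lies in a compact part of the diagonal, which is cut into finitely
many cells on which \<open>f\<close> is almost constant. The boxes around the cells are disjoint and \<open>f\<close> is still
almost constant on each, so as \<open>f \<ge> 0\<close> the lower bounds for the probabilities of the boxes add up to
a lower bound for the expectation.\<close>

lemma expectation_lower:
  fixes f :: "'a \<times> real \<times> real \<Rightarrow> real" and Y :: "'i \<Rightarrow> 'w \<Rightarrow> 'a \<times> real \<times> real" and P :: "'w measure"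
  assumes P: "prob_space P"
    and Y: "eventually (\<lambda>i. Y i \<in> borel_measurable P) G"
    and boxes: "\<And>V a s l. V \<in> sets borel \<Longrightarrow> V \<subseteq> W \<Longrightarrow> a > 0 \<Longrightarrow> s > 1 \<Longrightarrow>
      l < measure lborel V * (a powr (- \<alpha>) - (s * a) powr (- \<alpha>)) * exp (- ((a / s ^ 3) powr (- \<alpha>))) \<Longrightarrow>
      eventually (\<lambda>i. l < measure P {\<omega>\<in>space P. Y i \<omega> \<in> box_near_diagonal V a s}) G"
    and f: "continuous_on UNIV f" "\<And>y. 0 \<le> f y" "\<And>y. f y \<le> C" and \<epsilon>: "\<epsilon> > 0"
  shows "eventually (\<lambda>i. (\<integral>\<omega>. f (X \<omega>, F \<omega>, F \<omega>) \<partial>P') - \<epsilon> * (2 + 3 * C) \<le> (\<integral>\<omega>. f (Y i \<omega>) \<partial>P)) G"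
proof -
  interpret P: prob_space P by (rule P)
  have f_borel [measurable]: "f \<in> borel_measurable borel" using f(1) by (rule borel_measurable_continuous_onI)
  have C: "C \<ge> 0" by (rule order_trans[OF f(2,3)])
  obtain L where L: "L > 0" "prob {\<omega>\<in>space P'. exp (- L) < F \<omega> \<and> F \<omega> \<le> exp L} \<ge> 1 - \<epsilon>"
    using prob_range_lower[OF \<epsilon>] .
  define T where "T = (\<lambda>(x, u). (x, u, u)) ` (W \<times> {exp (- L)..exp L})"
  have "compact T" unfolding T_def case_prod_beta'
    by (intro compact_continuous_image compact_Times compact compact_Icc continuous_intros)
  then obtain \<delta> where \<delta>: "\<delta> > 0" "\<And>p y. p \<in> T \<Longrightarrow> norm (y - p) < \<delta> \<Longrightarrow> \<bar>f y - f p\<bar> < \<epsilon>"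
    using uniform_continuity_near_compact[OF f(1) _ \<epsilon>] by blast
  have \<delta>3: "\<delta> / 3 > 0" using \<delta>(1) by simp
  obtain s n where s: "s > 1" and sn: "exp (- L) * s ^ n = exp L" and s\<delta>: "(s\<^sup>2 - 1 / s) * exp L < \<delta> / 3"
    and mesh: "\<And>a. exp (- L) \<le> a \<Longrightarrow> (a / s ^ 3) powr (- \<alpha>) - (s * a) powr (- \<alpha>) \<le> \<epsilon>"
    using that by (rule fine_ratio_exists[OF L(1) \<epsilon> \<delta>3])
  obtain V :: "nat \<Rightarrow> 'a set" and N :: nat where "(\<forall>j. V j \<in> sets borel \<and> V j \<subseteq> W) \<and> disjoint_family V
    \<and> W \<subseteq> (\<Union>j<N. V j) \<and> (\<forall>j. \<forall>x\<in>V j. \<forall>y\<in>V j. norm (x - y) < \<delta> / 3)"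
    using borel_partition_of_compact[OF compact \<delta>3] by (elim exE) (rule that)
  then have V: "\<And>j. V j \<in> sets borel" "\<And>j. V j \<subseteq> W" "disjoint_family V" "W \<subseteq> (\<Union>j<N. V j)"
    "\<And>j x y. x \<in> V j \<Longrightarrow> y \<in> V j \<Longrightarrow> norm (x - y) < \<delta> / 3" by blast+
  define a where "a i = exp (- L) * s ^ i" for i
  have a_ge: "exp (- L) \<le> a i" for i using s by (simp add: a_def one_le_power)
  then have a_pos: "a i > 0" for i by (rule less_le_trans[OF exp_gt_zero])
  have sa_le: "s * a i \<le> exp L" if "i < n" for i
  proof -
    have "s ^ Suc i \<le> s ^ n" using that s by (intro power_increasing) auto
    then have "exp (- L) * s ^ Suc i \<le> exp L" unfolding sn[symmetric] by (rule mult_left_mono) simp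
    then show ?thesis by (simp add: a_def mult_ac)
  qed
  define I where "I = {..<N} \<times> {..<n}"
  have I: "finite I" by (simp add: I_def)
  define B where "B k = box_near_diagonal (V (fst k)) (a (snd k)) s" for k
  have B_sets [measurable]: "B k \<in> sets borel" for k unfolding B_def by (rule box_near_diagonal_sets[OF V(1)])
  \<comment> \<open>The cells in position and mark; the box around a cell meets the diagonal in exactly that cell.\<close>
  define D where "D k = V (fst k) \<times> {a (snd k)<..s * a (snd k)}" for k
  have disjD: "disjoint_family_on D I"
  proof (unfold disjoint_family_on_def, intro ballI impI)
    fix k l :: "nat \<times> nat" assume "k \<noteq> l"
    then consider "fst k \<noteq> fst l" | "snd k \<noteq> snd l" by (metis prod.collapse)
    then show "D k \<inter> D l = {}"
    proof cases
      case 1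
      then have "V (fst k) \<inter> V (fst l) = {}" using V(3) by (auto simp: disjoint_family_on_def)
      then show ?thesis by (auto simp: D_def)
    next
      case 2
      then have "{a (snd k)<..s * a (snd k)} \<inter> {a (snd l)<..s * a (snd l)} = {}"
        unfolding a_def by (rule geometric_strips_disjoint[OF s exp_gt_zero])
      then show ?thesis unfolding D_def Times_Int_Times by simp
    qed
  qed
  have B_D: "(x, m, r) \<in> B k \<Longrightarrow> (x, m) \<in> D k" for x m r k
    by (simp add: B_def D_def box_near_diagonal_def)
  have disjB: "disjoint_family_on B I"
    using disjD B_D unfolding disjoint_family_on_def by fast
  have D_B: "(x, u, u) \<in> B k" if "(x, u) \<in> D k" for x u k
  proof -
    have "a (snd k) / s \<le> a (snd k) * 1" using s a_pos[of "snd k"] by (simp add: divide_le_eq)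
    moreover have "s * a (snd k) \<le> s * (s * a (snd k))" using s a_pos[of "snd k"] by simp
    ultimately show ?thesis using that by (auto simp: B_def D_def box_near_diagonal_def power2_eq_square mult.assoc)
  qed
  define c where "c k = f ((SOME x. x \<in> V (fst k)), s * a (snd k), s * a (snd k))" for k
  have near: "\<bar>f y - c k\<bar> < \<epsilon>" if k: "k \<in> I" and y: "y \<in> B k" for y k
  proof -
    obtain x m r where xmr: "y = (x, m, r)" using prod_cases3 by blast
    define z where "z = (SOME x. x \<in> V (fst k))"
    define b where "b = a (snd k)"
    have b: "b > 0" "exp (- L) \<le> b" "s * b \<le> exp L" using a_pos a_ge sa_le k by (auto simp: b_def I_def)
    have x: "x \<in> V (fst k)" and m: "b < m" "m \<le> s * b" and r: "b / s \<le> r" "r \<le> s\<^sup>2 * b"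
      using y by (auto simp: xmr B_def box_near_diagonal_def b_def)
    have z: "z \<in> V (fst k)" unfolding z_def using x by (rule someI)
    have bs: "b \<le> s * b" "b / s \<le> b" "s * b \<le> s\<^sup>2 * b"
      using s b by (auto simp: divide_le_eq power2_eq_square)
    have "b \<le> exp L" using b bs by linarith
    moreover have "1 / s \<le> s\<^sup>2" using s by (simp add: divide_le_eq power2_eq_square less_1_mult less_imp_le)
    ultimately have "(s\<^sup>2 - 1 / s) * b \<le> (s\<^sup>2 - 1 / s) * exp L" by (intro mult_left_mono) auto
    moreover have "s\<^sup>2 * b - b / s = (s\<^sup>2 - 1 / s) * b" by (simp add: left_diff_distrib)
    ultimately have small: "s\<^sup>2 * b - b / s < \<delta> / 3" using s\<delta> by linarith
    have "\<bar>m - s * b\<bar> < \<delta> / 3" "\<bar>r - s * b\<bar> < \<delta> / 3" using m r bs small by linarith+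
    moreover have "norm (x - z) < \<delta> / 3" using V(5)[OF x z] .
    ultimately have "norm (y - (z, s * b, s * b)) < \<delta>"
      using norm_triple_le[of "x - z" "m - s * b" "r - s * b"] by (simp add: xmr)
    moreover have "s * b \<ge> exp (- L)" using b bs by linarith
    then have "(z, s * b, s * b) \<in> T" using subsetD[OF V(2) z] b
      unfolding T_def by (intro image_eqI[of _ _ "(z, s * b)"]) auto
    ultimately show ?thesis using \<delta>(2) unfolding c_def z_def b_def by blast
  qed
  define p where "p k = max 0 (c k - \<epsilon>)" for k
  have p: "0 \<le> p k" "p k \<le> C" "c k + \<epsilon> \<le> p k + 2 * \<epsilon>" for k
    using f(3)[of "(SOME x. x \<in> V (fst k), s * a (snd k), s * a (snd k))"] C \<epsilon>
    by (auto simp: p_def c_def max_def)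
  define \<mu> where "\<mu> k = prob {\<omega>\<in>space P'. X \<omega> \<in> V (fst k) \<and> a (snd k) < F \<omega> \<and> F \<omega> \<le> s * a (snd k)}" for k
  have \<mu>_eq: "\<mu> k = prob {\<omega>\<in>space P'. (X \<omega>, F \<omega>) \<in> D k}" for k unfolding \<mu>_def D_def by simp
  have ev_D: "{\<omega>\<in>space P'. (X \<omega>, F \<omega>) \<in> D k} \<in> sets P'" for k
    unfolding D_def using V(1)[of "fst k"] by simp
  have \<mu>_sum: "(\<Sum>k\<in>I. \<mu> k) \<le> 1"
  proof -
    have "(\<Sum>k\<in>I. \<mu> k) = prob (\<Union>k\<in>I. {\<omega>\<in>space P'. (X \<omega>, F \<omega>) \<in> D k})"
      unfolding \<mu>_eq using I ev_D
    proof (intro finite_measure_finite_Union[symmetric])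
      show "disjoint_family_on (\<lambda>k. {\<omega>\<in>space P'. (X \<omega>, F \<omega>) \<in> D k}) I"
        using disjD unfolding disjoint_family_on_def by blast
    qed auto
    then show ?thesis by simp
  qed
  have int_ind: "integrable P' (\<lambda>\<omega>. indicator {\<omega>\<in>space P'. (X \<omega>, F \<omega>) \<in> D k} \<omega> :: real)" for k
    using ev_D by (intro integrable_real_indicator) (auto simp: emeasure_eq_measure)
  define Z where "Z = {\<omega>\<in>space P'. \<not> (X \<omega> \<in> W \<and> exp (- L) < F \<omega> \<and> F \<omega> \<le> exp L)}"
  have W: "W \<in> sets borel" using compact by (simp add: borel_compact)
  have Z_sets: "Z \<in> sets P'" unfolding Z_def using W by measurable
  have Z: "prob Z \<le> \<epsilon>"
  proof -
    have inW: "prob {\<omega>\<in>space P'. X \<omega> \<in> W} = 1" using prob_X[OF W] volume by (simp add: measure_def)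
    have "Z \<subseteq> {\<omega>\<in>space P'. X \<omega> \<notin> W} \<union> {\<omega>\<in>space P'. \<not> (exp (- L) < F \<omega> \<and> F \<omega> \<le> exp L)}" by (auto simp: Z_def)
    then have "prob Z \<le> prob ({\<omega>\<in>space P'. X \<omega> \<notin> W} \<union> {\<omega>\<in>space P'. \<not> (exp (- L) < F \<omega> \<and> F \<omega> \<le> exp L)})"
      using W by (intro finite_measure_mono) auto
    also have "\<dots> \<le> prob {\<omega>\<in>space P'. X \<omega> \<notin> W} + prob {\<omega>\<in>space P'. \<not> (exp (- L) < F \<omega> \<and> F \<omega> \<le> exp L)}"
      using W by (intro measure_Un_le) auto
    also have "\<dots> = (1 - 1) + (1 - prob {\<omega>\<in>space P'. exp (- L) < F \<omega> \<and> F \<omega> \<le> exp L})"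
      using W inW by (subst (1 2) prob_neg) auto
    also have "\<dots> \<le> \<epsilon>" using L(2) by simp
    finally show ?thesis .
  qed
  have "(\<integral>\<omega>. f (X \<omega>, F \<omega>, F \<omega>) \<partial>P') \<le> (\<integral>\<omega>. (\<Sum>k\<in>I. (c k + \<epsilon>) * indicator {\<omega>\<in>space P'. (X \<omega>, F \<omega>) \<in> D k} \<omega>) + C * indicator Z \<omega> \<partial>P')"
  proof (rule integral_mono_AE)
    have "(\<lambda>\<omega>. (X \<omega>, F \<omega>, F \<omega>)) \<in> borel_measurable P'" by measurable
    from measurable_compose[OF this f_borel]
    show "integrable P' (\<lambda>\<omega>. f (X \<omega>, F \<omega>, F \<omega>))"
      using f(2,3) by (intro integrable_const_bound[of _ C]) auto
    show "integrable P' (\<lambda>\<omega>. (\<Sum>k\<in>I. (c k + \<epsilon>) * indicator {\<omega>\<in>space P'. (X \<omega>, F \<omega>) \<in> D k} \<omega>) + C * indicator Z \<omega>)"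
      using ev_D Z_sets by (intro Bochner_Integration.integrable_add Bochner_Integration.integrable_sum
          integrable_mult_right integrable_real_indicator) (auto simp: emeasure_eq_measure)
    show "AE \<omega> in P'. f (X \<omega>, F \<omega>, F \<omega>)
        \<le> (\<Sum>k\<in>I. (c k + \<epsilon>) * indicator {\<omega>\<in>space P'. (X \<omega>, F \<omega>) \<in> D k} \<omega>) + C * indicator Z \<omega>"
    proof (rule AE_I2)
      fix \<omega> assume \<omega>: "\<omega> \<in> space P'"
      have ind: "indicator {\<omega>\<in>space P'. (X \<omega>, F \<omega>) \<in> D k} \<omega> = (indicator (D k) (X \<omega>, F \<omega>) :: real)" for k
        using \<omega> by (simp add: indicator_def)
      have c0: "0 \<le> c k + \<epsilon>" for k using f(2) \<epsilon> by (simp add: c_def)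
      show "f (X \<omega>, F \<omega>, F \<omega>)
        \<le> (\<Sum>k\<in>I. (c k + \<epsilon>) * indicator {\<omega>\<in>space P'. (X \<omega>, F \<omega>) \<in> D k} \<omega>) + C * indicator Z \<omega>"
      proof (cases "\<omega> \<in> Z")
        case True
        have "0 \<le> (\<Sum>k\<in>I. (c k + \<epsilon>) * indicator {\<omega>\<in>space P'. (X \<omega>, F \<omega>) \<in> D k} \<omega>)"
          using c0 by (intro sum_nonneg mult_nonneg_nonneg) auto
        moreover have "C * indicator Z \<omega> = C" using True by simp
        ultimately show ?thesis using f(3)[of "(X \<omega>, F \<omega>, F \<omega>)"] by linarith
      next
        case False
        then have XF: "X \<omega> \<in> W" "exp (- L) < F \<omega>" "F \<omega> \<le> exp (- L) * s ^ n" using \<omega> by (auto simp: Z_def sn)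
        obtain j where j: "j < N" "X \<omega> \<in> V j" using V(4) XF(1) by blast
        obtain i where i: "i < n" "a i < F \<omega>" "F \<omega> \<le> s * a i"
          using geometric_strip_exists[OF s exp_gt_zero XF(2,3)] unfolding a_def by blast
        have k: "(j, i) \<in> I" "(X \<omega>, F \<omega>) \<in> D (j, i)" using i j by (auto simp: I_def D_def)
        have "f (X \<omega>, F \<omega>, F \<omega>) \<le> c (j, i) + \<epsilon>" using near[OF k(1) D_B[OF k(2)]] by linarith
        also have "\<dots> = (\<Sum>k\<in>I. (c k + \<epsilon>) * indicator (D k) (X \<omega>, F \<omega>))"
          by (rule sum_indicator_disjoint[OF I disjD k, symmetric])
        finally show ?thesis using False by (simp only: ind) simp
      qed
    qed
  qed
  also have "\<dots> = (\<Sum>k\<in>I. (c k + \<epsilon>) * \<mu> k) + C * prob Z"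
    using int_ind Z_sets ev_D unfolding \<mu>_eq
    by (subst Bochner_Integration.integral_add)
      (auto intro!: Bochner_Integration.integrable_sum integrable_mult_right integrable_real_indicator sum.cong
        simp: Bochner_Integration.integral_sum emeasure_eq_measure simp del: sum_mult_indicator)
  also have "\<dots> \<le> (\<Sum>k\<in>I. (p k + 2 * \<epsilon>) * \<mu> k) + C * \<epsilon>"
  proof (intro add_mono sum_mono)
    show "(c k + \<epsilon>) * \<mu> k \<le> (p k + 2 * \<epsilon>) * \<mu> k" for k
      by (rule mult_right_mono[OF p(3)]) (simp add: \<mu>_def)
    show "C * prob Z \<le> C * \<epsilon>" using C Z by (intro mult_left_mono)
  qed
  also have "\<dots> = (\<Sum>k\<in>I. p k * \<mu> k) + 2 * \<epsilon> * (\<Sum>k\<in>I. \<mu> k) + C * \<epsilon>"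
    by (simp add: distrib_right sum.distrib sum_distrib_left)
  also have "\<dots> \<le> (\<Sum>k\<in>I. p k * \<mu> k) + 2 * \<epsilon> * 1 + C * \<epsilon>"
    using \<mu>_sum \<epsilon> by (intro add_right_mono add_left_mono mult_left_mono) auto
  finally have upper: "(\<integral>\<omega>. f (X \<omega>, F \<omega>, F \<omega>) \<partial>P') \<le> (\<Sum>k\<in>I. p k * \<mu> k) + 2 * \<epsilon> + C * \<epsilon>" by simp
  \<comment> \<open>The errors on the finitely many boxes sum to at most \<open>\<epsilon>\<close>.\<close>
  define e where "e = \<epsilon> / (real (card I) + 1)"
  have e: "e > 0" using \<epsilon> by (simp add: e_def)
  have "eventually (\<lambda>i. \<forall>k\<in>I. exp (- \<epsilon>) * \<mu> k - e < measure P {\<omega>\<in>space P. Y i \<omega> \<in> B k}) G"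
  proof (intro eventually_ball_finite I ballI)
    fix k
    show "eventually (\<lambda>i. exp (- \<epsilon>) * \<mu> k - e < measure P {\<omega>\<in>space P. Y i \<omega> \<in> B k}) G"
      unfolding B_def
    proof (rule boxes[OF V(1,2) a_pos s])
      show "exp (- \<epsilon>) * \<mu> k - e < measure lborel (V (fst k)) *
          (a (snd k) powr (- \<alpha>) - (s * a (snd k)) powr (- \<alpha>)) * exp (- ((a (snd k) / s ^ 3) powr (- \<alpha>)))"
        using box_limit_ge[OF V(1,2) a_pos s mesh[OF a_ge], of "fst k" "snd k"] e unfolding \<mu>_def by linarith
    qed
  qed
  then show ?thesis using Y
  proof eventually_elim
    case (elim i)
    note [measurable] = elim(2)
    have ev_B: "{\<omega>\<in>space P. Y i \<omega> \<in> B k} \<in> sets P" for k by measurable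
    have int_B: "integrable P (\<lambda>\<omega>. indicator {\<omega>\<in>space P. Y i \<omega> \<in> B k} \<omega> :: real)" for k
      using ev_B by (intro integrable_real_indicator) (auto simp: P.emeasure_eq_measure)
    have "(\<Sum>k\<in>I. p k * \<mu> k) - C * \<epsilon> - C * \<epsilon> \<le> (\<Sum>k\<in>I. p k * (exp (- \<epsilon>) * \<mu> k - e))"
    proof -
      have "(\<Sum>k\<in>I. p k * \<mu> k) * (1 - \<epsilon>) \<le> (\<Sum>k\<in>I. p k * \<mu> k) * exp (- \<epsilon>)"
        using exp_ge_add_one_self[of "- \<epsilon>"] p by (intro mult_left_mono sum_nonneg mult_nonneg_nonneg) (auto simp: \<mu>_def)
      moreover have "(\<Sum>k\<in>I. p k * \<mu> k) * \<epsilon> \<le> C * \<epsilon>"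
      proof (intro mult_right_mono)
        have "(\<Sum>k\<in>I. p k * \<mu> k) \<le> (\<Sum>k\<in>I. C * \<mu> k)"
          using p by (intro sum_mono mult_right_mono) (auto simp: \<mu>_def)
        also have "\<dots> \<le> C * 1" using \<mu>_sum C unfolding sum_distrib_left[symmetric] by (intro mult_left_mono) auto
        finally show "(\<Sum>k\<in>I. p k * \<mu> k) \<le> C" by simp
      qed (use \<epsilon> in auto)
      moreover have "(\<Sum>k\<in>I. p k) * e \<le> C * \<epsilon>"
      proof -
        have "(\<Sum>k\<in>I. p k) * e \<le> (real (card I) * C) * e"
          using sum_bounded_above[of I p C] p e by (intro mult_right_mono) auto
        also have "\<dots> = C * (real (card I) * e)" by simp
        also have "\<dots> \<le> C * \<epsilon>" using C \<epsilon> by (intro mult_left_mono) (auto simp: e_def field_simps)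
        finally show ?thesis .
      qed
      moreover have "(\<Sum>k\<in>I. p k * (exp (- \<epsilon>) * \<mu> k - e)) = (\<Sum>k\<in>I. p k * \<mu> k) * exp (- \<epsilon>) - (\<Sum>k\<in>I. p k) * e"
        by (simp add: right_diff_distrib sum_subtractf sum_distrib_right sum_distrib_left mult_ac)
      ultimately show ?thesis by (simp add: algebra_simps)
    qed
    also have "\<dots> \<le> (\<Sum>k\<in>I. p k * measure P {\<omega>\<in>space P. Y i \<omega> \<in> B k})"
      using p(1) elim(1) by (intro sum_mono mult_left_mono) (auto intro: less_imp_le)
    also have "\<dots> = (\<integral>\<omega>. (\<Sum>k\<in>I. p k * indicator {\<omega>\<in>space P. Y i \<omega> \<in> B k} \<omega>) \<partial>P)"
      using int_B ev_B by (subst Bochner_Integration.integral_sum)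
        (auto intro!: integrable_mult_right sum.cong)
    also have "\<dots> \<le> (\<integral>\<omega>. f (Y i \<omega>) \<partial>P)"
    proof (rule integral_mono_AE)
      show "integrable P (\<lambda>\<omega>. \<Sum>k\<in>I. p k * indicator {\<omega>\<in>space P. Y i \<omega> \<in> B k} \<omega>)"
        using int_B by (intro Bochner_Integration.integrable_sum integrable_mult_right) auto
      show "integrable P (\<lambda>\<omega>. f (Y i \<omega>))"
        using f(2,3) by (intro P.integrable_const_bound[of _ C]) auto
      show "AE \<omega> in P. (\<Sum>k\<in>I. p k * indicator {\<omega>\<in>space P. Y i \<omega> \<in> B k} \<omega>) \<le> f (Y i \<omega>)"
      proof (rule AE_I2)
        fix \<omega> assume \<omega>: "\<omega> \<in> space P"
        have ind: "indicator {\<omega>\<in>space P. Y i \<omega> \<in> B k} \<omega> = (indicator (B k) (Y i \<omega>) :: real)" for k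
          using \<omega> by (simp add: indicator_def)
        show "(\<Sum>k\<in>I. p k * indicator {\<omega>\<in>space P. Y i \<omega> \<in> B k} \<omega>) \<le> f (Y i \<omega>)"
        proof (cases "\<exists>k\<in>I. Y i \<omega> \<in> B k")
          case True
          then obtain k where k: "k \<in> I" "Y i \<omega> \<in> B k" by blast
          have "(\<Sum>k\<in>I. p k * indicator (B k) (Y i \<omega>)) = p k" by (rule sum_indicator_disjoint[OF I disjB k])
          also have "\<dots> \<le> f (Y i \<omega>)" using near[OF k] f(2)[of "Y i \<omega>"] by (simp add: p_def)
          finally show ?thesis by (simp only: ind)
        next
          case False
          then have "(\<Sum>k\<in>I. p k * indicator (B k) (Y i \<omega>)) = 0" by (intro sum.neutral) auto
          then show ?thesis using f(2)[of "Y i \<omega>"] by (simp only: ind)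
        qed
      qed
    qed
    finally show ?case using upper by (simp add: algebra_simps)
  qed
qed

text \<open>Lower bounds for expectations of nonnegative functions are enough: adding a constant to \<open>f\<close> and to
\<open>- f\<close> makes both nonnegative, and the lower bound for the second is an upper bound for \<open>f\<close>.\<close>

lemma converges_of_box_bounds:
  fixes Y :: "'i \<Rightarrow> 'w \<Rightarrow> 'a \<times> real \<times> real" and P :: "'w measure"
  assumes P: "prob_space P"
    and Y: "eventually (\<lambda>i. Y i \<in> borel_measurable P) G"
    and boxes: "\<And>V a s l. V \<in> sets borel \<Longrightarrow> V \<subseteq> W \<Longrightarrow> a > 0 \<Longrightarrow> s > 1 \<Longrightarrow>
      l < measure lborel V * (a powr (- \<alpha>) - (s * a) powr (- \<alpha>)) * exp (- ((a / s ^ 3) powr (- \<alpha>))) \<Longrightarrow>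
      eventually (\<lambda>i. l < measure P {\<omega>\<in>space P. Y i \<omega> \<in> box_near_diagonal V a s}) G"
  shows "converges_in_distribution P Y (distr P' borel (\<lambda>\<omega>. (X \<omega>, F \<omega>, F \<omega>))) G"
  unfolding converges_in_distribution_def
proof (intro conjI allI impI Y)
  interpret P: prob_space P by (rule P)
  fix f :: "'a \<times> real \<times> real \<Rightarrow> real" assume f: "continuous_on UNIV f \<and> bounded (range f)"
  then obtain K where K: "\<And>y. \<bar>f y\<bar> \<le> K" by (auto simp: bounded_iff)
  have K0: "K \<ge> 0" using K[of undefined] by linarith
  have f_borel [measurable]: "f \<in> borel_measurable borel" using f by (intro borel_measurable_continuous_onI) auto
  have XF [measurable]: "(\<lambda>\<omega>. (X \<omega>, F \<omega>, F \<omega>)) \<in> borel_measurable P'" by measurable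
  have eq: "(\<integral>y. f y \<partial>distr P' borel (\<lambda>\<omega>. (X \<omega>, F \<omega>, F \<omega>))) = (\<integral>\<omega>. f (X \<omega>, F \<omega>, F \<omega>) \<partial>P')"
    by (rule integral_distr) auto
  have intX: "integrable P' (\<lambda>\<omega>. f (X \<omega>, F \<omega>, F \<omega>))"
    using measurable_compose[OF XF f_borel] K by (intro integrable_const_bound[of _ K]) auto
  show "((\<lambda>i. \<integral>\<omega>. f (Y i \<omega>) \<partial>P) \<longlongrightarrow> (\<integral>y. f y \<partial>distr P' borel (\<lambda>\<omega>. (X \<omega>, F \<omega>, F \<omega>)))) G"
    unfolding eq tendsto_iff dist_real_def
  proof (intro allI impI)
    fix e :: real assume e: "e > 0"
    \<comment> \<open>\<open>K + f\<close> and \<open>K - f\<close> take values between \<open>0\<close> and \<open>2 K\<close>.\<close>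
    define \<epsilon> where "\<epsilon> = e / (2 * (2 + 3 * (2 * K)))"
    have \<epsilon>: "\<epsilon> > 0" "\<epsilon> * (2 + 3 * (2 * K)) < e" using e K0 by (auto simp: \<epsilon>_def field_simps add_pos_nonneg)
    have "eventually (\<lambda>i. (\<integral>\<omega>. K + f (X \<omega>, F \<omega>, F \<omega>) \<partial>P') - \<epsilon> * (2 + 3 * (2 * K)) \<le> (\<integral>\<omega>. K + f (Y i \<omega>) \<partial>P)) G"
    proof (rule expectation_lower[OF P Y boxes, of "\<lambda>y. K + f y" "2 * K"])
      show "continuous_on UNIV (\<lambda>y. K + f y)" using f by (intro continuous_intros) auto
      show "0 \<le> K + f y" "K + f y \<le> 2 * K" for y using K[of y] by linarith+
    qed (use \<epsilon> in auto)
    moreover have "eventually (\<lambda>i. (\<integral>\<omega>. K - f (X \<omega>, F \<omega>, F \<omega>) \<partial>P') - \<epsilon> * (2 + 3 * (2 * K)) \<le> (\<integral>\<omega>. K - f (Y i \<omega>) \<partial>P)) G"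
    proof (rule expectation_lower[OF P Y boxes, of "\<lambda>y. K - f y" "2 * K"])
      show "continuous_on UNIV (\<lambda>y. K - f y)" using f by (intro continuous_intros) auto
      show "0 \<le> K - f y" "K - f y \<le> 2 * K" for y using K[of y] by linarith+
    qed (use \<epsilon> in auto)
    ultimately show "eventually (\<lambda>i. \<bar>(\<integral>\<omega>. f (Y i \<omega>) \<partial>P) - (\<integral>\<omega>. f (X \<omega>, F \<omega>, F \<omega>) \<partial>P')\<bar> < e) G" using Y
    proof eventually_elim
      case (elim i)
      have intY: "integrable P (\<lambda>\<omega>. f (Y i \<omega>))"
        using measurable_compose[OF elim(3) f_borel] K by (intro P.integrable_const_bound[of _ K]) auto
      show ?case using elim(1,2) \<epsilon>(2) intX intY prob_space P.prob_space by simp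
    qed
  qed
qed

end

section \<open>The rescaled maximum in a small box\<close>

lemma scaled_set_sets:
  fixes V :: "'a::euclidean_space set"
  assumes "V \<in> sets borel" "c > 0"
  shows "(\<lambda>x. c *\<^sub>R x) ` V \<in> sets borel"
proof -
  have "(\<lambda>x. c *\<^sub>R x) ` V = (\<lambda>x. (1 / c) *\<^sub>R x) -` V"
  proof safe
    fix x assume "(1 / c) *\<^sub>R x \<in> V"
    moreover have "x = c *\<^sub>R ((1 / c) *\<^sub>R x)" using assms(2) by simp
    ultimately show "x \<in> (\<lambda>x. c *\<^sub>R x) ` V" by blast
  qed (use assms(2) in simp)
  moreover have "(\<lambda>x :: 'a. (1 / c) *\<^sub>R x) \<in> borel_measurable borel"
    by (intro borel_measurable_continuous_onI continuous_intros)
  ultimately show ?thesis using measurable_sets_borel[OF _ assms(1)] by metis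
qed

lemma emeasure_scaled_set:
  fixes V :: "'a::euclidean_space set"
  assumes "V \<in> sets borel" "c > 0"
  shows "emeasure lborel ((\<lambda>x. c *\<^sub>R x) ` V) = ennreal (c ^ DIM('a)) * emeasure lborel V"
proof -
  have "(\<lambda>x. 0 + c *\<^sub>R x) -` ((\<lambda>x. c *\<^sub>R x) ` V) = V"
    using assms(2) by auto
  then show ?thesis
    using scaled_set_sets[OF assms] assms(2)
    by (subst lborel_affine[of c 0]) (simp_all add: emeasure_density nn_integral_cmult emeasure_distr)
qed

context poisson_laguerre
begin

lemma scale_ge: "eventually (\<lambda>\<rho>. v \<rho> \<ge> z) at_top"
  using scale_at_top by (simp add: filterlim_at_top)

text \<open>There are at most of order \<open>\<rho>\<^sup>d\<close> cubes, each being empty with probability at most \<open>exp (- c v)\<close>.\<close>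

lemma no_hole_asymp:
  assumes \<kappa>: "0 < \<kappa>" "\<kappa> \<le> R"
  shows "((\<lambda>\<rho>. P.prob {\<omega>\<in>space P. \<not> no_hole (\<kappa> * v \<rho>) (R * \<rho> / (\<kappa> * v \<rho>)) \<omega>}) \<longlongrightarrow> 0) at_top"
proof -
  define c where "c = \<gamma> * \<kappa> ^ DIM('a)"
  have "c > 0" using gamma_pos \<kappa> by (simp add: c_def)
  then have lim: "((\<lambda>\<rho>. (5 * R / \<kappa>) ^ DIM('a) * (\<rho> ^ DIM('a) * exp (- c * v \<rho>))) \<longlongrightarrow> 0) at_top"
    using tendsto_mult[OF tendsto_const index_power_exp_scale] by fastforce
  have le: "eventually (\<lambda>\<rho>. P.prob {\<omega>\<in>space P. \<not> no_hole (\<kappa> * v \<rho>) (R * \<rho> / (\<kappa> * v \<rho>)) \<omega>}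
      \<le> (5 * R / \<kappa>) ^ DIM('a) * (\<rho> ^ DIM('a) * exp (- c * v \<rho>))) at_top"
    using scale_ge[of 1] scale_le_index eventually_ge_at_top[of 1]
  proof eventually_elim
    case (elim \<rho>)
    have k: "R * \<rho> / (\<kappa> * v \<rho>) \<ge> 1"
    proof -
      have "\<kappa> * v \<rho> \<le> R * \<rho>" using \<kappa> elim by (intro mult_mono) auto
      moreover have "0 < \<kappa> * v \<rho>" using \<kappa> elim by simp
      ultimately show ?thesis by simp
    qed
    have "P.prob {\<omega>\<in>space P. \<not> no_hole (\<kappa> * v \<rho>) (R * \<rho> / (\<kappa> * v \<rho>)) \<omega>}
        \<le> (5 * (R * \<rho> / (\<kappa> * v \<rho>))) ^ DIM('a) * exp (- \<gamma> * (\<kappa> * v \<rho>) ^ DIM('a))"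
      using \<kappa> elim k by (intro prob_hole_le) auto
    also have "\<dots> \<le> (5 * (R * \<rho> / \<kappa>)) ^ DIM('a) * exp (- c * v \<rho>)"
    proof (rule mult_mono)
      have "R * \<rho> / (\<kappa> * v \<rho>) \<le> R * \<rho> / \<kappa>"
        using \<kappa> elim by (intro divide_left_mono) auto
      then show "(5 * (R * \<rho> / (\<kappa> * v \<rho>))) ^ DIM('a) \<le> (5 * (R * \<rho> / \<kappa>)) ^ DIM('a)"
        using k by (intro power_mono) auto
      have "v \<rho> ^ 1 \<le> v \<rho> ^ DIM('a)" using elim by (intro power_increasing) auto
      then have "c * v \<rho> \<le> c * v \<rho> ^ DIM('a)" using \<open>c > 0\<close> by simp
      then show "exp (- \<gamma> * (\<kappa> * v \<rho>) ^ DIM('a)) \<le> exp (- c * v \<rho>)"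
        by (simp add: c_def power_mult_distrib mult.assoc)
    qed (use \<kappa> elim k in auto)
    also have "\<dots> = (5 * R / \<kappa>) ^ DIM('a) * (\<rho> ^ DIM('a) * exp (- c * v \<rho>))"
      by (simp add: power_mult_distrib power_divide mult_ac)
    finally show ?case .
  qed
  show ?thesis by (rule tendsto_sandwich[OF _ le tendsto_const lim]) simp
qed

text \<open>The expected number of marks above \<open>e v\<close> stays bounded while the truncated moment vanishes. Here
the finiteness of the \<open>d\<close>-th moment, that is \<open>\<alpha> > d\<close>, enters.\<close>

lemma no_interference_asymp:
  fixes e D R :: real
  assumes "e > 0" "D \<ge> DIM('a)" "R \<ge> 1"
  shows "((\<lambda>\<rho>. P.prob {\<omega>\<in>space P. \<not> no_interference (v \<rho>) (R * \<rho> / v \<rho>) (e * v \<rho>) (D * v \<rho>) \<omega>}) \<longlongrightarrow> 0) at_top"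
proof -
  define J where "J \<rho> = enn2real (\<integral>\<^sup>+ t. ennreal (t ^ DIM('a)) * indicator {e * v \<rho><..} t \<partial>Q)" for \<rho>
  define K where "K = \<gamma> * unit_ball_vol DIM('a) * (1 + D / e) ^ DIM('a)"
  define b where "b \<rho> = 2 * (5 * R) ^ DIM('a) * (\<gamma> * \<rho> ^ DIM('a) * tail (e * v \<rho>)) * (K * J \<rho>)" for \<rho>
  have "(b \<longlongrightarrow> 2 * (5 * R) ^ DIM('a) * e powr (- \<alpha>) * (K * 0)) at_top"
    unfolding b_def J_def using assms(1)
    by (intro tendsto_mult tendsto_const tail_scale moment_tail_tendsto)
  then have lim: "(b \<longlongrightarrow> 0) at_top" by simp
  have le: "eventually (\<lambda>\<rho>. P.prob {\<omega>\<in>space P. \<not> no_interference (v \<rho>) (R * \<rho> / v \<rho>) (e * v \<rho>) (D * v \<rho>) \<omega>} \<le> b \<rho>) at_top"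
    using scale_ge[of 1] scale_le_index eventually_ge_at_top[of 1]
  proof eventually_elim
    case (elim \<rho>)
    have "1 * v \<rho> \<le> R * \<rho>" using assms elim by (intro mult_mono) auto
    then have k: "R * \<rho> / v \<rho> \<ge> 1" using elim by simp
    have "P.prob {\<omega>\<in>space P. \<not> no_interference (v \<rho>) (R * \<rho> / v \<rho>) (e * v \<rho>) (D * v \<rho>) \<omega>}
      \<le> 2 * (5 * (R * \<rho> / v \<rho>) * v \<rho>) ^ DIM('a) * (\<gamma> * tail (e * v \<rho>))
          * (\<gamma> * unit_ball_vol DIM('a) * (1 + (D * v \<rho>) / (e * v \<rho>)) ^ DIM('a) * J \<rho>)"
      unfolding J_def using assms elim k by (intro prob_interference_le) auto
    also have "\<dots> = b \<rho>"
      using elim by (simp add: b_def K_def power_mult_distrib mult_ac)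
    finally show ?case .
  qed
  show ?thesis by (rule tendsto_sandwich[OF _ le tendsto_const lim]) simp
qed

definition rescaled_max :: "real \<Rightarrow> 'w \<Rightarrow> 'a \<times> real \<times> real" where
  "rescaled_max \<rho> \<omega> = (case max_triple ((\<lambda>x. \<rho> *\<^sub>R x) ` W) (points (\<eta> \<omega>)) of (x, m, r) \<Rightarrow>
     ((1 / \<rho>) *\<^sub>R x, m / v \<rho>, r / v \<rho>))"

lemma W_sets: "W \<in> sets borel"
  using compact_W by (simp add: borel_compact)

lemma rescaled_max_measurable:
  assumes "\<rho> > 0"
  shows "rescaled_max \<rho> \<in> borel_measurable P"
proof -
  note [measurable] = max_triple_measurable[OF scaled_set_sets[OF W_sets assms]]
  have [measurable]: "fst \<in> borel_measurable (borel :: ('a \<times> real \<times> real) measure)"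
    "snd \<in> borel_measurable (borel :: ('a \<times> real \<times> real) measure)"
    "fst \<in> borel_measurable (borel :: (real \<times> real) measure)"
    "snd \<in> borel_measurable (borel :: (real \<times> real) measure)"
    by (auto intro!: borel_measurable_continuous_onI continuous_on_fst continuous_on_snd continuous_on_id)
  show ?thesis unfolding rescaled_max_def[abs_def] case_prod_beta' by measurable
qed

text \<open>Exact by independence of the counts in disjoint sets; the limit is the normalization of the scale.\<close>

lemma prob_single_exceedance:
  assumes V: "V \<in> sets borel" "V \<subseteq> W" and a: "0 < b" "b < a" "a < c"
  shows "((\<lambda>\<rho>. P.prob {\<omega>\<in>space P.
      cnt ((\<lambda>x. \<rho> *\<^sub>R x) ` V \<times> {a * v \<rho><..c * v \<rho>}) \<omega> = 1 \<and>
      cnt ((\<lambda>x. \<rho> *\<^sub>R x) ` W \<times> {b * v \<rho><..} - (\<lambda>x. \<rho> *\<^sub>R x) ` V \<times> {a * v \<rho><..c * v \<rho>}) \<omega> = 0})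
    \<longlongrightarrow> measure lborel V * (a powr (- \<alpha>) - c powr (- \<alpha>)) * exp (- (b powr (- \<alpha>)))) at_top"
    (is "(?p \<longlongrightarrow> ?l) at_top")
proof -
  have finV: "emeasure lborel V < \<infinity>"
    using emeasure_mono[OF V(2), of lborel] W_sets volume_W by (simp add: le_less_trans)
  define F where "F \<rho> = (measure lborel V * (\<gamma> * \<rho> ^ DIM('a) * tail (a * v \<rho>) - \<gamma> * \<rho> ^ DIM('a) * tail (c * v \<rho>)))
      * exp (- (\<gamma> * \<rho> ^ DIM('a) * tail (b * v \<rho>)))" for \<rho>
  have "(F \<longlongrightarrow> ?l) at_top"
    unfolding F_def using a by (intro tendsto_intros tail_scale) auto
  moreover have "eventually (\<lambda>\<rho>. F \<rho> = ?p \<rho>) at_top"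
    using scale_ge[of 1] eventually_ge_at_top[of 1]
  proof eventually_elim
    case (elim \<rho>)
    define A where "A = (\<lambda>x. \<rho> *\<^sub>R x) ` V \<times> {a * v \<rho><..c * v \<rho>}"
    define B where "B = (\<lambda>x. \<rho> *\<^sub>R x) ` W \<times> {b * v \<rho><..}"
    have abc: "b * v \<rho> < a * v \<rho>" "a * v \<rho> < c * v \<rho>" "0 < b * v \<rho>" using a elim by auto
    have mark: "{a * v \<rho><..c * v \<rho>} = {a * v \<rho><..} - {c * v \<rho><..}" by auto
    have rays: "{a * v \<rho><..} \<in> sets Q" "{b * v \<rho><..} \<in> sets Q" "{c * v \<rho><..} \<in> sets Q"
      using abc by (auto intro!: ray_sets)
    have scaled: "(\<lambda>x. \<rho> *\<^sub>R x) ` V \<in> sets borel" "(\<lambda>x. \<rho> *\<^sub>R x) ` W \<in> sets borel"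
      using elim V W_sets by (auto intro!: scaled_set_sets)
    have A [measurable]: "A \<in> sets \<Lambda>" and B [measurable]: "B \<in> sets \<Lambda>"
      unfolding A_def B_def mark using rays scaled by (auto intro!: times_sets)
    have AB: "A \<union> (B - A) = B" using V(2) abc unfolding A_def B_def by auto
    have "measure Q {a * v \<rho><..c * v \<rho>} = tail (a * v \<rho>) - tail (c * v \<rho>)"
      unfolding mark tail_def using rays abc by (intro finite_measure_Diff) auto
    then have "emeasure Q {a * v \<rho><..c * v \<rho>} = ennreal (tail (a * v \<rho>) - tail (c * v \<rho>))"
      by (simp add: emeasure_eq_measure)
    moreover have nonneg: "0 \<le> tail (a * v \<rho>) - tail (c * v \<rho>)" using tail_mono[of "a * v \<rho>" "c * v \<rho>"] abc by simp
    moreover have "emeasure lborel V = ennreal (measure lborel V)" using finV by (simp add: emeasure_eq_ennreal_measure less_top[symmetric])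
    ultimately have "emeasure \<Lambda> A = ennreal (\<gamma> * ((\<rho> ^ DIM('a) * measure lborel V) * (tail (a * v \<rho>) - tail (c * v \<rho>))))"
      unfolding A_def using scaled rays V elim gamma_pos
      by (subst intensity_times) (auto simp: mark emeasure_scaled_set ennreal_mult)
    then have mA: "measure \<Lambda> A = \<gamma> * ((\<rho> ^ DIM('a) * measure lborel V) * (tail (a * v \<rho>) - tail (c * v \<rho>)))"
      using nonneg gamma_pos elim by (simp add: measure_def)
    have eB: "emeasure \<Lambda> B = ennreal (\<gamma> * (\<rho> ^ DIM('a) * tail (b * v \<rho>)))"
      unfolding B_def using scaled rays elim gamma_pos W_sets
      by (subst intensity_times) (auto simp: emeasure_scaled_set volume_W ennreal_mult tail_def emeasure_eq_measure)
    then have mB: "measure \<Lambda> B = \<gamma> * (\<rho> ^ DIM('a) * tail (b * v \<rho>))"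
      using gamma_pos elim tail_nonneg by (simp add: measure_def)
    have "P.prob {\<omega>\<in>space P. cnt A \<omega> = 1 \<and> cnt (B - A) \<omega> = 0} = measure \<Lambda> A * exp (- measure \<Lambda> (A \<union> (B - A)))"
      by (rule prob_one_in_none_in) (auto simp: AB[unfolded Un_Diff_cancel] eB)
    also have "\<dots> = F \<rho>" unfolding AB mA mB F_def by (simp add: algebra_simps)
    finally show ?case unfolding A_def B_def by simp
  qed
  ultimately show ?thesis by (rule Lim_transform_eventually)
qed

text \<open>The geometric core at scale \<open>v\<close>. The slack \<open>(d + a) v\<close> is the diameter \<open>d v\<close> of the cubes, lost when
replacing the nucleus by the corner of its cube, plus the margin \<open>a v\<close> that protects the cell.\<close>

lemma rescaled_max_in_box:
  fixes a s h \<kappa> R0 R :: real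
  assumes \<omega>: "\<omega> \<in> space P" and \<rho>: "\<rho> \<ge> 1" and v: "v \<rho> > 0" "v \<rho> \<le> \<rho>"
    and V: "V \<in> sets borel" "V \<subseteq> W" and a: "a > 0" and s: "s > 1"
    and one: "cnt ((\<lambda>x. \<rho> *\<^sub>R x) ` V \<times> {a * v \<rho><..s * a * v \<rho>}) \<omega> = 1"
    and none: "cnt ((\<lambda>x. \<rho> *\<^sub>R x) ` W \<times> {a / s ^ 3 * v \<rho><..}
                 - (\<lambda>x. \<rho> *\<^sub>R x) ` V \<times> {a * v \<rho><..s * a * v \<rho>}) \<omega> = 0"
    and \<kappa>: "0 < \<kappa>" "\<kappa> \<le> 1 / 2" "1 + \<kappa> \<le> s"
    and h: "h > 0" "DIM('a) * h \<le> \<kappa> * (a / s ^ 3)"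
    and R: "W \<subseteq> cball 0 R0" "R0 + s * a \<le> R"
    and hole: "no_hole (h * v \<rho>) (R * \<rho> / (h * v \<rho>)) \<omega>"
    and interf: "no_interference (v \<rho>) (R * \<rho> / v \<rho>) (a * sqrt (1 - 1 / s\<^sup>2) * v \<rho>) ((real DIM('a) + a) * v \<rho>) \<omega>"
  shows "rescaled_max \<rho> \<omega> \<in> box_near_diagonal V a s"
proof -
  define \<phi> where "\<phi> = points (\<eta> \<omega>)"
  define A where "A = (\<lambda>x. \<rho> *\<^sub>R x) ` W"
  define B where "B = (\<lambda>x. \<rho> *\<^sub>R x) ` V \<times> {a * v \<rho><..s * a * v \<rho>}"
  define C where "C = A \<times> {a / s ^ 3 * v \<rho><..}"
  obtain e :: 'a where e: "norm e = 1" using nonempty_Basis norm_Basis by blast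
  have s3: "1 < s ^ 3" using s by (simp add: one_less_power)
  have order: "0 < a / s ^ 3" "a / s ^ 3 < a" "a < s * a" using a s s3 by (auto simp: divide_less_eq)
  have order': "a / s ^ 3 * v \<rho> < a * v \<rho>" "0 < a / s ^ 3 * v \<rho>" using order v by (auto simp del: times_divide_eq_left)
  have scaled: "(\<lambda>x. \<rho> *\<^sub>R x) ` V \<in> sets borel" "A \<in> sets borel"
    using \<rho> V W_sets unfolding A_def by (auto intro!: scaled_set_sets)
  have mark: "{a * v \<rho><..s * a * v \<rho>} \<in> sets Q" "{a / s ^ 3 * v \<rho><..} \<in> sets Q"
    using order' by (auto simp: sets_Q_iff)
  have B: "B \<in> sets \<Lambda>" and C: "C \<in> sets \<Lambda>"
    unfolding B_def C_def using scaled mark by (auto intro!: times_sets)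
  have marks: "0 \<le> t" if "(y, t) \<in> \<phi>" for y t
    using that space_kernel[OF \<omega>] by (auto simp: \<phi>_def points_def space_\<Lambda>)
  have "cnt B \<omega> > 0" using one by (simp add: B_def)
  then obtain x m where p: "(x, m) \<in> \<phi>" "(x, m) \<in> B"
    using exists_point_iff[OF \<omega> B] by (auto simp: \<phi>_def)
  then have xA: "x \<in> A" and m: "a * v \<rho> < m" "m \<le> s * a * v \<rho>" and xV: "(1 / \<rho>) *\<^sub>R x \<in> V"
    using V \<rho> by (auto simp: B_def A_def)
  have normA: "norm y \<le> R0 * \<rho>" if "y \<in> A" for y
    using that R \<rho> by (auto simp: A_def mult.commute subset_eq intro!: mult_right_mono)
  have sa: "s * a * v \<rho> \<le> s * a * \<rho>" using v a s by (intro mult_left_mono) auto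
  have R\<rho>: "R0 * \<rho> + s * a * \<rho> \<le> R * \<rho>" using mult_right_mono[OF R(2), of \<rho>] \<rho> by (simp add: algebra_simps)
  have others: "t \<le> a * v \<rho> / s ^ 3" if yt: "(y, t) \<in> \<phi>" "y \<in> A" "(y, t) \<noteq> (x, m)" for y t
  proof (rule ccontr)
    assume "\<not> t \<le> a * v \<rho> / s ^ 3"
    then have yC: "(y, t) \<in> C" using yt by (simp add: C_def)
    have "(y, t) \<notin> C - B"
      using exists_point_iff[OF \<omega>, of "C - B"] none B C yt(1) by (auto simp: A_def B_def C_def \<phi>_def)
    then have "(y, t) \<in> B" using yC by blast
    then have "2 \<le> cnt B \<omega>" using two_points_count[OF \<omega> B] p yt(1,3) unfolding \<phi>_def by metis
    then show False using one by (simp add: B_def)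
  qed
  have far: "t \<le> a * v \<rho> * sqrt (1 - 1 / s\<^sup>2) \<or> t \<le> norm (y - x) - a * v \<rho>"
    if yt: "(y, t) \<in> \<phi>" "(y, t) \<noteq> (x, m)" for y t
  proof -
    have "1 < s\<^sup>2" using s by (simp add: one_less_power)
    then have "1 / s\<^sup>2 < 1" "0 \<le> 1 / s\<^sup>2" using s by (simp_all add: divide_less_eq)
    then have sq: "0 < sqrt (1 - 1 / s\<^sup>2)" "sqrt (1 - 1 / s\<^sup>2) \<le> 1" by auto
    have "t \<le> a * sqrt (1 - 1 / s\<^sup>2) * v \<rho> \<or> t \<le> norm (y - x) - ((real DIM('a) + a) * v \<rho> - DIM('a) * v \<rho>)"
    proof (rule no_interference_far[OF interf \<omega> v(1)])
      show "0 < a * sqrt (1 - 1 / s\<^sup>2) * v \<rho>" using a sq v by simp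
      show "DIM('a) * v \<rho> \<le> (real DIM('a) + a) * v \<rho>" using a v by (intro mult_right_mono) auto
      show "(x, m) \<in> points (\<eta> \<omega>)" using p by (simp add: \<phi>_def)
      show "(y, t) \<in> points (\<eta> \<omega>)" "(y, t) \<noteq> (x, m)" using yt by (auto simp: \<phi>_def)
      have "0 \<le> s * a * \<rho>" using s a \<rho> by simp
      then show "norm x \<le> R * \<rho> / v \<rho> * v \<rho>" using normA[OF xA] R\<rho> v by simp
      have "a * v \<rho> * sqrt (1 - 1 / s\<^sup>2) \<le> a * v \<rho> * 1" using sq a v by (intro mult_left_mono) auto
      then show "a * sqrt (1 - 1 / s\<^sup>2) * v \<rho> < m" using m by (simp add: mult_ac)
    qed
    then show ?thesis by (simp add: algebra_simps)
  qed
  have filled: "\<exists>y' t. (y', t) \<in> \<phi> \<and> norm (y' - (y + c *\<^sub>R e)) \<le> \<kappa> * (a * v \<rho> / s ^ 3)"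
    if c: "c = a * v \<rho> / s ^ 3 \<or> c = s * (a * v \<rho>)" and y: "y \<in> A" for c y
  proof -
    have "a / s ^ 3 * v \<rho> \<le> s * a * v \<rho>" 
      using less_trans[OF order(2,3)] v by (intro mult_right_mono) auto
    then have "a * v \<rho> / s ^ 3 \<le> s * a * v \<rho>" by simp
    moreover have "0 \<le> c" using c order' a s v by auto
    ultimately have "norm (c *\<^sub>R e) \<le> s * a * \<rho>" using c e sa by (auto simp: mult.assoc)
    then have "norm (y + c *\<^sub>R e) \<le> R * \<rho>" using normA[OF y] R\<rho> norm_triangle_ineq[of y "c *\<^sub>R e"] by linarith
    then have "norm (y + c *\<^sub>R e) \<le> R * \<rho> / (h * v \<rho>) * (h * v \<rho>)" using h v by simp
    from no_hole_point[OF hole \<omega> _ this] h v obtain y' t where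
      y': "(y', t) \<in> \<phi>" "norm (y' - (y + c *\<^sub>R e)) \<le> DIM('a) * (h * v \<rho>)"
      by (auto simp: \<phi>_def)
    have "(DIM('a) * h) * v \<rho> \<le> (\<kappa> * (a / s ^ 3)) * v \<rho>" using h v by (intro mult_right_mono) auto
    then show ?thesis using y' by (intro exI[of _ y'] exI[of _ t]) (simp add: mult.assoc)
  qed
  obtain r where r: "max_triple A \<phi> = (x, m, r)" "a * v \<rho> / s \<le> r" "r \<le> s\<^sup>2 * (a * v \<rho>)"
    using max_triple_of_dominant_mark[of x m \<phi> A "a * v \<rho>" s e \<kappa>]
      p(1) xA a v m s marks others far e \<kappa> filled by (auto simp: mult.assoc)
  have "rescaled_max \<rho> \<omega> = ((1 / \<rho>) *\<^sub>R x, m / v \<rho>, r / v \<rho>)"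
    unfolding rescaled_max_def A_def[symmetric] \<phi>_def[symmetric] r by simp
  moreover have "a < m / v \<rho>" "m / v \<rho> \<le> s * a" using m v by (auto simp: field_simps)
  moreover have "a / s \<le> r / v \<rho>" "r / v \<rho> \<le> s\<^sup>2 * a" using r v by (auto simp: field_simps)
  ultimately show ?thesis using xV by (simp add: box_near_diagonal_def)
qed

text \<open>The single exceedance has the limiting probability on the right, and the two exceptional events
are asymptotically negligible.\<close>

lemma prob_box_lower:
  fixes a s :: real
  assumes V: "V \<in> sets borel" "V \<subseteq> W" and a: "a > 0" and s: "s > 1"
    and l: "l < measure lborel V * (a powr (- \<alpha>) - (s * a) powr (- \<alpha>)) * exp (- ((a / s ^ 3) powr (- \<alpha>)))"
  shows "eventually (\<lambda>\<rho>. l < P.prob {\<omega>\<in>space P. rescaled_max \<rho> \<omega> \<in> box_near_diagonal V a s}) at_top"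
proof -
  define \<kappa> where "\<kappa> = min (s - 1) (1 / 2)"
  have \<kappa>: "0 < \<kappa>" "\<kappa> \<le> 1 / 2" "1 + \<kappa> \<le> s" using s by (auto simp: \<kappa>_def min_def)
  \<comment> \<open>Cubes of mesh \<open>h v\<close> have diameter at most \<open>\<kappa>\<close> times the smallest mark level.\<close>
  define h where "h = \<kappa> * (a / s ^ 3) / DIM('a)"
  have h: "h > 0" "DIM('a) * h \<le> \<kappa> * (a / s ^ 3)" using \<kappa> a s by (auto simp: h_def)
  obtain R0 where R0': "R0 > 0" "\<And>x. x \<in> W \<Longrightarrow> norm x \<le> R0"
    using compact_imp_bounded[OF compact_W] unfolding bounded_pos by blast
  then have R0: "W \<subseteq> cball 0 R0" "R0 > 0" by auto
  \<comment> \<open>Since \<open>v \<le> \<rho>\<close>, the ball of radius \<open>R \<rho>\<close> contains \<open>\<rho> W\<close> together with all test points at distance at most \<open>s a v\<close>.\<close>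
  define R where "R = R0 + s * a + h + 1"
  have sa: "0 < s * a" using s a by simp
  have R: "R0 + s * a \<le> R" "h \<le> R" "1 \<le> R" using R0 h sa by (auto simp: R_def)
  have s3: "1 < s ^ 3" using s by (simp add: one_less_power)
  have order: "0 < a / s ^ 3" "a / s ^ 3 < a" "a < s * a" using a s s3 by (auto simp: divide_less_eq)
  define A1 where "A1 \<rho> = (\<lambda>x. \<rho> *\<^sub>R x) ` V \<times> {a * v \<rho><..s * a * v \<rho>}" for \<rho>
  define A2 where "A2 \<rho> = (\<lambda>x. \<rho> *\<^sub>R x) ` W \<times> {a / s ^ 3 * v \<rho><..} - A1 \<rho>" for \<rho>
  define G where "G \<rho> = {\<omega>\<in>space P. cnt (A1 \<rho>) \<omega> = 1 \<and> cnt (A2 \<rho>) \<omega> = 0}" for \<rho>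
  define H where "H \<rho> = {\<omega>\<in>space P. \<not> no_hole (h * v \<rho>) (R * \<rho> / (h * v \<rho>)) \<omega>}" for \<rho>
  define u where "u = a * sqrt (1 - 1 / s\<^sup>2)"
  have "1 < s\<^sup>2" using s by (simp add: one_less_power)
  then have "1 / s\<^sup>2 < 1" using s by (simp add: divide_less_eq)
  then have u: "u > 0" using a by (simp add: u_def)
  define I where "I \<rho> = {\<omega>\<in>space P. \<not> no_interference (v \<rho>) (R * \<rho> / v \<rho>) (u * v \<rho>) ((real DIM('a) + a) * v \<rho>) \<omega>}" for \<rho>
  have "((\<lambda>\<rho>. P.prob (G \<rho>)) \<longlongrightarrow> measure lborel V * (a powr (- \<alpha>) - (s * a) powr (- \<alpha>)) * exp (- ((a / s ^ 3) powr (- \<alpha>)))) at_top"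
    unfolding G_def A1_def A2_def by (rule prob_single_exceedance[OF V order])
  moreover have "((\<lambda>\<rho>. P.prob (H \<rho>)) \<longlongrightarrow> 0) at_top"
    unfolding H_def by (rule no_hole_asymp[OF h(1) R(2)])
  moreover have "((\<lambda>\<rho>. P.prob (I \<rho>)) \<longlongrightarrow> 0) at_top"
    unfolding I_def using a by (intro no_interference_asymp u R(3)) auto
  ultimately have "((\<lambda>\<rho>. P.prob (G \<rho>) - P.prob (H \<rho>) - P.prob (I \<rho>)) \<longlongrightarrow>
      measure lborel V * (a powr (- \<alpha>) - (s * a) powr (- \<alpha>)) * exp (- ((a / s ^ 3) powr (- \<alpha>))) - 0 - 0) at_top"
    by (intro tendsto_diff)
  then have "eventually (\<lambda>\<rho>. l < P.prob (G \<rho>) - P.prob (H \<rho>) - P.prob (I \<rho>)) at_top"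
    using l by (auto dest: order_tendstoD)
  then show ?thesis using scale_ge[of 1] scale_le_index eventually_ge_at_top[of 1]
  proof eventually_elim
    case (elim \<rho>)
    have [measurable]: "rescaled_max \<rho> \<in> borel_measurable P"
      using elim by (intro rescaled_max_measurable) simp
    note [measurable] = box_near_diagonal_sets[OF V(1)]
    have uv: "0 \<le> u * v \<rho>" using u elim by simp
    have sets_box: "{\<omega>\<in>space P. rescaled_max \<rho> \<omega> \<in> box_near_diagonal V a s} \<in> sets P"
      by measurable
    have sets_H: "H \<rho> \<in> sets P" unfolding H_def by measurable
    have sets_I: "I \<rho> \<in> sets P" unfolding I_def using no_interference_measurable[OF uv] by measurable
    have "G \<rho> \<subseteq> {\<omega>\<in>space P. rescaled_max \<rho> \<omega> \<in> box_near_diagonal V a s} \<union> (H \<rho> \<union> I \<rho>)"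
    proof
      fix \<omega> assume "\<omega> \<in> G \<rho>"
      then show "\<omega> \<in> {\<omega>\<in>space P. rescaled_max \<rho> \<omega> \<in> box_near_diagonal V a s} \<union> (H \<rho> \<union> I \<rho>)"
        using rescaled_max_in_box[of \<omega> \<rho> V a s \<kappa> h R0 R] elim V a s \<kappa> h R0 R
        unfolding G_def A1_def A2_def H_def I_def u_def by auto
    qed
    then have "P.prob (G \<rho>) \<le> P.prob ({\<omega>\<in>space P. rescaled_max \<rho> \<omega> \<in> box_near_diagonal V a s} \<union> (H \<rho> \<union> I \<rho>))"
      using sets_box sets_H sets_I by (intro P.finite_measure_mono) auto
    also have "\<dots> \<le> P.prob {\<omega>\<in>space P. rescaled_max \<rho> \<omega> \<in> box_near_diagonal V a s} + (P.prob (H \<rho>) + P.prob (I \<rho>))"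
      using sets_box sets_H sets_I by (intro order_trans[OF measure_Un_le] add_left_mono measure_Un_le) auto
    finally show ?case using elim by linarith
  qed
qed

end

theorem corollary1p5:
  fixes W :: "'a::euclidean_space set" and \<gamma> \<alpha> :: real and Q :: "real measure"
    and P :: "'w measure" and \<eta> :: "'w \<Rightarrow> ('a \<times> real) measure"
    and P' :: "'v measure" and X :: "'v \<Rightarrow> 'a" and F :: "'v \<Rightarrow> real"
  assumes "DIM('a) \<ge> 2" and "\<gamma> > 0"
    and "compact W" and "convex W" and "emeasure lborel W = 1"
    and "prob_space Q" and "sets Q = sets (restrict_space borel {0..})"
    and "poisson_process P (scale_measure (ennreal \<gamma>) (lborel \<Otimes>\<^sub>M Q)) \<eta>"
    and "regularly_varying_tail Q \<alpha>" and "\<alpha> > real DIM('a)"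
    and "AE m in Q. m > 0"
    and "prob_space P'"
    and "X \<in> borel_measurable P'" and "F \<in> borel_measurable P'"
    and "distr P' borel X = uniform_measure lborel W"
    and "\<And>u. u \<ge> 0 \<Longrightarrow>
           measure P' {\<omega>\<in>space P'. F \<omega> \<le> u} = (if u = 0 then 0 else exp (- (u powr (- \<alpha>))))"
    and "independent_variables P' X F"
  shows "converges_in_distribution P
           (\<lambda>\<rho> \<omega>. case max_triple ((\<lambda>x. \<rho> *\<^sub>R x) ` W) (points (\<eta> \<omega>)) of (x, m, r) \<Rightarrow>
              ((1 / \<rho>) *\<^sub>R x, m / q_scale Q \<gamma> \<alpha> DIM('a) \<rho>, r / q_scale Q \<gamma> \<alpha> DIM('a) \<rho>))
           (distr P' borel (\<lambda>\<omega>. (X \<omega>, F \<omega>, F \<omega>)))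
           (at_top :: real filter)"
proof -
  interpret prob_space Q by (rule assms(6))
  interpret poisson_laguerre Q \<alpha> \<gamma> W P \<eta>
    using assms by unfold_locales auto
  interpret limit: prob_space P' by (rule assms(12))
  interpret limit: uniform_frechet P' X F W \<alpha>
    using assms alpha_pos by unfold_locales auto
  have "converges_in_distribution P rescaled_max (distr P' borel (\<lambda>\<omega>. (X \<omega>, F \<omega>, F \<omega>))) at_top"
  proof (rule limit.converges_of_box_bounds[OF P.prob_space_axioms])
    show "eventually (\<lambda>\<rho>. rescaled_max \<rho> \<in> borel_measurable P) at_top"
      using eventually_gt_at_top[of 0] by eventually_elim (rule rescaled_max_measurable)
  qed (rule prob_box_lower)
  then show ?thesis by (simp add: rescaled_max_def[abs_def])
qed

end
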